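(* Let $d\ge 2$. For every probability measure $P$ on $(\mathbb{R}^d,\mathcal{B}^d)$ there exists a pair $(\theta,U)\in\mathbb{R}^d\times\mathbb{O}(d)$ that is a solution of the quarter median problem for $P$.
   Context: $\mathcal{B}^d$ is the Borel $\sigma$-field of $\mathbb{R}^d$. Vectors are columns, $x^{t}$ denotes the transpose, $\langle x,y\rangle=x^{t}y$, $\mathbb{S}_{d-1}$ is the Euclidean unit sphere in $\mathbb{R}^d$, and $\mathbb{O}(d)$ is the group of orthogonal $d\times d$ matrices. For $a\in\mathbb{R}^d$ and $b\in\mathbb{S}_{d-1}$ let $H_-(a;b)=\{x\in\mathbb{R}^d:\langle b,x-a\rangle\le 0\}$ and $H_+(a;b)=\{x\in\mathbb{R}^d:\langle b,x-a\rangle\ge 0\}$. For orthogonal $b,b'\in\mathbb{S}_{d-1}$ and signs $\sigma,\sigma'\in\{+,-\}$ let $V_{\sigma\sigma'}(a;b,b')=H_\sigma(a;b)\cap H_{\sigma'}(a;b')$ (quarter spaces). A pair $(\theta,U)\in\mathbb{R}^d\times\mathbb{O}(d)$, where $U$ has rows $b_1^{t},\ldots,b_d^{t}$, is a solution of the quarter median problem for a probability measure $P$ on $(\mathbb{R}^d,\mathcal{B}^d)$ if (i) $P(H_+(\theta;b_i))\ge 1/2$ and $P(H_-(\theta;b_i))\ge 1/2$ for $1\le i\le d$, and (ii) $P(V_{\sigma\sigma'}(\theta;b_i,b_j))\ge 1/4$ for $1\le i<j\le d$ and all four sign combinations $\sigma,\sigma'\in\{+,-\}$. *)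

theory Defs
  imports "HOL-Probability.Probability"
begin

datatype sign = Plus | Minus

fun half_space :: "sign \<Rightarrow> real ^ 'n \<Rightarrow> real ^ 'n \<Rightarrow> (real ^ 'n) set" where
  "half_space Plus a b = {x. b \<bullet> (x - a) \<ge> 0}"
| "half_space Minus a b = {x. b \<bullet> (x - a) \<le> 0}"

text \<open>
  The directions are meant to be unit vectors, and orthogonal to each other in
  \<open>quarter_space\<close>. Both definitions are total; below they are applied only to rows of
  an orthogonal matrix, which satisfy these conditions.
\<close>

definition quarter_space ::
  "sign \<Rightarrow> sign \<Rightarrow> real ^ 'n \<Rightarrow> real ^ 'n \<Rightarrow> real ^ 'n \<Rightarrow> (real ^ 'n) set" where
  "quarter_space s s' a b b' = half_space s a b \<inter> half_space s' a b'"

text \<open>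
  The finite index type \<open>'n\<close> carries no order, so the pairs \<open>i < j\<close> become pairs
  \<open>i \<noteq> j\<close>. As all four sign combinations are required, and
  \<open>quarter_space s s' a b b' = quarter_space s' s a b' b\<close>, the condition for \<open>(j, i)\<close> is
  the condition for \<open>(i, j)\<close>.
\<close>

definition quarter_median_solution ::
  "(real ^ 'n) measure \<Rightarrow> real ^ 'n \<Rightarrow> real ^ 'n ^ 'n \<Rightarrow> bool" where
  "quarter_median_solution P \<theta> U \<longleftrightarrow>
     orthogonal_matrix U \<and>
     (\<forall>i. measure P (half_space Plus \<theta> (row i U)) \<ge> 1 / 2 \<and>
          measure P (half_space Minus \<theta> (row i U)) \<ge> 1 / 2) \<and>
     (\<forall>i j. i \<noteq> j \<longrightarrow>
        (\<forall>s s'. measure P (quarter_space s s' \<theta> (row i U) (row j U)) \<ge> 1 / 4))"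

end

theory Submission
  imports Defs
begin

text \<open>
Replace the sign of \<open>\<langle>b, x\<rangle> - m\<close> by the continuous odd function \<open>y / (\<epsilon> + |y|)\<close>. Every direction \<open>b\<close> then
has a unique soft median \<open>m(b)\<close>, which depends continuously on \<open>b\<close> and is odd in \<open>b\<close>, and the
expectation \<open>f(U)\<^sub>i\<^sub>j\<close> of the product of the two soft signs along the rows \<open>i\<close> and \<open>j\<close> of a matrix \<open>U\<close>
is continuous, symmetric in \<open>i, j\<close>, and transforms by the obvious signed permutation when the rows
of \<open>U\<close> are permuted and multiplied by signs. An orthogonal \<open>U\<close> at which all off-diagonal entries
of \<open>f\<close> vanish is a soft quarter median: the four products \<open>(1 \<plusminus> \<psi>\<^sub>i)(1 \<plusminus> \<psi>\<^sub>j) / 4\<close> of the soft signs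
\<open>\<psi>\<close> all have expectation \<open>1/4\<close>. As \<open>\<epsilon> \<rightarrow> 0\<close> such solutions stay in a compact set, and in the limit each product is
dominated by the indicator of a closed quarter space (lemma \<open>measure_ge_limit\<close>), whatever the
measure \<open>P\<close> is.

The heart of the matter is the theorem \<open>equivariant_common_zero\<close>: every continuous, symmetric and
equivariant \<open>f\<close> has an orthogonal matrix among the common zeros of its off-diagonal entries.
There are as many pairs of rows as dimensions of the orthogonal group, and for
\<open>f\<^sub>0(U) = U A U\<^sup>t\<close> with \<open>A\<close> diagonal with distinct entries the zeros are exactly the signed
permutation matrices. They form a single orbit of the group \<open>G\<close> of signed permutations, which acts
freely near the orthogonal group, and they are non-degenerate. The number of orbits of zeros
modulo 2 is a homotopy invariant, so \<open>f\<close> has a zero as well. Integer degrees would not suffice: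
odd permutations reverse the relevant orientation, so that the signed count is zero.

The parity argument is carried out combinatorially in the space of all matrices, where the
orthogonality of the rows is imposed by further \<open>d(d+1)/2\<close> equations; this avoids manifolds and
keeps \<open>G\<close> acting linearly. The space of \<open>d \<times> d\<close> matrices times an interval is triangulated by the chains
of faces of a cubical grid. This triangulation is invariant under \<open>G\<close>, and each facet of a simplex
lies in two simplices, or in one if it is part of the bottom or the top
(\<open>facet_in_two_simplices\<close>). For a generic vertex map a simplex with a facet whose values have the
origin in their convex hull has exactly two such facets (\<open>card_balanced_facets\<close>). Double
counting, together with the free action of \<open>G\<close>, shows that the number of such facets in the bottom and top
layers is divisible by \<open>2 |G|\<close> (\<open>parity_obstruction\<close>). If \<open>f\<close> has no zero and the mesh is fine, the
top layer, which carries \<open>f\<close>, contributes nothing, while the bottom layer, which carries a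
slight modification of \<open>f\<^sub>0\<close>, contributes exactly \<open>|G|\<close>: a contradiction.
\<close>

section \<open>Chains of cubical cells\<close>

text \<open>
An integer vector encodes a face of the cubical grid with vertices in the even integers: an even
coordinate is a fixed position and an odd one is the open edge between its two even neighbours.
The order is inclusion of faces, and chains of faces are the simplices of the barycentric
subdivision of the grid.
\<close>

definition cell_le :: "('m \<Rightarrow> int) \<Rightarrow> ('m \<Rightarrow> int) \<Rightarrow> bool" where
  "cell_le v w \<longleftrightarrow> (\<forall>i. v i = w i \<or> (even (v i) \<and> odd (w i) \<and> \<bar>v i - w i\<bar> = 1))"

definition cell_dim :: "('m::finite \<Rightarrow> int) \<Rightarrow> nat" where
  "cell_dim v = card {i. odd (v i)}"

text \<open>
The coordinate \<open>p\<close> plays the role of time. In the slab it takes only the values 0 and 1, the start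
and the end of a homotopy. A single step in time suffices because only the two end layers have to be
fine.
\<close>

definition slab :: "'m \<Rightarrow> ('m \<Rightarrow> int) set" where
  "slab p = {v. v p = 0 \<or> v p = 1}"

definition cell_chain :: "'m \<Rightarrow> ('m \<Rightarrow> int) set \<Rightarrow> bool" where
  "cell_chain p S \<longleftrightarrow> S \<subseteq> slab p \<and> (\<forall>v\<in>S. \<forall>w\<in>S. cell_le v w \<or> cell_le w v)"

lemma cell_le_refl: "cell_le v v"
  by (simp add: cell_le_def)

lemma cell_le_trans:
  assumes "cell_le u v" "cell_le v w" shows "cell_le u w"
  using assms unfolding cell_le_def by metis

lemma cell_le_odd: "cell_le v w \<Longrightarrow> odd (v i) \<Longrightarrow> w i = v i"
  unfolding cell_le_def by metis

lemma cell_dim_mono: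
  assumes "cell_le v w" shows "cell_dim v \<le> cell_dim w"
  unfolding cell_dim_def
  by (rule card_mono) (use assms in \<open>auto simp: cell_le_def, metis\<close>)

lemma cell_le_dim_eq:
  assumes "cell_le v w" "cell_dim v = cell_dim w" shows "v = w"
proof -
  have "{i. odd (v i)} \<subseteq> {i. odd (w i)}"
    using assms(1) by (auto dest: cell_le_odd)
  then have "{i. odd (v i)} = {i. odd (w i)}"
    using assms(2) by (intro card_subset_eq) (auto simp: cell_dim_def)
  then show ?thesis
    using assms(1) unfolding cell_le_def by (intro ext) blast
qed

lemma cell_dim_le: "cell_dim (v :: 'm::finite \<Rightarrow> int) \<le> CARD('m)"
  unfolding cell_dim_def by (rule card_mono) auto

lemma cell_chain_subset: "cell_chain p S \<Longrightarrow> T \<subseteq> S \<Longrightarrow> cell_chain p T"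
  unfolding cell_chain_def by blast

lemma cell_chain_inj_dim:
  assumes "cell_chain p S" shows "inj_on cell_dim S"
  using assms cell_le_dim_eq unfolding cell_chain_def inj_on_def by metis

lemma cell_chain_le:
  assumes "cell_chain p S" "v \<in> S" "w \<in> S" "cell_dim v \<le> cell_dim w"
  shows "cell_le v w"
  using assms cell_le_dim_eq cell_dim_mono unfolding cell_chain_def
  by (metis cell_le_refl le_antisym)

lemma cell_chain_finite:
  assumes "cell_chain p (S :: ('m::finite \<Rightarrow> int) set)" shows "finite S"
proof (rule finite_imageD)
  show "finite (cell_dim ` S)"
    by (rule finite_subset[of _ "{..CARD('m)}"]) (auto simp: cell_dim_le)
qed (rule cell_chain_inj_dim[OF assms])

lemma cell_chain_near:
  assumes "cell_chain p S" "v \<in> S" "w \<in> S"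
  shows "\<bar>v i - w i\<bar> \<le> 1"
  using assms unfolding cell_chain_def cell_le_def by (smt (verit))

lemma cell_chain_insert:
  assumes "cell_chain p F" "x \<in> slab p" "\<forall>v\<in>F. cell_le v x \<or> cell_le x v"
  shows "cell_chain p (insert x F)"
  using assms unfolding cell_chain_def by (auto simp: cell_le_refl)

lemma dim_0_even: "cell_dim v = 0 \<Longrightarrow> even (v i)"
  unfolding cell_dim_def by auto

lemma dim_top_odd: "cell_dim (v :: 'm::finite \<Rightarrow> int) = CARD('m) \<Longrightarrow> odd (v i)"
proof -
  assume "cell_dim v = CARD('m)"
  then have "{i. odd (v i)} = UNIV"
    unfolding cell_dim_def by (intro card_subset_eq) auto
  then show ?thesis by auto
qed

lemma cell_chain_missing_dim:
  fixes F :: "('m::finite \<Rightarrow> int) set"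
  assumes "cell_chain p F" "card F = CARD('m)"
  obtains r where "r \<le> CARD('m)" "cell_dim ` F = {..CARD('m)} - {r}"
proof -
  have c: "card (cell_dim ` F) = CARD('m)"
    using cell_chain_inj_dim[OF assms(1)] assms(2) by (simp add: card_image)
  have s: "cell_dim ` F \<subseteq> {..CARD('m)}" by (auto simp: cell_dim_le)
  have "card ({..CARD('m)} - cell_dim ` F) = 1"
    using card_Diff_subset[OF _ s] c by (simp add: cell_chain_finite[OF assms(1)])
  then obtain r where "{..CARD('m)} - cell_dim ` F = {r}"
    by (auto simp: card_1_singleton_iff)
  then show ?thesis using s that by blast
qed

text \<open>
A facet misses exactly one dimension, and completing it to a maximal simplex means choosing a cell
of that dimension comparable with all the others. Which cells are available depends on whether
the missing dimension is the lowest, the highest or an intermediate one.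
\<close>

definition extenders :: "'m::finite \<Rightarrow> ('m \<Rightarrow> int) set \<Rightarrow> ('m \<Rightarrow> int) set" where
  "extenders p F = {x \<in> slab p. x \<notin> F \<and> (\<forall>v\<in>F. cell_le v x \<or> cell_le x v)}"

lemma card_superchains:
  fixes F :: "('m::finite \<Rightarrow> int) set"
  assumes "cell_chain p F" "card F = CARD('m)"
  shows "card {S. cell_chain p S \<and> card S = CARD('m) + 1 \<and> F \<subseteq> S} = card (extenders p F)"
proof -
  have fin: "finite F" by (rule cell_chain_finite[OF assms(1)])
  have "{S. cell_chain p S \<and> card S = CARD('m) + 1 \<and> F \<subseteq> S} = (\<lambda>x. insert x F) ` extenders p F"
  proof (intro set_eqI iffI)
    fix S assume "S \<in> {S. cell_chain p S \<and> card S = CARD('m) + 1 \<and> F \<subseteq> S}"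
    then have S: "cell_chain p S" "card S = CARD('m) + 1" "F \<subseteq> S" by auto
    have "card (S - F) = 1"
      using S assms(2) fin by (simp add: card_Diff_subset)
    then obtain x where "S - F = {x}" by (auto simp: card_1_singleton_iff)
    then have "x \<notin> F" "S = insert x F" "x \<in> S" using S(3) by auto
    then show "S \<in> (\<lambda>x. insert x F) ` extenders p F"
      using S unfolding extenders_def cell_chain_def by blast
  next
    fix S assume "S \<in> (\<lambda>x. insert x F) ` extenders p F"
    then show "S \<in> {S. cell_chain p S \<and> card S = CARD('m) + 1 \<and> F \<subseteq> S}"
      using assms fin by (auto simp: extenders_def intro!: cell_chain_insert)
  qed
  moreover have "inj_on (\<lambda>x. insert x F) (extenders p F)"
    unfolding inj_on_def extenders_def by blast
  ultimately show ?thesis by (simp add: card_image)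
qed

lemma extenders_dim:
  fixes F :: "('m::finite \<Rightarrow> int) set"
  assumes "cell_chain p F" "r \<le> CARD('m)" "cell_dim ` F = {..CARD('m)} - {r}"
  shows "extenders p F = {x \<in> slab p. cell_dim x = r \<and> (\<forall>v\<in>F. cell_le v x \<or> cell_le x v)}"
proof -
  have "cell_dim x = r" if "x \<notin> F" "\<forall>v\<in>F. cell_le v x \<or> cell_le x v" for x
  proof (rule ccontr)
    assume "cell_dim x \<noteq> r"
    then have "cell_dim x \<in> cell_dim ` F" using assms(3) cell_dim_le[of x] by auto
    then obtain v where "v \<in> F" "cell_dim v = cell_dim x" by auto
    then show False using that cell_le_dim_eq by metis
  qed
  moreover have "x \<notin> F" if "cell_dim x = r" for x
    using that assms(3) by auto
  ultimately show ?thesis unfolding extenders_def by blast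
qed

lemma cell_dim_flip_up:
  assumes "even (y i)" "odd (a::int)"
  shows "cell_dim (y(i := a)) = Suc (cell_dim (y :: 'm::finite \<Rightarrow> int))"
proof -
  have "{j. odd ((y(i := a)) j)} = insert i {j. odd (y j)}" using assms by auto
  then show ?thesis using assms by (simp add: cell_dim_def)
qed

text \<open>
The smallest cell of the facet is an edge, which has two end points. The only edges with just one
end point in the slab are those in the direction \<open>p\<close>, and a chain starting with such an edge lies
entirely in the layer \<open>p = 1\<close>.
\<close>

lemma card_extenders_bottom:
  fixes F :: "('m::finite \<Rightarrow> int) set"
  assumes F: "cell_chain p F" "cell_dim ` F = {..CARD('m)} - {0}"
  shows "card (extenders p F) = (if (\<forall>v\<in>F. v p = 0) \<or> (\<forall>v\<in>F. v p = 1) then 1 else 2)"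
proof -
  have sl: "F \<subseteq> slab p" using F(1) by (simp add: cell_chain_def)
  have "1 \<in> cell_dim ` F" "CARD('m) \<in> cell_dim ` F" using F(2) by auto
  then obtain z t where z: "z \<in> F" "cell_dim z = 1" and t: "t \<in> F" "cell_dim t = CARD('m)" by force
  have zle: "cell_le z v" if "v \<in> F" for v
  proof -
    have "cell_dim v \<noteq> 0" using that F(2) by (metis DiffE imageI singletonI)
    then show ?thesis using cell_chain_le[OF F(1) z(1) that] z(2) by simp
  qed
  obtain i where i: "{j. odd (z j)} = {i}"
    using z(2) unfolding cell_dim_def by (auto simp: card_1_singleton_iff)
  have tp: "t p = 1"
    using dim_top_odd[OF t(2), of p] sl t(1) unfolding slab_def by force
  have nz: "\<not> (\<forall>v\<in>F. v p = 0)" using tp t(1) by force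
  have ext: "extenders p F = {x \<in> slab p. cell_dim x = 0 \<and> cell_le x z}"
    unfolding extenders_dim[OF F(1) _ F(2), simplified]
    using z zle cell_le_trans cell_dim_mono
    by (smt (verit, best) Collect_cong le_zero_eq zero_neq_one)
  have iz: "odd (z i)" "\<And>j. j \<noteq> i \<Longrightarrow> even (z j)" using i by auto
  have down: "cell_dim x = 0 \<and> cell_le x z \<longleftrightarrow> x = z(i := z i - 1) \<or> x = z(i := z i + 1)" for x
  proof
    assume x: "cell_dim x = 0 \<and> cell_le x z"
    then have "x j = z j" if "j \<noteq> i" for j
      using iz(2)[OF that] unfolding cell_le_def by metis
    moreover have "x i = z i - 1 \<or> x i = z i + 1"
      using x dim_0_even[of x i] iz(1) unfolding cell_le_def by (smt (verit))
    ultimately show "x = z(i := z i - 1) \<or> x = z(i := z i + 1)" by (auto simp: fun_eq_iff)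
  next
    assume "x = z(i := z i - 1) \<or> x = z(i := z i + 1)"
    then have "even (x j)" "x j = z j \<or> even (x j) \<and> odd (z j) \<and> \<bar>x j - z j\<bar> = 1" for j
      using iz by (cases "j = i"; auto)+
    then show "cell_dim x = 0 \<and> cell_le x z"
      unfolding cell_dim_def cell_le_def by simp
  qed
  show ?thesis
  proof (cases "i = p")
    case True
    then have "z p = 1" using iz(1) sl z(1) unfolding slab_def by force
    then have "\<forall>v\<in>F. v p = 1" using zle cell_le_odd[of z _ p] by force
    moreover have "extenders p F = {z(p := 0)}"
      unfolding ext down using True \<open>z p = 1\<close> by (auto simp: slab_def)
    ultimately show ?thesis by simp
  next
    case False
    then have "z p = 0" using iz(2)[of p] sl z(1) unfolding slab_def by force
    then have "\<not> (\<forall>v\<in>F. v p = 1)" using z(1) by force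
    moreover have "extenders p F = {z(i := z i - 1), z(i := z i + 1)}"
      unfolding ext down using False \<open>z p = 0\<close> by (auto simp: slab_def)
    moreover have "z(i := z i - 1) \<noteq> z(i := z i + 1)"
      by (metis add_diff_cancel_left' diff_add_cancel fun_upd_same one_neq_neg_one add.commute add_left_cancel uminus_add_conv_diff)
    ultimately show ?thesis using nz by simp
  qed
qed

text \<open>
The largest cell of the facet is a wall, which has two sides. A wall orthogonal to \<open>p\<close> has only one
side in the slab, and a chain below such a wall lies entirely in the layer \<open>p = 0\<close>.
\<close>

lemma card_extenders_top:
  fixes F :: "('m::finite \<Rightarrow> int) set"
  assumes F: "cell_chain p F" "cell_dim ` F = {..CARD('m)} - {CARD('m)}"
  shows "card (extenders p F) = (if (\<forall>v\<in>F. v p = 0) \<or> (\<forall>v\<in>F. v p = 1) then 1 else 2)"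
proof -
  have m: "CARD('m) > 0" by simp
  have sl: "F \<subseteq> slab p" using F(1) by (simp add: cell_chain_def)
  have "0 \<in> cell_dim ` F" "CARD('m) - 1 \<in> cell_dim ` F"
    unfolding F(2) using m by (auto simp del: One_nat_def zero_less_card_finite)
  then obtain y b where y: "y \<in> F" "cell_dim y = CARD('m) - 1" and b: "b \<in> F" "cell_dim b = 0" by force
  have yle: "cell_le v y" if "v \<in> F" for v
  proof -
    have "cell_dim v \<in> {..CARD('m)} - {CARD('m)}" using that F(2) by blast
    then have "cell_dim v \<noteq> CARD('m)" by simp
    then have "cell_dim v \<le> CARD('m) - 1" using cell_dim_le[of v] by simp
    then show ?thesis using cell_chain_le[OF F(1) that y(1)] y(2) by simp
  qed
  have "card (- {j. odd (y j)}) = 1"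
    using y(2) m unfolding cell_dim_def Compl_eq_Diff_UNIV by (subst card_Diff_subset) auto
  then obtain i where i: "- {j. odd (y j)} = {i}"
    by (auto simp: card_1_singleton_iff)
  have bp: "b p = 0"
    using dim_0_even[OF b(2), of p] sl b(1) unfolding slab_def by force
  have no: "\<not> (\<forall>v\<in>F. v p = 1)" using bp b(1) by force
  have iy: "even (y i)" "\<And>j. j \<noteq> i \<Longrightarrow> odd (y j)" using i by auto
  have ynot: "\<not> cell_le x y" if "cell_dim x = CARD('m)" for x
    using cell_dim_mono[of x y] y(2) m that by linarith
  have ext: "extenders p F = {x \<in> slab p. cell_dim x = CARD('m) \<and> cell_le y x}"
    unfolding extenders_dim[OF F(1) _ F(2), simplified]
    using y(1) yle cell_le_trans ynot by blast
  have up: "cell_dim x = CARD('m) \<and> cell_le y x \<longleftrightarrow> x = y(i := y i - 1) \<or> x = y(i := y i + 1)" for x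
  proof
    assume x: "cell_dim x = CARD('m) \<and> cell_le y x"
    then have "x j = y j" if "j \<noteq> i" for j
      using iy(2)[OF that] unfolding cell_le_def by metis
    moreover have "x i = y i - 1 \<or> x i = y i + 1"
      using x dim_top_odd[of x i] iy(1) unfolding cell_le_def by (smt (verit))
    ultimately show "x = y(i := y i - 1) \<or> x = y(i := y i + 1)" by (auto simp: fun_eq_iff)
  next
    assume x: "x = y(i := y i - 1) \<or> x = y(i := y i + 1)"
    then have "cell_dim x = CARD('m)"
      using iy y(2) m cell_dim_flip_up[of y i] by auto
    moreover have "y j = x j \<or> even (y j) \<and> odd (x j) \<and> \<bar>y j - x j\<bar> = 1" for j
      using iy x by (cases "j = i") auto
    ultimately show "cell_dim x = CARD('m) \<and> cell_le y x"
      by (simp add: cell_le_def)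
  qed
  show ?thesis
  proof (cases "i = p")
    case True
    then have "y p = 0" using iy(1) sl y(1) unfolding slab_def by force
    then have "v p = 0" if "v \<in> F" for v
      using yle[OF that] sl that cell_le_odd[of v y p] unfolding slab_def by force
    moreover have "extenders p F = {y(p := 1)}"
      unfolding ext up using True \<open>y p = 0\<close> by (auto simp: slab_def)
    ultimately show ?thesis by simp
  next
    case False
    then have "y p = 1" using iy(2)[of p] sl y(1) unfolding slab_def by force
    then have "\<not> (\<forall>v\<in>F. v p = 0)" using y(1) by force
    moreover have "extenders p F = {y(i := y i - 1), y(i := y i + 1)}"
      unfolding ext up using False \<open>y p = 1\<close> by (auto simp: slab_def)
    moreover have "y(i := y i - 1) \<noteq> y(i := y i + 1)"
      by (metis add_diff_cancel_left' diff_add_cancel fun_upd_same one_neq_neg_one add.commute add_left_cancel uminus_add_conv_diff)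
    ultimately show ?thesis using no by simp
  qed
qed

text \<open>
Two cells whose dimensions differ by two have exactly two cells in between: one obtains them by
opening up either of the two coordinates in which the cells differ.
\<close>

lemma card_extenders_middle:
  fixes F :: "('m::finite \<Rightarrow> int) set"
  assumes F: "cell_chain p F" "cell_dim ` F = {..CARD('m)} - {r}" and r: "0 < r" "r < CARD('m)"
  shows "card (extenders p F) = (if (\<forall>v\<in>F. v p = 0) \<or> (\<forall>v\<in>F. v p = 1) then 1 else 2)"
proof -
  have sl: "F \<subseteq> slab p" using F(1) by (simp add: cell_chain_def)
  have "0 \<in> cell_dim ` F" "CARD('m) \<in> cell_dim ` F" "r - 1 \<in> cell_dim ` F" "r + 1 \<in> cell_dim ` F"
    using F(2) r by auto
  then obtain b t y z where b: "b \<in> F" "cell_dim b = 0" and t: "t \<in> F" "cell_dim t = CARD('m)"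
    and y: "y \<in> F" "cell_dim y = r - 1" and z: "z \<in> F" "cell_dim z = r + 1" by force
  have bp: "b p = 0"
    using dim_0_even[OF b(2), of p] sl b(1) unfolding slab_def by force
  have tp: "t p = 1"
    using dim_top_odd[OF t(2), of p] sl t(1) unfolding slab_def by force
  have nb: "\<not> ((\<forall>v\<in>F. v p = 0) \<or> (\<forall>v\<in>F. v p = 1))" using bp tp b(1) t(1) by force
  have yz: "cell_le y z" using cell_chain_le[OF F(1) y(1) z(1)] y z by simp
  have split: "cell_le v y \<or> cell_le z v" if "v \<in> F" for v
  proof -
    have "cell_dim v \<noteq> r" using that F(2) by (metis DiffE imageI singletonI)
    then have "cell_dim v \<le> r - 1 \<or> r + 1 \<le> cell_dim v" by linarith
    then show ?thesis
      using cell_chain_le[OF F(1) that y(1)] cell_chain_le[OF F(1) z(1) that] y z by auto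
  qed
  have n1: "\<not> cell_le x y" if "cell_dim x = r" for x
    using cell_dim_mono[of x y] y(2) r that by linarith
  have n2: "\<not> cell_le z x" if "cell_dim x = r" for x
    using cell_dim_mono[of z x] z(2) r that by linarith
  have ext: "extenders p F = {x \<in> slab p. cell_dim x = r \<and> cell_le y x \<and> cell_le x z}"
    unfolding extenders_dim[OF F(1) less_imp_le[OF r(2)] F(2)]
    using y(1) z(1) split cell_le_trans n1 n2 by blast
  define D where "D = {j. y j \<noteq> z j}"
  have D: "D = {j. odd (z j)} - {j. odd (y j)}"
    proof (rule set_eqI)
    fix k show "k \<in> D \<longleftrightarrow> k \<in> {j. odd (z j)} - {j. odd (y j)}"
      using yz[unfolded cell_le_def, rule_format, of k] by (auto simp: D_def)
  qed
  have sub: "{j. odd (y j)} \<subseteq> {j. odd (z j)}" using yz by (auto dest: cell_le_odd)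
  have "card D = 2"
    unfolding D using sub y(2) z(2) r by (subst card_Diff_subset) (auto simp: cell_dim_def)
  then obtain i j where ij: "D = {i, j}" "i \<noteq> j" by (auto simp: card_2_iff)
  have zi: "odd (z i)" "even (y i)" "odd (z j)" "even (y j)" using ij(1) unfolding D by auto
  have neqi: "y i \<noteq> z i" "y j \<noteq> z j" using ij(1) unfolding D_def by auto
  have eqs: "y k = z k" if "k \<noteq> i" "k \<noteq> j" for k using ij(1) that unfolding D_def by blast
  have up: "cell_dim x = r \<and> cell_le y x \<and> cell_le x z \<longleftrightarrow> x = y(i := z i) \<or> x = y(j := z j)" for x
  proof
    assume x: "cell_dim x = r \<and> cell_le y x \<and> cell_le x z"
    have xk: "x k = y k \<or> x k = z k" for k using x unfolding cell_le_def by metis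
    have "x \<noteq> y" using x y(2) r by auto
    then obtain k where "x k \<noteq> y k" by auto
    then have k1: "x i \<noteq> y i \<or> x j \<noteq> y j" using eqs xk by metis
    have "x \<noteq> z" using x z(2) by auto
    then obtain k where "x k \<noteq> z k" by auto
    then have k2: "x i \<noteq> z i \<or> x j \<noteq> z j" using eqs xk by metis
    have xo: "x k = y k" if "k \<noteq> i" "k \<noteq> j" for k using xk[of k] eqs[OF that] by auto
    have "(x i = z i \<and> x j = y j) \<or> (x j = z j \<and> x i = y i)"
      using k1 k2 xk[of i] xk[of j] by blast
    then show "x = y(i := z i) \<or> x = y(j := z j)"
      using xo by (fastforce simp: fun_eq_iff)
  next
    assume x: "x = y(i := z i) \<or> x = y(j := z j)"
    then have "cell_dim x = r" using cell_dim_flip_up[of y i] cell_dim_flip_up[of y j] zi y(2) r by auto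
    moreover have "x k = y k \<or> x k = z k" for k
      using x by auto
    ultimately show "cell_dim x = r \<and> cell_le y x \<and> cell_le x z"
      using yz unfolding cell_le_def by metis
  qed
  have "extenders p F = {y(i := z i), y(j := z j)}"
    unfolding ext up using subsetD[OF sl y(1)] subsetD[OF sl z(1)]
    by (auto simp: slab_def split: if_splits)
  moreover have "y(i := z i) \<noteq> y(j := z j)"
    using ij(2) neqi by (metis fun_upd_apply)
  ultimately show ?thesis using nb by simp
qed

lemma facet_in_two_simplices:
  fixes F :: "('m::finite \<Rightarrow> int) set"
  assumes F: "cell_chain p F" "card F = CARD('m)"
  shows "card {S. cell_chain p S \<and> card S = CARD('m) + 1 \<and> F \<subseteq> S} =
    (if (\<forall>v\<in>F. v p = 0) \<or> (\<forall>v\<in>F. v p = 1) then 1 else 2)"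
proof -
  obtain r where r: "r \<le> CARD('m)" "cell_dim ` F = {..CARD('m)} - {r}"
    using cell_chain_missing_dim[OF F] by blast
  consider "r = 0" | "r = CARD('m)" | "0 < r" "r < CARD('m)" using r(1) by linarith
  then show ?thesis
    unfolding card_superchains[OF F]
    using r(2) card_extenders_bottom[OF F(1)] card_extenders_top[OF F(1)]
      card_extenders_middle[OF F(1) r(2)]
    by cases blast+
qed

section \<open>Balanced families of vectors\<close>

text \<open>
The origin lies in the convex hull of the family. Leaving the coefficients unnormalised avoids
divisions; indexing by vertices instead of by values allows repeated values.
\<close>

definition balanced :: "('v \<Rightarrow> 'y::real_vector) \<Rightarrow> 'v set \<Rightarrow> bool" where
  "balanced g F \<longleftrightarrow> (\<exists>c. (\<forall>v\<in>F. 0 \<le> c v) \<and> (\<exists>v\<in>F. 0 < c v) \<and> (\<Sum>v\<in>F. c v *\<^sub>R g v) = 0)"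

text \<open>
Linear independence of a family, which in contrast to independence of its set of values excludes
repetitions.
\<close>

definition free_family :: "('v \<Rightarrow> 'y::real_vector) \<Rightarrow> 'v set \<Rightarrow> bool" where
  "free_family g D \<longleftrightarrow> (\<forall>c. (\<Sum>v\<in>D. c v *\<^sub>R g v) = 0 \<longrightarrow> (\<forall>v\<in>D. c v = 0))"

lemma balanced_cong: "(\<And>v. v \<in> F \<Longrightarrow> g v = h v) \<Longrightarrow> balanced g F = balanced h F"
  unfolding balanced_def by (simp cong: sum.cong)

lemma balanced_mono:
  assumes "balanced g F" "F \<subseteq> S" "finite S"
  shows "balanced g S"
proof -
  obtain c where c: "\<forall>v\<in>F. 0 \<le> c v" "\<exists>v\<in>F. 0 < c v" "(\<Sum>v\<in>F. c v *\<^sub>R g v) = 0"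
    using assms(1) unfolding balanced_def by blast
  let ?d = "\<lambda>v. if v \<in> F then c v else 0"
  have "(\<Sum>v\<in>S. ?d v *\<^sub>R g v) = (\<Sum>v\<in>F. ?d v *\<^sub>R g v)"
    using assms(2,3) by (intro sum.mono_neutral_right) auto
  also have "\<dots> = 0" using c(3) by (simp cong: sum.cong)
  finally show ?thesis
    using c assms(2) unfolding balanced_def by (intro exI[of _ ?d]) auto
qed

lemma not_balanced_if_positive:
  assumes "linear \<phi>" "finite F" "\<And>v. v \<in> F \<Longrightarrow> (\<phi> (g v) :: real) > 0"
  shows "\<not> balanced g F"
proof
  assume "balanced g F"
  then obtain c where c: "\<forall>v\<in>F. 0 \<le> c v" "\<exists>v\<in>F. 0 < c v" "(\<Sum>v\<in>F. c v *\<^sub>R g v) = 0"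
    unfolding balanced_def by blast
  have "0 = \<phi> (\<Sum>v\<in>F. c v *\<^sub>R g v)" using c(3) assms(1) by (simp add: linear_0)
  also have "\<dots> = (\<Sum>v\<in>F. c v * \<phi> (g v))"
    using assms(1) by (simp add: linear_sum linear_cmul)
  also have "\<dots> > 0"
    using c assms by (auto intro!: sum_pos2 simp: less_imp_le)
  finally show False by simp
qed

lemma not_balanced_functional:
  fixes g :: "'v \<Rightarrow> 'y::euclidean_space"
  assumes "\<not> balanced g F" "finite F"
  obtains a b where "0 < b" "\<And>v. v \<in> F \<Longrightarrow> b < a \<bullet> g v"
proof -
  have "0 \<notin> convex hull (g ` F)"
  proof
    assume "0 \<in> convex hull (g ` F)"
    then obtain u where u: "\<forall>y\<in>g ` F. 0 \<le> u y" "sum u (g ` F) = 1" "(\<Sum>y\<in>g ` F. u y *\<^sub>R y) = 0"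
      using assms(2) by (auto simp: convex_hull_finite)
    define r where "r = inv_into F g"
    define R where "R = r ` g ` F"
    have R: "R \<subseteq> F" unfolding R_def r_def by (auto intro: inv_into_into)
    have gr: "g (r y) = y" if "y \<in> g ` F" for y using that by (simp add: r_def f_inv_into_f)
    have inj: "inj_on r (g ` F)" by (rule inj_on_inverseI[of _ g]) (use gr in auto)
    have "(\<Sum>v\<in>R. u (g v) *\<^sub>R g v) = (\<Sum>y\<in>g ` F. u y *\<^sub>R y)"
      unfolding R_def by (subst sum.reindex[OF inj]) (auto intro!: sum.cong simp: gr)
    moreover have "sum u (g ` F) = (\<Sum>v\<in>R. u (g v))"
      unfolding R_def by (subst sum.reindex[OF inj]) (auto intro!: sum.cong simp: gr)
    then have "\<exists>v\<in>R. u (g v) > 0"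
      using u(2) by (metis not_less sum_nonpos zero_less_one)
    ultimately have "balanced g R"
      unfolding balanced_def using u R by (intro exI[of _ "\<lambda>v. u (g v)"]) auto
    then show False using balanced_mono R assms by blast
  qed
  then show ?thesis
    using separating_hyperplane_closed_0[of "convex hull (g ` F)"] that
      finite_imp_compact_convex_hull[of "g ` F"] assms(2) hull_subset[of "g ` F" convex]
    by (metis (no_types, lifting) compact_imp_closed convex_convex_hull finite_imageI image_subset_iff)
qed

text \<open>
A hyperplane strictly separates the origin from the finitely many values, and still does so after
a small perturbation.
\<close>

lemma not_balanced_stable:
  fixes g :: "'v \<Rightarrow> 'y::euclidean_space"
  assumes "\<not> balanced g F" "finite F"
  obtains \<epsilon> where "0 < \<epsilon>" "\<And>h. (\<And>v. v \<in> F \<Longrightarrow> norm (h v - g v) < \<epsilon>) \<Longrightarrow> \<not> balanced h F"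
proof -
  obtain a b where ab: "0 < b" "\<And>v. v \<in> F \<Longrightarrow> b < a \<bullet> g v"
    using not_balanced_functional[OF assms] by blast
  have "\<not> balanced h F" if h: "\<And>v. v \<in> F \<Longrightarrow> norm (h v - g v) < b / (norm a + 1)" for h
  proof (rule not_balanced_if_positive[of "\<lambda>y. a \<bullet> y"])
    fix v assume v: "v \<in> F"
    have "\<bar>a \<bullet> (h v - g v)\<bar> \<le> norm a * norm (h v - g v)" by (rule Cauchy_Schwarz_ineq2)
    also have "\<dots> \<le> norm a * (b / (norm a + 1))"
      using h[OF v] by (intro mult_left_mono) auto
    also have "\<dots> = b * (norm a / (norm a + 1))" by simp
    also have "\<dots> \<le> b * 1" using ab(1) by (intro mult_left_mono) (auto simp: divide_le_eq_1 add_nonneg_pos)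
    finally show "0 < a \<bullet> h v" using ab(2)[OF v] by (simp add: inner_diff_right)
  qed (use assms in \<open>auto intro: bounded_linear.linear bounded_linear_inner_right\<close>)
  moreover have "0 < b / (norm a + 1)" using ab(1) by (simp add: add_nonneg_pos)
  ultimately show ?thesis using that by blast
qed

text \<open>
If the origin is the barycentre of a family that spans \<open>W\<close>, it is interior to the convex hull
relative to \<open>W\<close>: every unit vector of \<open>W\<close> has a negative inner product with some member, by
compactness uniformly so. A nearby family in \<open>W\<close> therefore admits no separating hyperplane.
\<close>

lemma balanced_stable:
  fixes g :: "'v \<Rightarrow> 'y::euclidean_space"
  assumes F: "finite F" "F \<noteq> {}" and W: "subspace W" and span: "W \<subseteq> span (g ` F)"
    and sum0: "(\<Sum>v\<in>F. g v) = 0"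
  obtains \<epsilon> where "0 < \<epsilon>"
    "\<And>h. (\<And>v. v \<in> F \<Longrightarrow> h v \<in> W \<and> norm (h v - g v) < \<epsilon>) \<Longrightarrow> balanced h F"
proof -
  define K where "K = W \<inter> sphere 0 1"
  have K: "compact K" unfolding K_def
    using W by (simp add: closed_Int_compact closed_subspace)
  have low: "\<exists>v\<in>F. w \<bullet> g v < 0" if "w \<in> K" for w
  proof (rule ccontr)
    assume "\<not> (\<exists>v\<in>F. w \<bullet> g v < 0)"
    then have nn: "\<And>v. v \<in> F \<Longrightarrow> 0 \<le> w \<bullet> g v" by force
    have "(\<Sum>v\<in>F. w \<bullet> g v) = 0" using sum0 by (simp flip: inner_sum_right)
    then have z: "\<And>v. v \<in> F \<Longrightarrow> w \<bullet> g v = 0" using nn F(1) by (simp add: sum_nonneg_eq_0_iff)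
    have "w \<in> span (g ` F)" using that span by (auto simp: K_def)
    then have "orthogonal w w"
      by (rule orthogonal_to_span) (use z in \<open>auto simp: orthogonal_def\<close>)
    then have "w = 0" by (simp add: orthogonal_def)
    then show False using that by (simp add: K_def)
  qed
  define \<psi> where "\<psi> w = (\<Sum>v\<in>F. max 0 (- (w \<bullet> g v)))" for w
  have cont: "continuous_on K \<psi>" unfolding \<psi>_def by (intro continuous_intros)
  have pos: "\<psi> w > 0" if "w \<in> K" for w
    using low[OF that] F(1) unfolding \<psi>_def by (auto intro!: sum_pos2)
  obtain m where m: "m > 0" "\<And>w. w \<in> K \<Longrightarrow> m \<le> \<psi> w"
  proof (cases "K = {}")
    case True then show ?thesis using that[of 1] by auto
  next
    case False
    then show ?thesis using continuous_attains_inf[OF K False cont] pos that by metis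
  qed
  have cF: "real (card F) > 0" using F by (simp add: card_gt_0_iff)
  have "balanced h F" if h: "\<And>v. v \<in> F \<Longrightarrow> h v \<in> W \<and> norm (h v - g v) < m / card F" for h
  proof (rule ccontr)
    assume "\<not> balanced h F"
    then obtain a b where ab: "0 < b" "\<And>v. v \<in> F \<Longrightarrow> b < a \<bullet> h v"
      using not_balanced_functional F(1) by blast
    obtain u w0 where u: "u \<in> span W" "\<And>x. x \<in> span W \<Longrightarrow> orthogonal w0 x" "a = u + w0"
      using orthogonal_subspace_decomp_exists[of W a] by blast
    have sW: "span W = W" using W by (simp add: span_eq_iff)
    have uh: "b < u \<bullet> h v" if "v \<in> F" for v
      using ab(2)[OF that] u(2)[of "h v"] h[OF that] sW u(3)
      by (simp add: inner_add_left orthogonal_def)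
    obtain v0 where v0: "v0 \<in> F" using F(2) by blast
    have u0: "u \<noteq> 0" using uh[OF v0] ab(1) by auto
    define w where "w = u /\<^sub>R norm u"
    have wK: "w \<in> K" using u0 u(1) sW W by (auto simp: w_def K_def subspace_mul)
    have wh: "0 < w \<bullet> h v" if "v \<in> F" for v
      using uh[OF that] ab(1) u0 by (simp add: w_def)
    have "max 0 (- (w \<bullet> g v)) < m / card F" if v: "v \<in> F" for v
    proof -
      have "\<bar>w \<bullet> (h v - g v)\<bar> \<le> norm w * norm (h v - g v)" by (rule Cauchy_Schwarz_ineq2)
      then have "\<bar>w \<bullet> (h v - g v)\<bar> < m / card F" using wK h[OF v] by (simp add: K_def)
      then show ?thesis using wh[OF v] m(1) cF by (simp add: inner_diff_right)
    qed
    then have "\<psi> w < (\<Sum>v\<in>F. m / card F)" unfolding \<psi>_def by (intro sum_strict_mono F)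
    also have "\<dots> = m" using cF by simp
    finally show False using m(2)[OF wK] by simp
  qed
  moreover have "0 < m / card F" using m(1) cF by simp
  ultimately show ?thesis using that by blast
qed

lemma span_image_coeffs:
  assumes "finite D" "x \<in> span (g ` D)"
  shows "\<exists>u. x = (\<Sum>v\<in>D. u v *\<^sub>R g v)"
  using assms(2)
proof (induction rule: span_induct_alt)
  case base
  then show ?case by (intro exI[of _ "\<lambda>_. 0"]) simp
next
  case (step c x y)
  then obtain v u where v: "v \<in> D" "x = g v" and u: "y = (\<Sum>v\<in>D. u v *\<^sub>R g v)" by blast
  have "(\<Sum>w\<in>D. (if w = v then c else 0) *\<^sub>R g w) = c *\<^sub>R x"
    using assms(1) v by (simp add: if_distrib[of "\<lambda>r. r *\<^sub>R _"] sum.delta cong: if_cong)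
  then have "c *\<^sub>R x + y = (\<Sum>w\<in>D. ((if w = v then c else 0) + u w) *\<^sub>R g w)"
    unfolding u scaleR_left_distrib sum.distrib by simp
  then show ?case by (intro exI[of _ "\<lambda>w. (if w = v then c else 0) + u w"])
qed

lemma free_family_spans:
  fixes g :: "'v \<Rightarrow> 'y::euclidean_space"
  assumes "free_family g D" "finite D" "\<And>v. v \<in> D \<Longrightarrow> g v \<in> W" "card D = dim W"
  shows "W \<subseteq> span (g ` D)"
proof -
  have inj: "inj_on g D"
  proof (rule inj_onI, rule ccontr)
    fix x y assume xy: "x \<in> D" "y \<in> D" "g x = g y" "x \<noteq> y"
    let ?c = "\<lambda>v. if v = x then 1 else if v = y then - 1 else (0::real)"
    have "(\<Sum>v\<in>D. ?c v *\<^sub>R g v) = (\<Sum>v\<in>{x,y}. ?c v *\<^sub>R g v)"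
      using xy assms(2) by (intro sum.mono_neutral_right) auto
    also have "\<dots> = 0" using xy by simp
    finally have "?c x = 0" by (rule assms(1)[unfolded free_family_def, rule_format, OF _ xy(1)])
    then show False by simp
  qed
  have "independent (g ` D)"
  proof (rule independent_if_scalars_zero)
    fix f x assume f: "(\<Sum>x\<in>g ` D. f x *\<^sub>R x) = 0" and x: "x \<in> g ` D"
    have "(\<Sum>v\<in>D. f (g v) *\<^sub>R g v) = 0" using f by (simp add: sum.reindex[OF inj])
    then have "\<forall>v\<in>D. f (g v) = 0" by (rule assms(1)[unfolded free_family_def, rule_format, of "\<lambda>v. f (g v)", THEN ballI])
    then show "f x = 0" using x by blast
  qed (use assms in simp)
  then show ?thesis
    using card_ge_dim_independent[of "g ` D" W] assms inj by (auto simp: card_image)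
qed

text \<open>
This is the pivot step of the simplex method. The linear relations of \<open>n + 2\<close> generic vectors in an
\<open>n\<close>-dimensional space form a plane. Its non-negative part is a cone with exactly two extreme rays,
and by genericity each of them has precisely one vanishing coefficient.
\<close>

lemma ratio_test:
  fixes g :: "'v \<Rightarrow> 'y::euclidean_space"
  assumes S: "finite S" "card S = dim W + 2" and gW: "\<And>v. v \<in> S \<Longrightarrow> g v \<in> W"
    and free: "\<And>D. D \<subseteq> S \<Longrightarrow> card D = dim W \<Longrightarrow> free_family g D"
    and a: "a \<in> S" "balanced g (S - {a})"
  shows "\<exists>!b. b \<in> S - {a} \<and> balanced g (S - {b})"
proof -
  have vanish: "x w = 0"
    if "(\<Sum>v\<in>S. x v *\<^sub>R g v) = 0" "x u = 0" "x v = 0" "u \<in> S" "v \<in> S" "u \<noteq> v" "w \<in> S" for x u v w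
  proof -
    have "card (S - {u,v}) = dim W" using that S by (simp add: card_Diff_subset)
    then have "free_family g (S - {u,v})" using free by blast
    moreover have "(\<Sum>v\<in>S - {u,v}. x v *\<^sub>R g v) = (\<Sum>v\<in>S. x v *\<^sub>R g v)"
      using that(2,3) S(1) by (intro sum.mono_neutral_left) auto
    ultimately have "\<forall>v\<in>S - {u,v}. x v = 0" using that(1) unfolding free_family_def by auto
    then show ?thesis using that by blast
  qed
  have pos: "\<exists>x. x b = 0 \<and> (\<forall>v\<in>S - {b}. x v > 0) \<and> (\<Sum>v\<in>S. x v *\<^sub>R g v) = 0"
    if b: "b \<in> S" "balanced g (S - {b})" for b
  proof -
    obtain c where c: "\<forall>v\<in>S - {b}. 0 \<le> c v" "\<exists>v\<in>S - {b}. 0 < c v" "(\<Sum>v\<in>S - {b}. c v *\<^sub>R g v) = 0"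
      using b(2) unfolding balanced_def by blast
    define x where "x = c(b := 0)"
    have "(\<Sum>v\<in>S. x v *\<^sub>R g v) = (\<Sum>v\<in>S - {b}. x v *\<^sub>R g v)"
      using S(1) by (intro sum.mono_neutral_right) (auto simp: x_def)
    also have "\<dots> = (\<Sum>v\<in>S - {b}. c v *\<^sub>R g v)" by (intro sum.cong) (auto simp: x_def)
    finally have x0: "(\<Sum>v\<in>S. x v *\<^sub>R g v) = 0" using c(3) by simp
    have "x v > 0" if "v \<in> S - {b}" for v
    proof (rule ccontr)
      assume "\<not> 0 < x v"
      then have "x v = 0" using that c(1) unfolding x_def by (metis Diff_iff fun_upd_apply insertI1 antisym_conv2)
      moreover have "x b = 0" by (simp add: x_def)
      ultimately have xw: "x w = 0" if "w \<in> S" for w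
        using vanish[OF x0, of v b w] that \<open>v \<in> S - {b}\<close> b(1) by blast
      obtain w where "w \<in> S - {b}" "0 < c w" using c(2) by blast
      then show False using xw[of w] by (simp add: x_def)
    qed
    then show ?thesis using x0 by (intro exI[of _ x]) (auto simp: x_def)
  qed
  \<comment> \<open>\<open>l\<close> is one extreme ray; adding multiples of it to a relation \<open>c\<close> with \<open>c a = 1\<close> reaches all relations
    with coefficient 1 at \<open>a\<close>.\<close>
  obtain l where l: "l a = 0" "\<And>v. v \<in> S - {a} \<Longrightarrow> l v > 0" "(\<Sum>v\<in>S. l v *\<^sub>R g v) = 0"
    using pos[OF a] by blast
  have "card (S - {a}) = dim W + 1" using S a(1) by simp
  then have "S - {a} \<noteq> {}" by force
  then obtain d where d: "d \<in> S" "d \<noteq> a" by blast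
  define D where "D = S - {a, d}"
  have D: "finite D" "card D = dim W" "D \<subseteq> S"
    using S a(1) d by (auto simp: D_def card_Diff_subset)
  have "g a \<in> span (g ` D)"
    using free_family_spans[OF free[OF D(3,2)] D(1) _ D(2)] gW D(3) a(1) by blast
  then obtain u where u: "g a = (\<Sum>v\<in>D. u v *\<^sub>R g v)"
    using span_image_coeffs[OF D(1)] by blast
  define c where "c v = (if v = a then 1 else if v = d then 0 else - u v)" for v
  have c0: "(\<Sum>v\<in>S. c v *\<^sub>R g v) = 0"
  proof -
    have "S = insert a (insert d D)" using a(1) d by (auto simp: D_def)
    then have "(\<Sum>v\<in>S. c v *\<^sub>R g v) = g a + (\<Sum>v\<in>D. c v *\<^sub>R g v)"
      using D(1) d by (simp only: \<open>S = insert a (insert d D)\<close>) (simp add: D_def c_def)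
    also have "(\<Sum>v\<in>D. c v *\<^sub>R g v) = - g a"
      unfolding u sum_negf[symmetric] by (intro sum.cong) (auto simp: c_def D_def)
    finally show ?thesis by simp
  qed
  \<comment> \<open>the least multiple of \<open>l\<close> that makes \<open>c\<close> non-negative\<close>
  define \<rho> where "\<rho> = Max ((\<lambda>v. - c v / l v) ` (S - {a}))"
  have "\<rho> \<in> (\<lambda>v. - c v / l v) ` (S - {a})"
    unfolding \<rho>_def using S(1) d by (intro Max_in) auto
  then obtain b where b: "b \<in> S - {a}" "\<rho> = - c b / l b" by blast
  define x where "x v = c v + \<rho> * l v" for v
  have xa: "x a = 1" by (simp add: x_def c_def l(1))
  have xb: "x b = 0" using l(2)[OF b(1)] b(2) by (simp add: x_def)
  have x0: "(\<Sum>v\<in>S. x v *\<^sub>R g v) = 0"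
    unfolding x_def scaleR_left_distrib sum.distrib c0
    using l(3) by (simp flip: scaleR_scaleR scaleR_sum_right)
  have xn: "0 \<le> x v" if "v \<in> S" for v
  proof (cases "v = a")
    case False
    then have v: "v \<in> S - {a}" using that by blast
    have "- c v / l v \<le> \<rho>" unfolding \<rho>_def using S(1) v by (intro Max_ge) auto
    then show ?thesis using l(2)[OF v] by (simp add: x_def field_simps)
  qed (simp add: xa)
  show ?thesis
  proof (rule ex1I[of _ b])
    have "(\<Sum>v\<in>S - {b}. x v *\<^sub>R g v) = 0"
      using x0 xb S(1) by (subst sum.mono_neutral_left[of S]) auto
    then have "balanced g (S - {b})"
      unfolding balanced_def using xn xa a(1) b(1) by (intro exI[of _ x]) (auto intro!: bexI[of _ a])
    then show "b \<in> S - {a} \<and> balanced g (S - {b})" using b(1) by blast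
  next
    fix b' assume b': "b' \<in> S - {a} \<and> balanced g (S - {b'})"
    then obtain k where k: "k b' = 0" "\<And>v. v \<in> S - {b'} \<Longrightarrow> k v > 0" "(\<Sum>v\<in>S. k v *\<^sub>R g v) = 0"
      using pos[of b'] by blast
    have ka: "k a > 0" using k(2) a(1) b' by blast
    define t where "t = (k d / k a - x d) / l d"
    define z where "z v = k v / k a - x v - t * l v" for v
    have ld: "l d > 0" using l(2) d by blast
    have "(\<Sum>v\<in>S. (k v / k a) *\<^sub>R g v) = (1 / k a) *\<^sub>R (\<Sum>v\<in>S. k v *\<^sub>R g v)"
      unfolding scaleR_sum_right by simp
    then have "(\<Sum>v\<in>S. z v *\<^sub>R g v) = 0"
      unfolding z_def scaleR_left_diff_distrib sum_subtractf x0
      using l(3) k(3) by (simp flip: scaleR_scaleR scaleR_sum_right)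
    moreover have "z a = 0" using ka by (simp add: z_def xa l(1))
    moreover have "z d = 0" using ld by (simp add: z_def t_def)
    ultimately have z: "z w = 0" if "w \<in> S" for w using vanish[of z a d] a(1) d that by blast
    have kb: "k b / k a = t * l b" using z[of b] xb b(1) by (simp add: z_def)
    have "0 \<le> k b" using k(1) k(2)[of b] b(1) by (cases "b = b'") force+
    then have "0 \<le> t" using kb ka l(2)[OF b(1)]
      by (metis divide_nonneg_pos zero_le_mult_iff not_less)
    moreover have "x b' = - t * l b'" using z[of b'] b' k(1) by (simp add: z_def)
    then have "t \<le> 0" using xn[of b'] b' l(2)[of b'] by (simp add: mult_le_0_iff not_less)
    ultimately have "x b' = 0" using \<open>x b' = - t * l b'\<close> by simp
    then show "b' = b"
      using vanish[OF x0, of b b' a] xb xa a(1) b(1) b' by (cases "b = b'") auto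
  qed
qed

lemma card_balanced_facets:
  fixes g :: "'v \<Rightarrow> 'y::euclidean_space"
  assumes S: "finite S" "card S = dim W + 2" and gW: "\<And>v. v \<in> S \<Longrightarrow> g v \<in> W"
    and free: "\<And>D. D \<subseteq> S \<Longrightarrow> card D = dim W \<Longrightarrow> free_family g D"
    and F: "F \<subseteq> S" "card F = dim W + 1" "balanced g F"
  shows "card {F. F \<subseteq> S \<and> card F = dim W + 1 \<and> balanced g F} = 2"
proof -
  have omit: "\<exists>a\<in>S. F = S - {a}" if "F \<subseteq> S" "card F = dim W + 1" for F
  proof -
    have "card (S - F) = 1" using that S finite_subset[OF that(1) S(1)] by (simp add: card_Diff_subset)
    then obtain a where "S - F = {a}" by (auto simp: card_1_singleton_iff)
    then show ?thesis using that(1) by (intro bexI[of _ a]) auto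
  qed
  obtain a where a: "a \<in> S" "F = S - {a}" using omit[OF F(1,2)] by blast
  obtain b where b: "b \<in> S - {a}" "balanced g (S - {b})"
    and uniq: "\<And>b'. b' \<in> S - {a} \<Longrightarrow> balanced g (S - {b'}) \<Longrightarrow> b' = b"
    using ratio_test[OF S gW free a(1)] F(3) a(2) by blast
  have "{F. F \<subseteq> S \<and> card F = dim W + 1 \<and> balanced g F} = {S - {a}, S - {b}}"
  proof (intro set_eqI iffI)
    fix G assume "G \<in> {F. F \<subseteq> S \<and> card F = dim W + 1 \<and> balanced g F}"
    then have G: "G \<subseteq> S" "card G = dim W + 1" "balanced g G" by auto
    then obtain e where e: "e \<in> S" "G = S - {e}" using omit by blast
    then have "e = a \<or> e = b" using uniq[of e] G(3) by blast
    then show "G \<in> {S - {a}, S - {b}}" using e(2) by blast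
  next
    fix G assume "G \<in> {S - {a}, S - {b}}"
    then show "G \<in> {F. F \<subseteq> S \<and> card F = dim W + 1 \<and> balanced g F}"
      using a b F(3) S by auto
  qed
  moreover have "S - {a} \<noteq> S - {b}" using a(1) b(1) by blast
  ultimately show ?thesis by simp
qed

text \<open>
A vector that avoids all but one of the subspaces is moved slightly along a line that leaves the
last one; the line meets each subspace in at most one point.
\<close>

lemma avoid_subspaces:
  fixes W :: "'y::real_normed_vector set"
  assumes "finite \<T>" "subspace W" "w0 \<in> W" "0 < \<epsilon>"
    and "\<And>T. T \<in> \<T> \<Longrightarrow> subspace T \<and> \<not> W \<subseteq> T"
  shows "\<exists>w\<in>W. norm (w - w0) < \<epsilon> \<and> (\<forall>T\<in>\<T>. w \<notin> T)"
  using assms(1,5)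
proof (induction \<T>)
  case empty
  then show ?case using assms by (intro bexI[of _ w0]) auto
next
  case (insert T \<T>)
  then obtain w where w: "w \<in> W" "norm (w - w0) < \<epsilon>" "\<forall>T\<in>\<T>. w \<notin> T" by auto
  obtain u where u: "u \<in> W" "u \<notin> T" using insert.prems[of T] by blast
  define \<eta> where "\<eta> = (\<epsilon> - norm (w - w0)) / (norm u + 1)"
  have \<eta>: "0 < \<eta>" using w(2) by (simp add: \<eta>_def add_nonneg_pos)
  define bad where "bad V = {t. w + t *\<^sub>R u \<in> V}" for V
  have one: "finite (bad V)" if V: "V \<in> insert T \<T>" for V
  proof -
    have sV: "subspace V" using insert.prems[OF V] by blast
    have "s = t" if st: "s \<in> bad V" "t \<in> bad V" for s t
    proof (rule ccontr)
      assume ne: "s \<noteq> t"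
      have "(w + s *\<^sub>R u) - (w + t *\<^sub>R u) \<in> V"
        using st sV unfolding bad_def by (blast intro: subspace_diff)
      then have "(s - t) *\<^sub>R u \<in> V" by (simp add: algebra_simps)
      then have "(1 / (s - t)) *\<^sub>R (s - t) *\<^sub>R u \<in> V" using sV subspace_mul by blast
      then have uV: "u \<in> V" using ne by simp
      then have "(w + s *\<^sub>R u) - s *\<^sub>R u \<in> V"
        using st sV unfolding bad_def by (blast intro: subspace_diff subspace_mul)
      then show False using w(3) u(2) uV V by auto
    qed
    then have "bad V \<subseteq> {s}" if "s \<in> bad V" for s using that by blast
    then show ?thesis by (metis finite.simps finite_subset ex_in_conv)
  qed
  then have "finite (\<Union>V\<in>insert T \<T>. bad V)" using insert.hyps by blast
  then have "infinite ({0<..<\<eta>} - (\<Union>V\<in>insert T \<T>. bad V))"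
    using \<eta> by (simp add: Diff_infinite_finite)
  then have "{0<..<\<eta>} - (\<Union>V\<in>insert T \<T>. bad V) \<noteq> {}" by (rule infinite_imp_nonempty)
  then obtain t where "t \<in> {0<..<\<eta>} - (\<Union>V\<in>insert T \<T>. bad V)" by blast
  then have t: "0 < t" "t < \<eta>" "\<And>V. V \<in> insert T \<T> \<Longrightarrow> t \<notin> bad V" by auto
  have "norm (w + t *\<^sub>R u - w0) \<le> norm (w - w0) + t * norm u"
    using norm_triangle_ineq[of "w - w0" "t *\<^sub>R u"] t(1) by (simp add: algebra_simps)
  also have "t * norm u \<le> \<eta> * norm u" using t by (intro mult_right_mono) auto
  also have "\<eta> * norm u < \<eta> * (norm u + 1)" using \<eta> by simp
  also have "\<eta> * (norm u + 1) = \<epsilon> - norm (w - w0)" 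
    by (simp add: \<eta>_def add_nonneg_eq_0_iff)
  finally have "norm (w + t *\<^sub>R u - w0) < \<epsilon>" by simp
  then show ?case
    using t(3) w(1) u(1) assms(2) unfolding bad_def
    by (intro bexI[of _ "w + t *\<^sub>R u"]) (auto intro: subspace_add subspace_mul)
qed

text \<open>
The vectors are chosen one after the other, avoiding the finitely many proper subspaces spanned by
fewer than \<open>dim W\<close> of the images of the earlier ones. Independence is required for all choices of group
elements at once because only orbit representatives are perturbed, while a simplex contains
arbitrary members of their orbits.
\<close>

lemma generic_perturbation:
  fixes q0 :: "'v \<Rightarrow> 'y::euclidean_space" and \<beta> :: "'i \<Rightarrow> 'y \<Rightarrow> 'y"
  assumes "finite Q" and I: "finite I" and W: "subspace W" and \<epsilon>: "0 < \<epsilon>"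
    and lin: "\<And>i. i \<in> I \<Longrightarrow> linear (\<beta> i)" and iso: "\<And>i y. i \<in> I \<Longrightarrow> norm (\<beta> i y) = norm y"
    and "\<And>v. v \<in> Q \<Longrightarrow> q0 v \<in> W"
  shows "\<exists>q. (\<forall>v\<in>Q. q v \<in> W \<and> norm (q v - q0 v) < \<epsilon>) \<and>
    (\<forall>D h. D \<subseteq> Q \<longrightarrow> card D \<le> dim W \<longrightarrow> h ` D \<subseteq> I \<longrightarrow> free_family (\<lambda>v. \<beta> (h v) (q v)) D)"
  using assms(1,7)
proof (induction Q)
  case empty
  then show ?case by (auto simp: free_family_def)
next
  case (insert u Q)
  then obtain q where q: "\<And>v. v \<in> Q \<Longrightarrow> q v \<in> W \<and> norm (q v - q0 v) < \<epsilon>"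
    and fr: "\<And>D h. D \<subseteq> Q \<Longrightarrow> card D \<le> dim W \<Longrightarrow> h ` D \<subseteq> I \<Longrightarrow> free_family (\<lambda>v. \<beta> (h v) (q v)) D"
    by (metis insertI2)
  define E where "E D h i = {x. \<beta> i x \<in> span ((\<lambda>v. \<beta> (h v) (q v)) ` D)}" for D h i
  define \<T> where "\<T> = (\<Union>D\<in>{D. D \<subseteq> Q \<and> card D < dim W}. \<Union>h\<in>PiE D (\<lambda>_. I). E D h ` I)"
  have "finite \<T>"
    unfolding \<T>_def using insert.hyps(1) I
    by (intro finite_UN_I finite_PiE finite_imageI) (auto intro: finite_subset)
  moreover have "subspace T \<and> \<not> W \<subseteq> T" if "T \<in> \<T>" for T
  proof -
    obtain D h i where D: "D \<subseteq> Q" "card D < dim W" "i \<in> I" "T = E D h i"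
      using \<open>T \<in> \<T>\<close> unfolding \<T>_def by blast
    have fD: "finite D" using D(1) insert.hyps(1) finite_subset by blast
    have "subspace T"
      unfolding D(4) E_def using linear_subspace_vimage[OF lin[OF D(3)] subspace_span]
      by (simp add: vimage_def)
    moreover have "\<not> W \<subseteq> T"
    proof
      assume "W \<subseteq> T"
      then have "\<beta> i ` W \<subseteq> span ((\<lambda>v. \<beta> (h v) (q v)) ` D)" by (auto simp: D(4) E_def)
      then have "dim (\<beta> i ` W) \<le> card ((\<lambda>v. \<beta> (h v) (q v)) ` D)"
        using fD by (intro dim_le_card) auto
      also have "\<dots> \<le> card D" using fD by (rule card_image_le)
      finally have "dim (\<beta> i ` W) < dim W" using D(2) by simp
      moreover have "inj (\<beta> i)"
        using linear_injective_0[OF lin[OF D(3)]] iso[OF D(3)] by (metis norm_eq_zero)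
      then have "dim (\<beta> i ` W) = dim W"
        by (intro dim_image_eq lin D) (auto intro: inj_on_subset)
      ultimately show False by simp
    qed
    ultimately show ?thesis by blast
  qed
  ultimately obtain w where w: "w \<in> W" "norm (w - q0 u) < \<epsilon>" "\<And>T. T \<in> \<T> \<Longrightarrow> w \<notin> T"
    using avoid_subspaces[of \<T> W "q0 u" \<epsilon>] W \<epsilon> insert.prems by blast
  define q' where "q' = q(u := w)"
  have "free_family (\<lambda>v. \<beta> (h v) (q' v)) D"
    if D: "D \<subseteq> insert u Q" "card D \<le> dim W" "h ` D \<subseteq> I" for D h
  proof (cases "u \<in> D")
    case False
    then have "D \<subseteq> Q" using D(1) by blast
    then have "free_family (\<lambda>v. \<beta> (h v) (q v)) D" using fr D by blast
    moreover have "\<beta> (h v) (q' v) = \<beta> (h v) (q v)" if "v \<in> D" for v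
      using that False by (auto simp: q'_def)
    ultimately show ?thesis unfolding free_family_def by (simp cong: sum.cong)
  next
    case True
    have fD: "finite D" using D(1) insert.hyps(1) finite_subset by blast
    define D' where "D' = D - {u}"
    have D': "D' \<subseteq> Q" "card D' < dim W" "finite D'" "u \<notin> D'" "D = insert u D'" "h ` D' \<subseteq> I"
      using D True fD card_Diff1_less[OF fD True] unfolding D'_def by auto
    have eq: "\<beta> (h v) (q' v) = \<beta> (h v) (q v)" if "v \<in> D'" for v
      using that D'(4) by (auto simp: q'_def)
    show ?thesis unfolding free_family_def
    proof (intro allI impI)
      fix c assume c: "(\<Sum>v\<in>D. c v *\<^sub>R \<beta> (h v) (q' v)) = 0"
      let ?s = "\<Sum>v\<in>D'. c v *\<^sub>R \<beta> (h v) (q v)"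
      have eq0: "c u *\<^sub>R \<beta> (h u) w + ?s = 0"
        using c D'(3-5) eq by (simp add: q'_def cong: sum.cong)
      have cu: "c u = 0"
      proof (rule ccontr)
        assume ne: "c u \<noteq> 0"
        have "\<beta> (h u) w = (1 / c u) *\<^sub>R (c u *\<^sub>R \<beta> (h u) w)" using ne by simp
        also have "\<dots> = (1 / c u) *\<^sub>R (- ?s)" using eq0 by (metis eq_neg_iff_add_eq_0)
        also have "\<dots> \<in> span ((\<lambda>v. \<beta> (h v) (q v)) ` D')"
          by (intro span_mul span_neg span_sum span_base) auto
        finally have "w \<in> E D' h (h u)" by (simp add: E_def)
        also have "E D' h (h u) = E D' (restrict h D') (h u)" by (simp add: E_def)
        finally have "w \<in> E D' (restrict h D') (h u)" .
        moreover have "E D' (restrict h D') (h u) \<in> \<T>"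
          unfolding \<T>_def
        proof (rule UN_I[of D'], goal_cases)
          case 1 show ?case using D'(1,2) by simp
        next
          case 2
          have "restrict h D' \<in> D' \<rightarrow>\<^sub>E I" using D'(6) by (intro restrict_PiE_iff[THEN iffD2]) auto
          then show ?case using D(3) True by blast
        qed
        ultimately show False using w(3) by blast
      qed
      have "?s = 0" using eq0 cu by simp
      moreover have "free_family (\<lambda>v. \<beta> (h v) (q v)) D'" using fr D'(1,2,6) by simp
      ultimately have "\<forall>v\<in>D'. c v = 0" unfolding free_family_def by blast
      then show "\<forall>v\<in>D. c v = 0" using cu D'(5) by simp
    qed
  qed
  moreover have "\<forall>v\<in>insert u Q. q' v \<in> W \<and> norm (q' v - q0 v) < \<epsilon>"
    using q w insert.hyps(2) by (auto simp: q'_def)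
  ultimately show ?case by (intro exI[of _ q']) blast
qed

section \<open>Counting balanced simplices modulo a symmetry group\<close>

text \<open>
The group is given by bare operations on an index set so that one lemma covers its actions on
simplices and on facets.
\<close>

lemma free_action_dvd_card:
  assumes A: "finite A" and I: "one \<in> I" "\<And>i j. i \<in> I \<Longrightarrow> j \<in> I \<Longrightarrow> mul i j \<in> I" "\<And>i. i \<in> I \<Longrightarrow> inver i \<in> I"
    and closed: "\<And>i a. i \<in> I \<Longrightarrow> a \<in> A \<Longrightarrow> act i a \<in> A"
    and act1: "\<And>a. a \<in> A \<Longrightarrow> act one a = a"
    and act2: "\<And>i j a. i \<in> I \<Longrightarrow> j \<in> I \<Longrightarrow> a \<in> A \<Longrightarrow> act (mul i j) a = act i (act j a)"
    and actinv: "\<And>i a. i \<in> I \<Longrightarrow> a \<in> A \<Longrightarrow> act (inver i) (act i a) = a"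
    and free: "\<And>i j a. i \<in> I \<Longrightarrow> j \<in> I \<Longrightarrow> a \<in> A \<Longrightarrow> act i a = act j a \<Longrightarrow> i = j"
  shows "card I dvd card A"
proof -
  define orb where "orb a = (\<lambda>i. act i a) ` I" for a
  have U: "\<Union> (orb ` A) = A"
    using closed I(1) act1 unfolding orb_def by force
  have sub: "orb b \<subseteq> orb a" if ab: "a \<in> A" "b \<in> A" and x: "x \<in> orb a" "x \<in> orb b" for a b x
  proof -
    obtain i j where ij: "i \<in> I" "x = act i a" "j \<in> I" "x = act j b" using x unfolding orb_def by blast
    have "b = act (inver j) x" using actinv[OF ij(3) ab(2)] ij(4) by simp
    then have b: "b = act (mul (inver j) i) a" using act2 ij I ab by simp
    show ?thesis
    proof
      fix y assume "y \<in> orb b"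
      then obtain k where "k \<in> I" "y = act k b" unfolding orb_def by blast
      then have "y = act (mul k (mul (inver j) i)) a" "mul k (mul (inver j) i) \<in> I"
        using b act2 ij I ab by simp_all
      then show "y \<in> orb a" unfolding orb_def by blast
    qed
  qed
  have "card I dvd card (\<Union> (orb ` A))"
  proof (rule dvd_partition)
    show "finite (\<Union> (orb ` A))" using U A by simp
    show "\<forall>c\<in>orb ` A. card I dvd card c"
      using free unfolding orb_def by (auto simp: card_image inj_on_def)
    show "\<forall>c1\<in>orb ` A. \<forall>c2\<in>orb ` A. c1 \<noteq> c2 \<longrightarrow> c1 \<inter> c2 = {}"
      using sub by blast
  qed
  then show ?thesis using U by simp
qed

text \<open>
A finite group, given by its operations on an index set \<open>I\<close>, acts on cells by automorphisms of the
face order that preserve the time coordinate, and on the target space \<open>W\<close> by linear isometries.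
\<close>

locale cell_action =
  fixes p :: "'m::finite" and I :: "'i set" and one :: 'i and mul :: "'i \<Rightarrow> 'i \<Rightarrow> 'i" and inver :: "'i \<Rightarrow> 'i"
    and \<alpha> :: "'i \<Rightarrow> ('m \<Rightarrow> int) \<Rightarrow> ('m \<Rightarrow> int)"
    and \<beta> :: "'i \<Rightarrow> 'y::euclidean_space \<Rightarrow> 'y" and W :: "'y set"
  assumes finite_I: "finite I" and one_I: "one \<in> I"
    and mul_I: "\<And>i j. i \<in> I \<Longrightarrow> j \<in> I \<Longrightarrow> mul i j \<in> I"
    and inver_I: "\<And>i. i \<in> I \<Longrightarrow> inver i \<in> I"
    and mul_inver_one: "\<And>i j. i \<in> I \<Longrightarrow> j \<in> I \<Longrightarrow> mul (inver j) i = one \<Longrightarrow> i = j"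
    and \<alpha>_one: "\<And>v. \<alpha> one v = v"
    and \<alpha>_mul: "\<And>i j v. i \<in> I \<Longrightarrow> j \<in> I \<Longrightarrow> \<alpha> (mul i j) v = \<alpha> i (\<alpha> j v)"
    and \<alpha>_inver: "\<And>i v. i \<in> I \<Longrightarrow> \<alpha> (inver i) (\<alpha> i v) = v"
    and \<alpha>_le: "\<And>i v w. i \<in> I \<Longrightarrow> cell_le v w \<Longrightarrow> cell_le (\<alpha> i v) (\<alpha> i w)"
    and \<alpha>_level: "\<And>i v. i \<in> I \<Longrightarrow> \<alpha> i v p = v p"
    and \<beta>_one: "\<And>y. \<beta> one y = y"
    and \<beta>_mul: "\<And>i j y. i \<in> I \<Longrightarrow> j \<in> I \<Longrightarrow> \<beta> (mul i j) y = \<beta> i (\<beta> j y)"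
    and \<beta>_linear: "\<And>i. i \<in> I \<Longrightarrow> linear (\<beta> i)"
    and \<beta>_norm: "\<And>i y. i \<in> I \<Longrightarrow> norm (\<beta> i y) = norm y"
    and \<beta>_W: "\<And>i y. i \<in> I \<Longrightarrow> y \<in> W \<Longrightarrow> \<beta> i y \<in> W"
    and subspace_W: "subspace W"
begin

lemma \<alpha>_inj: "i \<in> I \<Longrightarrow> inj_on (\<alpha> i) A"
  by (rule inj_on_inverseI[of _ "\<alpha> (inver i)"]) (rule \<alpha>_inver)

lemma \<alpha>_slab: "i \<in> I \<Longrightarrow> v \<in> slab p \<Longrightarrow> \<alpha> i v \<in> slab p"
  by (simp add: slab_def \<alpha>_level)

lemma \<alpha>_chain: "i \<in> I \<Longrightarrow> cell_chain p S \<Longrightarrow> cell_chain p (\<alpha> i ` S)"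
  unfolding cell_chain_def using \<alpha>_le \<alpha>_slab by (auto 0 3)

lemma balanced_image:
  assumes "i \<in> I" "\<And>v. v \<in> F \<Longrightarrow> g (\<alpha> i v) = \<beta> i (g v)" "balanced g F"
  shows "balanced g (\<alpha> i ` F)"
proof -
  obtain c where c: "\<forall>v\<in>F. 0 \<le> c v" "\<exists>v\<in>F. 0 < c v" "(\<Sum>v\<in>F. c v *\<^sub>R g v) = 0"
    using assms(3) unfolding balanced_def by blast
  have "(\<Sum>v\<in>\<alpha> i ` F. c (\<alpha> (inver i) v) *\<^sub>R g v) = (\<Sum>v\<in>F. c v *\<^sub>R \<beta> i (g v))"
    using assms(1,2) by (simp add: sum.reindex[OF \<alpha>_inj] \<alpha>_inver cong: sum.cong)
  also have "\<dots> = \<beta> i (\<Sum>v\<in>F. c v *\<^sub>R g v)"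
    using \<beta>_linear[OF assms(1)] by (simp add: linear_sum linear_cmul)
  also have "\<dots> = 0" using c(3) \<beta>_linear[OF assms(1)] by (simp add: linear_0)
  finally show ?thesis
    unfolding balanced_def using c(1,2) assms(1)
    by (intro exI[of _ "\<lambda>v. c (\<alpha> (inver i) v)"]) (auto simp: \<alpha>_inver)
qed

text \<open>
Where the action is free one may perturb the values at orbit representatives and transport them along
the orbits. A set of vertices is then generic as soon as its members lie in different orbits.
\<close>

lemma equivariant_generic_perturbation:
  assumes R: "finite R" "\<And>i v. i \<in> I \<Longrightarrow> v \<in> R \<Longrightarrow> \<alpha> i v \<in> R"
    and gW: "\<And>v. v \<in> R \<Longrightarrow> g0 v \<in> W"
    and equiv: "\<And>i v. i \<in> I \<Longrightarrow> v \<in> R \<Longrightarrow> g0 (\<alpha> i v) = \<beta> i (g0 v)"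
    and free: "\<And>i v. i \<in> I \<Longrightarrow> v \<in> R \<Longrightarrow> \<alpha> i v = v \<Longrightarrow> i = one"
    and \<epsilon>: "0 < \<epsilon>"
  shows "\<exists>g. (\<forall>v\<in>R. g v \<in> W \<and> norm (g v - g0 v) < \<epsilon> \<and> (\<forall>i\<in>I. g (\<alpha> i v) = \<beta> i (g v))) \<and>
    (\<forall>D. D \<subseteq> R \<longrightarrow> card D \<le> dim W \<longrightarrow> (\<forall>i\<in>I. \<forall>v\<in>D. \<alpha> i v \<in> D \<longrightarrow> i = one) \<longrightarrow> free_family g D)"
proof -
  define orb where "orb v = (\<lambda>i. \<alpha> i v) ` I" for v
  define rep where "rep v = (SOME u. u \<in> orb v)" for v
  have orb_sub: "orb (\<alpha> i v) \<subseteq> orb v" if "i \<in> I" for i v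
    using that mul_I \<alpha>_mul[symmetric] unfolding orb_def by auto
  have orb_eq: "orb (\<alpha> i v) = orb v" if "i \<in> I" for i v
    using orb_sub[OF that, of v] orb_sub[OF inver_I[OF that], of "\<alpha> i v"] \<alpha>_inver[OF that] by auto
  have rep_eq: "rep (\<alpha> i v) = rep v" if "i \<in> I" for i v
    unfolding rep_def orb_eq[OF that] ..
  have "\<alpha> one v \<in> orb v" for v unfolding orb_def using one_I by blast
  then have rep_orb: "rep v \<in> orb v" for v
    unfolding rep_def by (metis someI)
  have ex_idx: "\<exists>i\<in>I. v = \<alpha> i (rep v)" for v
  proof -
    obtain i where "i \<in> I" "rep v = \<alpha> i v" using rep_orb unfolding orb_def by blast
    then show ?thesis using \<alpha>_inver[of i v] inver_I by (intro bexI[of _ "inver i"]) auto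
  qed
  then obtain idx where idx: "\<And>v. idx v \<in> I" "\<And>v. v = \<alpha> (idx v) (rep v)" by metis
  have repR: "rep v \<in> R" if "v \<in> R" for v
    using rep_orb[of v] R(2) that unfolding orb_def by auto
  have free2: "i = j" if "i \<in> I" "j \<in> I" "v \<in> R" "\<alpha> i v = \<alpha> j v" for i j v
  proof -
    have "\<alpha> (mul (inver j) i) v = v" using that \<alpha>_mul inver_I \<alpha>_inver by simp
    then have "mul (inver j) i = one" using free that mul_I inver_I by blast
    then show ?thesis using mul_inver_one that by blast
  qed
  have "\<exists>q. (\<forall>v\<in>rep ` R. q v \<in> W \<and> norm (q v - g0 v) < \<epsilon>) \<and>
    (\<forall>D h. D \<subseteq> rep ` R \<longrightarrow> card D \<le> dim W \<longrightarrow> h ` D \<subseteq> I \<longrightarrow> free_family (\<lambda>v. \<beta> (h v) (q v)) D)"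
    using R(1) gW repR
    by (intro generic_perturbation[where I = I] finite_I subspace_W \<epsilon> \<beta>_linear \<beta>_norm) auto
  then obtain q where q: "\<And>v. v \<in> rep ` R \<Longrightarrow> q v \<in> W \<and> norm (q v - g0 v) < \<epsilon>"
    and qfree: "\<And>D h. D \<subseteq> rep ` R \<Longrightarrow> card D \<le> dim W \<Longrightarrow> h ` D \<subseteq> I \<Longrightarrow>
        free_family (\<lambda>v. \<beta> (h v) (q v)) D"
    by blast
  define g where "g v = \<beta> (idx v) (q (rep v))" for v
  show ?thesis
  proof (intro exI[of _ g] conjI ballI allI impI)
    fix v assume v: "v \<in> R"
    show "g v \<in> W" using q v idx(1) \<beta>_W by (simp add: g_def)
    have "g0 v = \<beta> (idx v) (g0 (rep v))"
      using equiv[OF idx(1) repR[OF v], of v] idx(2)[of v] by simp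
    then have "g v - g0 v = \<beta> (idx v) (q (rep v) - g0 (rep v))"
      using \<beta>_linear[OF idx(1)] by (simp add: g_def linear_diff)
    then show "norm (g v - g0 v) < \<epsilon>" using \<beta>_norm[OF idx(1)] q v by simp
    fix i assume i: "i \<in> I"
    have "\<alpha> (idx (\<alpha> i v)) (rep v) = \<alpha> i v"
      using idx(2)[of "\<alpha> i v"] rep_eq[OF i] by simp
    also have "\<dots> = \<alpha> (mul i (idx v)) (rep v)"
      using idx(2)[of v] \<alpha>_mul[OF i idx(1)] by simp
    finally have "idx (\<alpha> i v) = mul i (idx v)"
      using free2 repR[OF v] idx(1) mul_I[OF i idx(1)] by blast
    then show "g (\<alpha> i v) = \<beta> i (g v)"
      using rep_eq[OF i] \<beta>_mul[OF i idx(1)] by (simp add: g_def)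
  next
    fix D assume D: "D \<subseteq> R" "card D \<le> dim W"
      and sep: "\<forall>i\<in>I. \<forall>v\<in>D. \<alpha> i v \<in> D \<longrightarrow> i = one"
    have inj: "inj_on rep D"
    proof (rule inj_onI)
      fix v w assume vw: "v \<in> D" "w \<in> D" "rep v = rep w"
      have "rep w = \<alpha> (inver (idx v)) v" using idx(2)[of v] \<alpha>_inver[OF idx(1)] vw(3) by metis
      then have w: "w = \<alpha> (mul (idx w) (inver (idx v))) v"
        using idx(2)[of w] \<alpha>_mul idx(1) inver_I by simp
      then have "mul (idx w) (inver (idx v)) = one"
        using sep[rule_format, OF _ vw(1)] vw(2) mul_I[OF idx(1) inver_I[OF idx(1)]] by metis
      then show "v = w" using w \<alpha>_one by simp
    qed
    define r where "r = inv_into D rep"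
    have r: "r (rep v) = v" if "v \<in> D" for v using inj that by (simp add: r_def)
    have fr: "free_family (\<lambda>u. \<beta> (idx (r u)) (q u)) (rep ` D)"
      using D idx(1) card_image[OF inj] by (intro qfree) auto
    show "free_family g D" unfolding free_family_def
    proof (intro allI impI ballI)
      fix c v assume c: "(\<Sum>v\<in>D. c v *\<^sub>R g v) = 0" and v: "v \<in> D"
      have "(\<Sum>u\<in>rep ` D. c (r u) *\<^sub>R \<beta> (idx (r u)) (q u)) = (\<Sum>v\<in>D. c v *\<^sub>R g v)"
        using r by (simp add: sum.reindex[OF inj] g_def cong: sum.cong)
      then have "\<forall>u\<in>rep ` D. c (r u) = 0"
        using c fr[unfolded free_family_def, rule_format, of "\<lambda>u. c (r u)"] by simp
      then show "c v = 0" using v r by force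
    qed
  qed
qed

text \<open>
After an equivariant generic perturbation, let \<open>Fs\<close> be the balanced facets and \<open>Ss\<close> the simplices with a
balanced facet. Each element of \<open>Ss\<close> has exactly two facets in \<open>Fs\<close>, and each element of \<open>Fs\<close> lies in two
elements of \<open>Ss\<close> unless it is in an end layer, where it lies in one. As the group acts freely
on \<open>Ss\<close> and \<open>Fs\<close>, the number of balanced facets in the two end layers is divisible by twice the order
of the group. But there are none at the top and a single orbit, that of \<open>\<sigma>\<close>, at the bottom.

The hypothesis on \<open>\<epsilon>0\<close> confines balanced simplices, also those of perturbed maps, to the finite region \<open>R\<close>;
there \<open>sep\<close> says that a simplex meets every orbit at most once and that the action is free.
\<close>

theorem parity_obstruction:
  assumes m: "CARD('m) = dim W + 1"
    and R: "finite R" "R \<subseteq> slab p" "\<And>i v. i \<in> I \<Longrightarrow> v \<in> R \<Longrightarrow> \<alpha> i v \<in> R"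
    and gW: "\<And>v. v \<in> slab p \<Longrightarrow> g0 v \<in> W"
    and equiv: "\<And>i v. i \<in> I \<Longrightarrow> v \<in> slab p \<Longrightarrow> g0 (\<alpha> i v) = \<beta> i (g0 v)"
    and sep: "\<And>S v w i. cell_chain p S \<Longrightarrow> S \<subseteq> R \<Longrightarrow> v \<in> S \<Longrightarrow> w \<in> S \<Longrightarrow> i \<in> I \<Longrightarrow> \<alpha> i v = w \<Longrightarrow> i = one"
    and \<epsilon>0: "0 < \<epsilon>0"
    and conf: "\<And>g S. (\<And>v. v \<in> slab p \<Longrightarrow> norm (g v - g0 v) < \<epsilon>0) \<Longrightarrow> cell_chain p S \<Longrightarrow> balanced g S \<Longrightarrow> S \<subseteq> R"
    and top: "\<And>F. cell_chain p F \<Longrightarrow> card F = CARD('m) \<Longrightarrow> \<forall>v\<in>F. v p = 1 \<Longrightarrow> \<not> balanced g0 F"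
    and bot: "\<And>F. cell_chain p F \<Longrightarrow> card F = CARD('m) \<Longrightarrow> \<forall>v\<in>F. v p = 0 \<Longrightarrow> balanced g0 F \<Longrightarrow>
        \<exists>i\<in>I. F = \<alpha> i ` \<sigma>"
    and \<sigma>: "cell_chain p \<sigma>" "card \<sigma> = CARD('m)" "\<forall>v\<in>\<sigma>. v p = 0"
    and stable: "0 < \<epsilon>1" "\<And>h. (\<And>v. v \<in> \<sigma> \<Longrightarrow> h v \<in> W \<and> norm (h v - g0 v) < \<epsilon>1) \<Longrightarrow> balanced h \<sigma>"
  shows False
proof -
  have \<sigma>slab: "\<sigma> \<subseteq> slab p" using \<sigma>(1) by (simp add: cell_chain_def)
  have "balanced g0 \<sigma>" using stable gW \<sigma>slab by (simp add: subset_iff)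
  then have \<sigma>R: "\<sigma> \<subseteq> R" using conf[of g0 \<sigma>] \<epsilon>0 \<sigma>(1) by simp
  have "\<forall>F. \<exists>\<delta>>0. F \<subseteq> R \<longrightarrow> \<not> balanced g0 F \<longrightarrow>
      (\<forall>h. (\<forall>v\<in>F. norm (h v - g0 v) < \<delta>) \<longrightarrow> \<not> balanced h F)"
  proof
    fix F show "\<exists>\<delta>>0. F \<subseteq> R \<longrightarrow> \<not> balanced g0 F \<longrightarrow>
      (\<forall>h. (\<forall>v\<in>F. norm (h v - g0 v) < \<delta>) \<longrightarrow> \<not> balanced h F)"
    proof (cases "F \<subseteq> R \<and> \<not> balanced g0 F")
      case True
      then show ?thesis using not_balanced_stable[of g0 F] R(1) finite_subset by metis
    qed (auto intro: exI[of _ 1])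
  qed
  then obtain \<delta> where \<delta>: "\<And>F. \<delta> F > 0" and \<delta>': "\<And>F h. F \<subseteq> R \<Longrightarrow> \<not> balanced g0 F \<Longrightarrow>
      (\<forall>v\<in>F. norm (h v - g0 v) < \<delta> F) \<Longrightarrow> \<not> balanced h F"
    by metis
  define \<epsilon> where "\<epsilon> = Min (insert \<epsilon>0 (insert \<epsilon>1 (\<delta> ` Pow R)))"
  have fin: "finite (insert \<epsilon>0 (insert \<epsilon>1 (\<delta> ` Pow R)))" using R(1) by simp
  have \<epsilon>: "0 < \<epsilon>" unfolding \<epsilon>_def using fin \<epsilon>0 stable(1) \<delta> by (subst Min_gr_iff) auto
  have \<epsilon>le: "\<epsilon> \<le> \<epsilon>0" "\<epsilon> \<le> \<epsilon>1" "\<And>F. F \<subseteq> R \<Longrightarrow> \<epsilon> \<le> \<delta> F"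
    unfolding \<epsilon>_def by (rule Min_le[OF fin]; blast)+
  have freeR: "i = one" if "i \<in> I" "v \<in> R" "\<alpha> i v = v" for i v
    using sep[of "{v}" v v i] that R(2) by (auto simp: cell_chain_def cell_le_refl)
  have gWR: "\<And>v. v \<in> R \<Longrightarrow> g0 v \<in> W" using gW R(2) by blast
  have equivR: "\<And>i v. i \<in> I \<Longrightarrow> v \<in> R \<Longrightarrow> g0 (\<alpha> i v) = \<beta> i (g0 v)" using equiv R(2) by blast
  obtain g' where g'_all: "(\<forall>v\<in>R. g' v \<in> W \<and> norm (g' v - g0 v) < \<epsilon> \<and> (\<forall>i\<in>I. g' (\<alpha> i v) = \<beta> i (g' v))) \<and>
    (\<forall>D. D \<subseteq> R \<longrightarrow> card D \<le> dim W \<longrightarrow> (\<forall>i\<in>I. \<forall>v\<in>D. \<alpha> i v \<in> D \<longrightarrow> i = one) \<longrightarrow> free_family g' D)"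
    by (rule exE[OF equivariant_generic_perturbation[OF R(1,3) gWR equivR freeR \<epsilon>]])
  have g': "\<And>v. v \<in> R \<Longrightarrow> g' v \<in> W" "\<And>v. v \<in> R \<Longrightarrow> norm (g' v - g0 v) < \<epsilon>"
    "\<And>i v. i \<in> I \<Longrightarrow> v \<in> R \<Longrightarrow> g' (\<alpha> i v) = \<beta> i (g' v)"
    using conjunct1[OF g'_all] by blast+
  note g'free = conjunct2[OF g'_all, rule_format]
  define g where "g v = (if v \<in> R then g' v else g0 v)" for v
  have near: "norm (g v - g0 v) < \<epsilon>" for v using g'(2) \<epsilon> by (simp add: g_def)
  have ggR: "balanced g F = balanced g' F" if "F \<subseteq> R" for F
    using that by (intro balanced_cong) (auto simp: g_def)
  have inR: "S \<subseteq> R" if "cell_chain p S" "balanced g S" for S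
    using conf[OF _ that] near \<epsilon>le(1) by (meson less_le_trans)
  have unb: "\<not> balanced g F" if "F \<subseteq> R" "\<not> balanced g0 F" for F
    using \<delta>'[OF that, of g] near \<epsilon>le(3)[OF that(1)] by (meson less_le_trans)
  have g_image: "balanced g (\<alpha> i ` F)" if "i \<in> I" "F \<subseteq> R" "balanced g F" for i F
  proof -
    have "balanced g' (\<alpha> i ` F)"
      using that g'(3) ggR by (intro balanced_image) auto
    then show ?thesis using ggR[of "\<alpha> i ` F"] that R(3) by (auto simp: image_subset_iff)
  qed
  have set_free: "i = j" if S: "cell_chain p S" "S \<subseteq> R" "S \<noteq> {}" and ij: "i \<in> I" "j \<in> I"
    and eq: "\<alpha> i ` S = \<alpha> j ` S" for i j S
  proof -
    obtain v where v: "v \<in> S" using S(3) by blast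
    then obtain w where w: "w \<in> S" "\<alpha> i v = \<alpha> j w" using eq by blast
    have "\<alpha> (mul (inver j) i) v = w" using w ij \<alpha>_mul inver_I \<alpha>_inver by simp
    then have "mul (inver j) i = one" using sep[OF S(1,2) v w(1)] ij mul_I inver_I by blast
    then show ?thesis using mul_inver_one ij by blast
  qed
  define Fs where "Fs = {F. cell_chain p F \<and> card F = CARD('m) \<and> balanced g F}"
  define Ss where "Ss = {S. cell_chain p S \<and> card S = CARD('m) + 1 \<and> (\<exists>F\<in>Fs. F \<subseteq> S)}"
  define bd where "bd F \<longleftrightarrow> (\<forall>v\<in>F. v p = 0) \<or> (\<forall>v\<in>F. v p = 1)" for F :: "('m \<Rightarrow> int) set"
  have FsR: "Fs \<subseteq> Pow R" using inR by (auto simp: Fs_def)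
  have SsR: "Ss \<subseteq> Pow R"
    using inR balanced_mono cell_chain_finite unfolding Ss_def Fs_def by blast
  have finFs: "finite Fs" and finSs: "finite Ss"
    using FsR SsR R(1) finite_subset by (metis finite_Pow_iff)+
  have card_pos: "F \<noteq> {}" if "card F = CARD('m) \<or> card F = CARD('m) + 1" for F :: "('m \<Rightarrow> int) set"
    using that by (auto simp: card_eq_0_iff)
  have two: "card {F\<in>Fs. F \<subseteq> S} = 2" if "S \<in> Ss" for S
  proof -
    obtain F where S: "cell_chain p S" "card S = CARD('m) + 1" and F: "F \<in> Fs" "F \<subseteq> S"
      using \<open>S \<in> Ss\<close> unfolding Ss_def by blast
    have SR: "S \<subseteq> R" using SsR \<open>S \<in> Ss\<close> by blast
    have "free_family g' D" if "D \<subseteq> S" "card D = dim W" for D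
    proof (rule g'free)
      fix i v assume "i \<in> I" "v \<in> D" "\<alpha> i v \<in> D"
      then show "i = one" using sep[OF S(1) SR, of v "\<alpha> i v" i] that(1) by blast
    qed (use that SR in auto)
    then have "card {F. F \<subseteq> S \<and> card F = dim W + 1 \<and> balanced g' F} = 2"
      using F SR S m g'(1) ggR[of F] FsR cell_chain_finite[OF S(1)]
      by (intro card_balanced_facets[of S W g' F]) (auto simp: Fs_def)
    moreover have "{F\<in>Fs. F \<subseteq> S} = {F. F \<subseteq> S \<and> card F = dim W + 1 \<and> balanced g' F}"
      using ggR SR m cell_chain_subset[OF S(1)] unfolding Fs_def by (auto 0 3)
    ultimately show ?thesis by (simp only:)
  qed
  have inc: "card {S\<in>Ss. F \<subseteq> S} = (if bd F then 1 else 2)" if "F \<in> Fs" for F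
  proof -
    have "{S\<in>Ss. F \<subseteq> S} = {S. cell_chain p S \<and> card S = CARD('m) + 1 \<and> F \<subseteq> S}"
      using that unfolding Ss_def by blast
    then show ?thesis using facet_in_two_simplices[of p F] that unfolding Fs_def bd_def by simp
  qed
  have "2 * card Ss = (\<Sum>S\<in>Ss. card {F\<in>Fs. F \<subseteq> S})" using two by simp
  also have "\<dots> = (\<Sum>F\<in>Fs. if bd F then 1 else 2)"
    using inc by (intro sum_multicount_gen finFs finSs) auto
  also have "\<dots> = card {F\<in>Fs. bd F} + 2 * card {F\<in>Fs. \<not> bd F}"
    using finFs by (simp add: sum.If_cases Int_def)
  finally have count: "2 * card Ss = card {F\<in>Fs. bd F} + 2 * card {F\<in>Fs. \<not> bd F}" .
  have "{F\<in>Fs. bd F} = (\<lambda>i. \<alpha> i ` \<sigma>) ` I"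
  proof (intro set_eqI iffI)
    fix F assume "F \<in> {F\<in>Fs. bd F}"
    then have F: "cell_chain p F" "card F = CARD('m)" "balanced g F" "bd F" by (auto simp: Fs_def)
    then have "balanced g0 F" using unb inR by blast
    moreover have "\<forall>v\<in>F. v p = 0"
      using F(4) top[OF F(1,2)] \<open>balanced g0 F\<close> unfolding bd_def by meson
    ultimately obtain i where "i \<in> I" "F = \<alpha> i ` \<sigma>" using bot[OF F(1,2)] by meson
    then show "F \<in> (\<lambda>i. \<alpha> i ` \<sigma>) ` I" by (metis imageI)
  next
    fix F assume "F \<in> (\<lambda>i. \<alpha> i ` \<sigma>) ` I"
    then obtain i where i: "i \<in> I" "F = \<alpha> i ` \<sigma>" by blast
    have "g v \<in> W \<and> norm (g v - g0 v) < \<epsilon>1" if "v \<in> \<sigma>" for v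
      using near[of v] \<epsilon>le(2) that g'(1) \<sigma>R by (auto simp: g_def)
    then have "balanced g \<sigma>" by (rule stable(2))
    then have "balanced g F" using g_image i \<sigma>R by blast
    moreover have "card F = CARD('m)" using i \<sigma>(2) by (simp add: card_image[OF \<alpha>_inj])
    moreover have "\<forall>v\<in>F. v p = 0" using i \<sigma>(3) \<alpha>_level by auto
    ultimately show "F \<in> {F\<in>Fs. bd F}" using \<alpha>_chain \<sigma>(1) i by (simp add: Fs_def bd_def)
  qed
  moreover have "inj_on (\<lambda>i. \<alpha> i ` \<sigma>) I"
    using set_free[OF \<sigma>(1) \<sigma>R] card_pos \<sigma>(2) by (intro inj_onI) auto
  ultimately have bdcard: "card {F\<in>Fs. bd F} = card I" by (simp add: card_image)
  have act: "\<alpha> (mul i j) ` S = \<alpha> i ` \<alpha> j ` S" "\<alpha> (inver i) ` \<alpha> i ` S = S"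
    if "i \<in> I" "j \<in> I" for i j S
    using that \<alpha>_mul \<alpha>_inver by (auto simp: image_image)
  have FsI: "\<alpha> i ` F \<in> Fs" if "i \<in> I" "F \<in> Fs" for i F
    using that g_image FsR \<alpha>_chain unfolding Fs_def by (auto simp: card_image[OF \<alpha>_inj])
  have SsI: "\<alpha> i ` S \<in> Ss" if "i \<in> I" "S \<in> Ss" for i S
  proof -
    obtain F where F: "F \<in> Fs" "F \<subseteq> S" using \<open>S \<in> Ss\<close> unfolding Ss_def by blast
    then have "\<alpha> i ` F \<in> Fs" "\<alpha> i ` F \<subseteq> \<alpha> i ` S" using FsI \<open>i \<in> I\<close> by blast+
    then show ?thesis
      using that \<alpha>_chain unfolding Ss_def by (auto simp: card_image[OF \<alpha>_inj])
  qed
  have bdI: "bd (\<alpha> i ` F) = bd F" if "i \<in> I" for i F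
    unfolding bd_def using \<alpha>_level[OF that] by auto
  have "card I dvd card Ss"
  proof (rule free_action_dvd_card[where act = "\<lambda>i. (`) (\<alpha> i)" and mul = mul and inver = inver and one = one])
    fix i j S assume "i \<in> I" "j \<in> I" "S \<in> Ss" "\<alpha> i ` S = \<alpha> j ` S"
    then have "cell_chain p S" "S \<subseteq> R" "S \<noteq> {}"
      using SsR card_pos[of S] unfolding Ss_def by (auto simp only: mem_Collect_eq)
    then show "i = j" by (rule set_free) fact+
  qed (use finSs one_I mul_I inver_I SsI act \<alpha>_one in auto)
  moreover have "card I dvd card {F\<in>Fs. \<not> bd F}"
  proof (rule free_action_dvd_card[where act = "\<lambda>i. (`) (\<alpha> i)" and mul = mul and inver = inver and one = one])
    fix i j F assume "i \<in> I" "j \<in> I" "F \<in> {F\<in>Fs. \<not> bd F}" "\<alpha> i ` F = \<alpha> j ` F"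
    then have "cell_chain p F" "F \<subseteq> R" "F \<noteq> {}"
      using FsR card_pos[of F] unfolding Fs_def by (auto simp only: mem_Collect_eq)
    then show "i = j" by (rule set_free) fact+
  qed (use finFs one_I mul_I inver_I FsI bdI act \<alpha>_one in auto)
  ultimately obtain k l where "card Ss = card I * k" "card {F\<in>Fs. \<not> bd F} = card I * l"
    by (auto elim!: dvdE)
  then have "card I * (2 * k) = card I * (1 + 2 * l)" using count bdcard by (simp add: algebra_simps)
  moreover have "card I > 0" using finite_I one_I by (auto simp: card_gt_0_iff)
  ultimately have "2 * k = 1 + 2 * l" by (metis mult_left_cancel less_irrefl)
  then show False by presburger
qed

end

section \<open>The staircase simplex around a point of a cube\<close>

text \<open>
Cutting the cube above the vertex \<open>b\<close> by the order \<open>e\<close> of the coordinates gives a simplex with the vertices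
\<open>stair p e b k\<close>. The coordinate \<open>i\<close> is raised in those of the vertices with \<open>k < e i\<close>, so the barycentre
has the pairwise different heights \<open>e i / CARD('m)\<close>.
\<close>

definition stair :: "'m \<Rightarrow> ('m \<Rightarrow> nat) \<Rightarrow> ('m \<Rightarrow> int) \<Rightarrow> nat \<Rightarrow> 'm \<Rightarrow> int" where
  "stair p e b k = (\<lambda>i. b i + (if i \<noteq> p \<and> k < e i then 1 else 0))"

definition staircase :: "'m::finite \<Rightarrow> ('m \<Rightarrow> nat) \<Rightarrow> ('m \<Rightarrow> int) \<Rightarrow> ('m \<Rightarrow> int) set" where
  "staircase p e b = stair p e b ` {..<CARD('m)}"

locale staircase_frame =
  fixes p :: "'m::finite" and e :: "'m \<Rightarrow> nat" and b :: "'m \<Rightarrow> int"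
  assumes e: "bij_betw e (- {p}) {1..<CARD('m)}" and b: "\<And>i. even (b i)" "b p = 0"
begin

lemma e_range: "i \<noteq> p \<Longrightarrow> 1 \<le> e i \<and> e i < CARD('m)"
  using bij_betw_apply[OF e, of i] by simp

lemma e_inj: "i \<noteq> p \<Longrightarrow> j \<noteq> p \<Longrightarrow> e i = e j \<Longrightarrow> i = j"
  using bij_betw_imp_inj_on[OF e] by (simp add: inj_on_def)

lemma e_surj: "1 \<le> k \<Longrightarrow> k < CARD('m) \<Longrightarrow> \<exists>i. i \<noteq> p \<and> e i = k"
  using bij_betw_imp_surj_on[OF e] by (metis ComplD atLeastLessThan_iff image_iff singletonI)

lemma stair_inj: "inj_on (stair p e b) {..<CARD('m)}"
proof (rule linorder_inj_onI)
  fix k k' assume k: "k < k'" "k \<in> {..<CARD('m)}" "k' \<in> {..<CARD('m)}"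
  then obtain i where "i \<noteq> p" "e i = k'" using e_surj[of k'] by auto
  then have "stair p e b k i \<noteq> stair p e b k' i" using k by (simp add: stair_def)
  then show "stair p e b k \<noteq> stair p e b k'" by metis
qed auto

lemma card_staircase: "card (staircase p e b) = CARD('m)"
  unfolding staircase_def by (simp add: card_image[OF stair_inj])

lemma staircase_level: "v \<in> staircase p e b \<Longrightarrow> v p = 0"
  using b(2) by (auto simp: staircase_def stair_def)

lemma staircase_near: "v \<in> staircase p e b \<Longrightarrow> b i \<le> v i \<and> v i \<le> b i + 1"
  by (auto simp: staircase_def stair_def)

lemma staircase_chain: "cell_chain p (staircase p e b)"
proof -
  have "cell_le (stair p e b k') (stair p e b k)" if "k \<le> k'" for k k'
    using that b(1) by (auto simp: cell_le_def stair_def)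
  then have "cell_le v w \<or> cell_le w v" if vw: "v \<in> staircase p e b" "w \<in> staircase p e b" for v w
  proof -
    obtain k k' where "v = stair p e b k" "w = stair p e b k'" using vw unfolding staircase_def by blast
    then show ?thesis using \<open>\<And>k k'. k \<le> k' \<Longrightarrow> _\<close> nat_le_linear by metis
  qed
  then show ?thesis
    using staircase_level unfolding cell_chain_def slab_def by blast
qed

lemma staircase_barycentre:
  assumes "i \<noteq> p"
  shows "(\<Sum>v\<in>staircase p e b. real_of_int (v i) - real_of_int (b i) - real (e i) / CARD('m)) = 0"
proof -
  have "(\<Sum>v\<in>staircase p e b. real_of_int (v i) - real_of_int (b i) - real (e i) / CARD('m))
    = (\<Sum>k<CARD('m). (if k < e i then 1 else 0) - real (e i) / CARD('m))"
    unfolding staircase_def using assms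
    by (subst sum.reindex[OF stair_inj]) (auto simp: stair_def intro!: sum.cong)
  also have "\<dots> = real (card {k \<in> {..<CARD('m)}. k < e i}) - real (e i)"
    by (simp add: sum_subtractf sum.If_cases Int_def)
  also have "{k \<in> {..<CARD('m)}. k < e i} = {..<e i}" using e_range[OF assms] by auto
  finally show ?thesis by simp
qed

lemma staircase_step:
  assumes "i \<noteq> p"
  shows "\<exists>v\<in>staircase p e b. \<exists>w\<in>staircase p e b. \<forall>j. j \<noteq> p \<longrightarrow> v j - w j = (if j = i then 1 else 0)"
proof -
  have mem: "stair p e b (e i - 1) \<in> staircase p e b" "stair p e b (e i) \<in> staircase p e b"
    using e_range[OF assms] by (auto simp: staircase_def)
  have "stair p e b (e i - 1) j - stair p e b (e i) j = (if j = i then 1 else 0)" if j: "j \<noteq> p" for j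
  proof -
    have "e j = e i \<longleftrightarrow> j = i" using e_inj assms j by blast
    then show ?thesis using e_range[OF assms] j by (auto simp: stair_def)
  qed
  then show ?thesis using mem by blast
qed

text \<open>
The simplex can be recovered from any point in its interior. The integer parts of the coordinates
determine the cube. If \<open>\<tau> i < \<tau> j\<close>, then a vertex of \<open>F\<close> that raises \<open>i\<close> must also raise \<open>j\<close>, since otherwise,
\<open>F\<close> being a chain, every vertex that raises \<open>j\<close> would raise \<open>i\<close>, so that \<open>\<tau> j \<le> \<tau> i\<close>. Hence every vertex of \<open>F\<close> raises
an upper set of coordinates and is a stair.
\<close>

lemma barycentre_in_staircase_only:
  assumes F: "cell_chain p F" "card F = CARD('m)" "\<And>v. v \<in> F \<Longrightarrow> v p = 0"
    and c: "\<And>v. v \<in> F \<Longrightarrow> 0 \<le> c v" "\<exists>v\<in>F. 0 < c v"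
    and bary: "\<And>i. i \<noteq> p \<Longrightarrow>
      (\<Sum>v\<in>F. c v * (real_of_int (v i) - real_of_int (b i) - real (e i) / CARD('m))) = 0"
  shows "F = staircase p e b"
proof -
  have fin: "finite F" by (rule cell_chain_finite[OF F(1)])
  define s where "s = sum c F"
  have s: "0 < s" unfolding s_def using c fin by (auto intro: sum_pos2)
  define \<tau> where "\<tau> i = real (e i) / CARD('m)" for i
  have \<tau>: "0 < \<tau> i" "\<tau> i < 1" if "i \<noteq> p" for i
    using e_range[OF that] by (auto simp: \<tau>_def)
  have wsum: "(\<Sum>v\<in>F. c v * (real_of_int (v i) - real_of_int (b i))) = s * \<tau> i" if "i \<noteq> p" for i
  proof -
    have "(\<Sum>v\<in>F. c v * (real_of_int (v i) - real_of_int (b i))) - s * \<tau> i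
      = (\<Sum>v\<in>F. c v * (real_of_int (v i) - real_of_int (b i) - \<tau> i))"
      unfolding s_def sum_distrib_right right_diff_distrib sum_subtractf by simp
    also have "\<dots> = 0" using bary[OF that] by (simp add: \<tau>_def)
    finally show ?thesis by simp
  qed
  have dimle: "cell_dim v < CARD('m)" if "v \<in> F" for v
  proof -
    have "\<not> odd (v p)" using F(3)[OF that] by simp
    then have "cell_dim v \<noteq> CARD('m)" using dim_top_odd by blast
    then show ?thesis using cell_dim_le[of v] by simp
  qed
  have dims: "cell_dim ` F = {..<CARD('m)}"
    using cell_chain_inj_dim[OF F(1)] dimle F(2)
    by (intro card_subset_eq) (auto simp: card_image)
  have "0 \<in> cell_dim ` F" "CARD('m) - 1 \<in> cell_dim ` F" unfolding dims by auto
  then obtain l t where l: "l \<in> F" "cell_dim l = 0" and t: "t \<in> F" "cell_dim t = CARD('m) - 1"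
    by (metis imageE)
  have todd: "odd (t i)" if "i \<noteq> p" for i
  proof -
    have "{j. odd (t j)} = - {p}"
      using t F(3)[OF t(1)] by (intro card_subset_eq) (auto simp: cell_dim_def Compl_eq_Diff_UNIV)
    then show ?thesis using that by blast
  qed
  have between: "v i = l i \<or> v i = t i" "\<bar>l i - t i\<bar> = 1" if "v \<in> F" "i \<noteq> p" for v i
  proof -
    have "cell_le l v" using cell_chain_le[OF F(1) l(1) that(1)] l(2) by simp
    moreover have "cell_le v t" using cell_chain_le[OF F(1) that(1) t(1)] t(2) dimle[OF that(1)] by simp
    ultimately show "v i = l i \<or> v i = t i" unfolding cell_le_def by metis
    have "cell_le l t" using cell_chain_le[OF F(1) l(1) t(1)] l(2) by simp
    then show "\<bar>l i - t i\<bar> = 1"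
      using todd[OF that(2)] dim_0_even[OF l(2), of i] unfolding cell_le_def by metis
  qed
  have bt: "l i = b i \<and> t i = b i + 1" if i: "i \<noteq> p" for i
  proof -
    have d: "\<bar>l i - t i\<bar> = 1" using between(2)[OF l(1) i] .
    have "\<exists>v\<in>F. v i \<le> b i"
    proof (rule ccontr)
      assume "\<not> (\<exists>v\<in>F. v i \<le> b i)"
      then have "s * 1 \<le> (\<Sum>v\<in>F. c v * (real_of_int (v i) - real_of_int (b i)))"
        unfolding s_def sum_distrib_right using c(1) by (intro sum_mono mult_left_mono) force+
      then show False using wsum[OF i] \<tau>(2)[OF i] s by simp
    qed
    moreover have "\<exists>v\<in>F. b i < v i"
    proof (rule ccontr)
      assume "\<not> (\<exists>v\<in>F. b i < v i)"
      then have "(\<Sum>v\<in>F. c v * (real_of_int (v i) - real_of_int (b i))) \<le> 0"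
        using c(1) by (intro sum_nonpos mult_nonneg_nonpos) force+
      then show False using wsum[OF i] \<tau>(1)[OF i] s by (simp add: mult_le_0_iff)
    qed
    ultimately have "min (l i) (t i) \<le> b i" "b i < max (l i) (t i)"
      using between(1)[OF _ i] by (metis min.cobounded1 min.cobounded2 order_trans, metis max.cobounded1 max.cobounded2 less_le_trans)
    then have "(l i = b i \<and> t i = b i + 1) \<or> (t i = b i \<and> l i = b i + 1)" using d by linarith
    then show ?thesis using todd[OF i] b(1)[of i] by auto
  qed
  define up where "up v = {i. i \<noteq> p \<and> v i = b i + 1}" for v :: "'m \<Rightarrow> int"
  have vi: "v i = b i + (if i \<in> up v then 1 else 0)" if "v \<in> F" for v i
  proof (cases "i = p")
    case True then show ?thesis using F(3)[OF that] b(2) by (simp add: up_def)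
  next
    case False then show ?thesis using between(1)[OF that False] bt[OF False] by (auto simp: up_def)
  qed
  have mono: "j \<in> up v" if v: "v \<in> F" and i: "i \<in> up v" and j: "j \<noteq> p" "e i < e j" for v i j
  proof (rule ccontr)
    assume nj: "j \<notin> up v"
    have ip: "i \<noteq> p" using i by (simp add: up_def)
    have imp: "i \<in> up w" if w: "w \<in> F" "j \<in> up w" for w
    proof -
      have wj: "odd (w j)" "even (v j)" using vi[OF w(1), of j] vi[OF v, of j] w(2) nj b(1)[of j] by auto
      then have "\<not> cell_le w v" using cell_le_odd[of w v j] by auto
      then have "cell_le v w" using F(1) v w(1) unfolding cell_chain_def by blast
      moreover have "odd (v i)" using vi[OF v, of i] i b(1)[of i] by simp
      ultimately have "w i = v i" by (rule cell_le_odd)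
      then show ?thesis using i by (simp add: up_def)
    qed
    have "s * \<tau> j = (\<Sum>w\<in>F. c w * (if j \<in> up w then 1 else 0))"
      unfolding wsum[OF j(1), symmetric] by (intro sum.cong) (auto simp: vi)
    also have "\<dots> \<le> (\<Sum>w\<in>F. c w * (if i \<in> up w then 1 else 0))"
      using imp c(1) by (intro sum_mono mult_left_mono) auto
    also have "\<dots> = s * \<tau> i"
      unfolding wsum[OF ip, symmetric] by (intro sum.cong) (auto simp: vi)
    finally have "\<tau> j \<le> \<tau> i" using s by simp
    then show False using j(2) by (simp add: \<tau>_def divide_le_cancel)
  qed
  have "F \<subseteq> staircase p e b"
  proof
    fix v assume v: "v \<in> F"
    \<comment> \<open>\<open>k\<close> is the largest rank that is not raised; the 0 covers the vertex that raises everything\<close>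
    define k where "k = Max (insert 0 (e ` (- {p} - up v)))"
    have "k \<in> insert 0 (e ` (- {p} - up v))" unfolding k_def by (intro Max_in) auto
    then have kcase: "k = 0 \<or> (\<exists>j. j \<noteq> p \<and> j \<notin> up v \<and> k = e j)" by auto
    have k: "k < CARD('m)" using kcase e_range by (auto)
    have "i \<in> up v \<longleftrightarrow> i \<noteq> p \<and> k < e i" for i
    proof
      assume i: "i \<in> up v"
      then have ip: "i \<noteq> p" by (simp add: up_def)
      have "k < e i"
      proof (rule ccontr)
        assume "\<not> k < e i"
        then obtain j where j: "j \<noteq> p" "j \<notin> up v" "e i \<le> e j"
          using kcase e_range[OF ip] by auto
        then have "e i \<noteq> e j" using e_inj[OF ip j(1)] i by auto
        then show False using mono[OF v i j(1)] j by auto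
      qed
      then show "i \<noteq> p \<and> k < e i" using ip by simp
    next
      assume i: "i \<noteq> p \<and> k < e i"
      show "i \<in> up v"
      proof (rule ccontr)
        assume "i \<notin> up v"
        then have "e i \<le> k" unfolding k_def using i by (intro Max_ge) auto
        then show False using i by simp
      qed
    qed
    then have "v = stair p e b k" using vi[OF v] by (auto simp: stair_def fun_eq_iff)
    then show "v \<in> staircase p e b" using k by (auto simp: staircase_def)
  qed
  then show ?thesis using card_staircase F(2) by (intro card_subset_eq) (auto simp: staircase_def)
qed

end

section \<open>Signed permutations of rows\<close>

text \<open>
The pair \<open>(s, e)\<close> stands for the matrix with the entries \<open>e i\<close> at the positions \<open>(i, s i)\<close>;
\<open>permute_rows\<close> is multiplication by this matrix from the left, and \<open>conjugate\<close> is conjugation by it.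
\<close>

type_synonym 'n signed_perm = "('n \<Rightarrow> 'n) \<times> ('n \<Rightarrow> int)"

definition signed_perms :: "'n signed_perm set" where
  "signed_perms = {(s, e). bij s \<and> (\<forall>i. e i = 1 \<or> e i = - 1)}"

definition sp_one :: "'n signed_perm" where
  "sp_one = (id, \<lambda>_. 1)"

definition sp_mul :: "'n signed_perm \<Rightarrow> 'n signed_perm \<Rightarrow> 'n signed_perm" where
  "sp_mul g h = (fst h \<circ> fst g, \<lambda>i. snd g i * snd h (fst g i))"

definition sp_inv :: "'n signed_perm \<Rightarrow> 'n signed_perm" where
  "sp_inv g = (inv (fst g), \<lambda>i. snd g (inv (fst g) i))"

definition permute_rows :: "'n signed_perm \<Rightarrow> real ^ 'm ^ 'n \<Rightarrow> real ^ 'm ^ 'n" where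
  "permute_rows g U = (\<chi> i j. of_int (snd g i) * U $ fst g i $ j)"

definition conjugate :: "'n signed_perm \<Rightarrow> real ^ 'n ^ 'n \<Rightarrow> real ^ 'n ^ 'n" where
  "conjugate g S = (\<chi> i j. of_int (snd g i * snd g j) * S $ fst g i $ fst g j)"

definition conjugate2 :: "'n signed_perm \<Rightarrow> (real ^ 'n ^ 'n) \<times> (real ^ 'n ^ 'n) \<Rightarrow> (real ^ 'n ^ 'n) \<times> (real ^ 'n ^ 'n)" where
  "conjugate2 g y = (conjugate g (fst y), conjugate g (snd y))"

text \<open>
Cells have one coordinate for each matrix entry, and \<open>None\<close> as the time coordinate.
\<close>

definition permute_cell :: "'n signed_perm \<Rightarrow> (('n \<times> 'n) option \<Rightarrow> int) \<Rightarrow> ('n \<times> 'n) option \<Rightarrow> int" where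
  "permute_cell g v x = (case x of None \<Rightarrow> v None | Some (i, j) \<Rightarrow> snd g i * v (Some (fst g i, j)))"

lemma sp_bij: "g \<in> signed_perms \<Longrightarrow> bij (fst g)"
  by (auto simp: signed_perms_def)

lemma sp_sign: "g \<in> signed_perms \<Longrightarrow> snd g i = 1 \<or> snd g i = - 1"
  by (auto simp: signed_perms_def)

lemma sp_sign_square: "g \<in> signed_perms \<Longrightarrow> snd g i * snd g i = 1"
  using sp_sign[of g i] by auto

lemma sp_sign_square_mult: "g \<in> signed_perms \<Longrightarrow> snd g i * (snd g i * x) = x"
  using sp_sign[of g i] by auto

lemma sp_inv_apply:
  assumes "g \<in> signed_perms" shows "fst g (inv (fst g) i) = i" "inv (fst g) (fst g i) = i"
  using sp_bij[OF assms] by (simp_all add: bij_is_surj surj_f_inv_f bij_is_inj inv_f_f)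

lemma finite_signed_perms: "finite (signed_perms :: 'n::finite signed_perm set)"
proof (rule finite_subset)
  show "signed_perms \<subseteq> (UNIV :: ('n \<Rightarrow> 'n) set) \<times> PiE (UNIV :: 'n set) (\<lambda>_. {1, - 1})"
    by (auto simp: signed_perms_def)
  show "finite ((UNIV :: ('n \<Rightarrow> 'n) set) \<times> PiE (UNIV :: 'n set) (\<lambda>_. {1, - 1 :: int}))"
    by (intro finite_cartesian_product finite_PiE) auto
qed

lemma sp_one_mem: "sp_one \<in> signed_perms"
  by (simp add: sp_one_def signed_perms_def)

lemma sp_mul_mem:
  assumes "g \<in> signed_perms" "h \<in> signed_perms" shows "sp_mul g h \<in> signed_perms"
proof -
  have "snd g i * snd h (fst g i) = 1 \<or> snd g i * snd h (fst g i) = - 1" for i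
    using sp_sign[OF assms(1), of i] sp_sign[OF assms(2), of "fst g i"] by auto
  then show ?thesis
    using bij_comp[OF sp_bij[OF assms(1)] sp_bij[OF assms(2)]]
    by (simp add: signed_perms_def sp_mul_def)
qed

lemma sp_inv_mem: "g \<in> signed_perms \<Longrightarrow> sp_inv g \<in> signed_perms"
  by (auto simp: signed_perms_def sp_inv_def bij_imp_bij_inv)

lemma sp_mul_inv_one:
  assumes "g \<in> signed_perms" "h \<in> signed_perms" "sp_mul (sp_inv h) g = sp_one"
  shows "g = h"
proof -
  have 1: "fst g (inv (fst h) i) = i" and 2: "snd h (inv (fst h) i) * snd g (inv (fst h) i) = 1" for i
    using assms(3) by (auto simp: sp_mul_def sp_inv_def sp_one_def fun_eq_iff)
  have "fst g i = fst h i" for i using 1[of "fst h i"] by (simp add: sp_inv_apply assms)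
  moreover have "snd g i = snd h i" for i
    using 2[of "fst h i"] sp_sign[OF assms(1), of i] sp_sign[OF assms(2), of i]
    by (auto simp: sp_inv_apply assms)
  ultimately show ?thesis by (simp add: prod_eq_iff fun_eq_iff)
qed

lemma permute_cell_le:
  assumes "g \<in> signed_perms" "cell_le v w"
  shows "cell_le (permute_cell g v) (permute_cell g w)"
  unfolding cell_le_def
proof
  fix x :: "('a \<times> 'a) option"
  show "permute_cell g v x = permute_cell g w x \<or>
    even (permute_cell g v x) \<and> odd (permute_cell g w x) \<and> \<bar>permute_cell g v x - permute_cell g w x\<bar> = 1"
  proof (cases x)
    case None
    then show ?thesis using assms(2) by (auto simp: permute_cell_def cell_le_def)
  next
    case (Some y)
    then show ?thesis
      using assms(2)[unfolded cell_le_def, rule_format, of "Some (fst g (fst y), snd y)"]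
        sp_sign[OF assms(1), of "fst y"]
      by (auto simp: permute_cell_def split: prod.splits)
  qed
qed

lemma norm_conjugate:
  assumes "g \<in> signed_perms" shows "norm (conjugate g S) = norm (S :: real ^ 'n ^ 'n)"
proof -
  have sq: "(real_of_int (snd g i * snd g j) * x)\<^sup>2 = x\<^sup>2" for i j x
    using sp_sign[OF assms, of i] sp_sign[OF assms, of j] by auto
  have re: "(\<Sum>i\<in>UNIV. \<phi> (fst g i)) = (\<Sum>i\<in>UNIV. \<phi> i)" for \<phi> :: "'n \<Rightarrow> real"
    by (rule sum.reindex_bij_betw) (use sp_bij[OF assms] in simp)
  show ?thesis
    unfolding norm_vec_def L2_set_def conjugate_def
    by (simp add: sq sum_nonneg del: of_int_mult)
      (simp only: re[of "\<lambda>j. (S $ _ $ j)\<^sup>2"] re[of "\<lambda>i. \<Sum>j\<in>UNIV. (S $ i $ j)\<^sup>2"])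
qed

lemma norm_permute_rows:
  assumes "g \<in> signed_perms" shows "norm (permute_rows g U) = norm (U :: real ^ 'm ^ 'n)"
proof -
  have sq: "(real_of_int (snd g i) * x)\<^sup>2 = x\<^sup>2" for i x
    using sp_sign[OF assms, of i] by auto
  have re: "(\<Sum>i\<in>UNIV. \<phi> (fst g i)) = (\<Sum>i\<in>UNIV. \<phi> i)" for \<phi> :: "'n \<Rightarrow> real"
    by (rule sum.reindex_bij_betw) (use sp_bij[OF assms] in simp)
  show ?thesis
    unfolding norm_vec_def L2_set_def permute_rows_def
    by (simp add: sq sum_nonneg) (simp add: re[of "\<lambda>i. \<Sum>j\<in>UNIV. (U $ i $ j)\<^sup>2"])
qed

lemma linear_conjugate2: "linear (conjugate2 g)"
  by (rule linearI) (simp_all add: conjugate2_def conjugate_def vec_eq_iff prod_eq_iff algebra_simps)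

lemma norm_conjugate2: "g \<in> signed_perms \<Longrightarrow> norm (conjugate2 g y) = norm y"
  by (simp add: conjugate2_def norm_Pair norm_conjugate) (simp add: norm_prod_def)

lemma permute_rows_diff: "permute_rows g (U - V) = permute_rows g U - permute_rows g V"
  by (simp add: permute_rows_def vec_eq_iff right_diff_distrib)

lemma permute_rows_mul: "permute_rows (sp_mul g h) U = permute_rows g (permute_rows h U)"
  by (simp add: permute_rows_def sp_mul_def vec_eq_iff mult.assoc)

lemma permute_rows_inv:
  assumes "g \<in> signed_perms"
  shows "permute_rows (sp_inv g) (permute_rows g U) = U" "permute_rows g (permute_rows (sp_inv g) U) = U"
proof -
  have "real_of_int (snd g i) * (real_of_int (snd g i) * x) = x" for i x
    using sp_sign[OF assms, of i] by auto
  then show "permute_rows (sp_inv g) (permute_rows g U) = U" "permute_rows g (permute_rows (sp_inv g) U) = U"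
    by (simp_all add: permute_rows_def sp_inv_def vec_eq_iff sp_inv_apply assms)
qed

lemma permute_rows_one: "permute_rows sp_one U = U"
  by (simp add: permute_rows_def sp_one_def vec_eq_iff)

lemma conjugate2_mul: "conjugate2 (sp_mul g h) y = conjugate2 g (conjugate2 h y)"
  by (simp add: conjugate2_def conjugate_def sp_mul_def vec_eq_iff algebra_simps)

lemma conjugate2_one: "conjugate2 sp_one y = y"
  by (simp add: conjugate2_def conjugate_def sp_one_def vec_eq_iff)

section \<open>The constraint map and a model with one orbit of zeros\<close>

definition off_diagonal :: "real ^ 'n ^ 'n \<Rightarrow> real ^ 'n ^ 'n" where
  "off_diagonal S = (\<chi> i j. if i = j then 0 else S $ i $ j)"

definition gram :: "real ^ 'n ^ 'n \<Rightarrow> real ^ 'n ^ 'n" where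
  "gram U = (\<chi> i j. U $ i \<bullet> U $ j)"

text \<open>
The zeros are the orthogonal matrices at which the off-diagonal entries of \<open>f\<close> vanish. For symmetric
\<open>f\<close> there are \<open>d(d-1)/2 + d(d+1)/2 = d\<^sup>2\<close> equations, as many as matrix entries.
\<close>

definition constraint_map :: "(real ^ 'n ^ 'n \<Rightarrow> real ^ 'n ^ 'n) \<Rightarrow> real ^ 'n ^ 'n \<Rightarrow> (real ^ 'n ^ 'n) \<times> (real ^ 'n ^ 'n)" where
  "constraint_map f U = (off_diagonal (f U), gram U - mat 1)"

definition sp_equivariant :: "(real ^ 'n ^ 'n \<Rightarrow> real ^ 'n ^ 'n) \<Rightarrow> bool" where
  "sp_equivariant f \<longleftrightarrow> (\<forall>g\<in>signed_perms. \<forall>U. f (permute_rows g U) = conjugate g (f U))"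

text \<open>
The matrix \<open>U A U\<^sup>t\<close> for the diagonal matrix \<open>A\<close> with the entries \<open>a k\<close>.
\<close>

definition weighted_form :: "('n \<Rightarrow> real) \<Rightarrow> real ^ 'n ^ 'n \<Rightarrow> real ^ 'n ^ 'n" where
  "weighted_form a U = (\<chi> i j. \<Sum>k\<in>UNIV. a k * (U $ i $ k * U $ j $ k))"

text \<open>
The derivative of \<open>constraint_map (weighted_form a)\<close> at the identity matrix. It is injective for
distinct \<open>a k\<close>, and its range serves as the target space of all maps below.
\<close>

definition linear_part :: "('n \<Rightarrow> real) \<Rightarrow> real ^ 'n ^ 'n \<Rightarrow> (real ^ 'n ^ 'n) \<times> (real ^ 'n ^ 'n)" where
  "linear_part a X = (\<chi> i j. if i = j then 0 else a j * X $ i $ j + a i * X $ j $ i,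
     \<chi> i j. X $ i $ j + X $ j $ i)"

lemma gram_permute: "gram (permute_rows g U) = conjugate g (gram U)"
proof -
  have "permute_rows g U $ i = of_int (snd g i) *\<^sub>R (U $ fst g i)" for i
    by (simp add: permute_rows_def vec_eq_iff)
  then show ?thesis unfolding gram_def conjugate_def by (simp add: mult_ac)
qed

lemma conjugate_mat1: "g \<in> signed_perms \<Longrightarrow> conjugate g (mat 1) = mat 1"
  using sp_bij[of g] sp_sign_square[of g]
  by (auto simp: conjugate_def mat_def vec_eq_iff bij_def inj_eq simp del: of_int_mult)

lemma weighted_form_equivariant: "sp_equivariant (weighted_form a)"
  by (simp add: sp_equivariant_def weighted_form_def conjugate_def permute_rows_def vec_eq_iff
      sum_distrib_left mult_ac)

lemma constraint_map_equivariant: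
  assumes "sp_equivariant f" "g \<in> signed_perms"
  shows "constraint_map f (permute_rows g U) = conjugate2 g (constraint_map f U)"
proof -
  have "conjugate g (off_diagonal S) = off_diagonal (conjugate g S)" for S
    using sp_bij[OF assms(2)] by (simp add: conjugate_def off_diagonal_def vec_eq_iff bij_def inj_eq)
  moreover have "conjugate g (S - T) = conjugate g S - conjugate g T" for S T
    by (simp add: conjugate_def vec_eq_iff right_diff_distrib)
  ultimately show ?thesis
    using assms by (simp add: constraint_map_def conjugate2_def sp_equivariant_def gram_permute conjugate_mat1)
qed

lemma continuous_gram: "continuous_on A gram"
  unfolding gram_def by (intro continuous_intros continuous_on_vec_lambda)

lemma continuous_constraint_map:
  assumes "continuous_on A f" shows "continuous_on A (constraint_map f)"
proof -
  have "continuous_on A (\<lambda>U. off_diagonal (f U))"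
    unfolding off_diagonal_def
  proof (intro continuous_on_vec_lambda)
    fix i j show "continuous_on A (\<lambda>x. if i = j then 0 else f x $ i $ j)"
      by (cases "i = j") (auto intro!: continuous_intros assms)
  qed
  then show ?thesis unfolding constraint_map_def by (intro continuous_intros continuous_gram)
qed

lemma continuous_weighted_form: "continuous_on A (weighted_form a)"
  unfolding weighted_form_def by (intro continuous_intros continuous_on_vec_lambda)

lemma linear_linear_part: "linear (linear_part a)"
  by (rule linearI) (simp_all add: linear_part_def vec_eq_iff prod_eq_iff algebra_simps)

lemma range_linear_part:
  assumes "inj a"
  shows "range (linear_part a) =
    {(S, T). (\<forall>i j. S $ i $ j = S $ j $ i) \<and> (\<forall>i. S $ i $ i = 0) \<and> (\<forall>i j. T $ i $ j = T $ j $ i)}"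
    (is "_ = ?W")
proof
  show "range (linear_part a) \<subseteq> ?W" by (auto simp: linear_part_def)
  show "?W \<subseteq> range (linear_part a)"
  proof
    fix y assume "y \<in> ?W"
    then obtain S T where y: "y = (S, T)" and S: "\<And>i j. S $ i $ j = S $ j $ i" "\<And>i. S $ i $ i = 0"
      and T: "\<And>i j. T $ i $ j = T $ j $ i" by auto
    define X where "X = (\<chi> i j. if i = j then T $ i $ i / 2 else (S $ i $ j - a i * T $ i $ j) / (a j - a i))"
    have "a j * X $ i $ j + a i * X $ j $ i = S $ i $ j \<and> X $ i $ j + X $ j $ i = T $ i $ j" if "i \<noteq> j" for i j
    proof -
      have d: "a j - a i \<noteq> 0" using assms that by (auto dest: injD)
      have X1: "X $ i $ j * (a j - a i) = S $ i $ j - a i * T $ i $ j" using that d by (simp add: X_def)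
      have "X $ j $ i * (a i - a j) = S $ i $ j - a j * T $ i $ j"
        using that d S(1)[of j i] T[of j i] by (simp add: X_def)
      then have X2: "X $ j $ i * (a j - a i) = a j * T $ i $ j - S $ i $ j"
        by (simp add: algebra_simps)
      have "(a j * X $ i $ j + a i * X $ j $ i) * (a j - a i)
        = a j * (X $ i $ j * (a j - a i)) + a i * (X $ j $ i * (a j - a i))" by (simp add: algebra_simps)
      also have "\<dots> = S $ i $ j * (a j - a i)" unfolding X1 X2 by (simp add: algebra_simps)
      finally have e1: "a j * X $ i $ j + a i * X $ j $ i = S $ i $ j" using d by simp
      have "(X $ i $ j + X $ j $ i) * (a j - a i) = X $ i $ j * (a j - a i) + X $ j $ i * (a j - a i)"
        by (simp add: algebra_simps)
      also have "\<dots> = T $ i $ j * (a j - a i)" unfolding X1 X2 by (simp add: algebra_simps)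
      finally show ?thesis using e1 d by simp
    qed
    moreover have "X $ i $ i + X $ i $ i = T $ i $ i" for i by (simp add: X_def)
    ultimately have "(if i = j then 0 else a j * X $ i $ j + a i * X $ j $ i) = S $ i $ j \<and>
        X $ i $ j + X $ j $ i = T $ i $ j" for i j
      using S(2) by (cases "i = j") auto
    then have "linear_part a X = y"
      unfolding y linear_part_def by (simp add: vec_eq_iff)
    then show "y \<in> range (linear_part a)" by blast
  qed
qed

lemma inj_linear_part:
  assumes "inj a" shows "inj (linear_part a)"
  unfolding linear_injective_0[OF linear_linear_part]
proof (intro allI impI)
  fix X assume X: "linear_part a X = 0"
  have 1: "a j * X $ i $ j + a i * X $ j $ i = 0" if "i \<noteq> j" for i j
    using X that by (simp add: linear_part_def prod_eq_iff vec_eq_iff) metis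
  have 2: "X $ j $ i = - X $ i $ j" for i j
    using X by (simp add: linear_part_def prod_eq_iff vec_eq_iff eq_neg_iff_add_eq_0 add.commute)
  have "X $ i $ j = 0" for i j
  proof (cases "i = j")
    case False
    then have "(a j - a i) * X $ i $ j = 0" using 1[OF False] by (simp add: 2[of j i] algebra_simps)
    then show ?thesis using False assms by (auto dest: injD)
  qed (use 2[of i i] in simp)
  then show "X = 0" by (simp add: vec_eq_iff)
qed

lemma dim_range_linear_part:
  assumes "inj a" shows "dim (range (linear_part (a :: 'n::finite \<Rightarrow> real))) = CARD('n) * CARD('n)"
proof -
  have "dim (linear_part a ` UNIV) = dim (UNIV :: (real ^ 'n ^ 'n) set)"
    by (rule dim_image_eq[OF linear_linear_part]) (use inj_linear_part[OF assms] in \<open>auto intro: inj_on_subset\<close>)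
  then show ?thesis by (simp add: dim_UNIV)
qed

lemma constraint_map_range:
  assumes "inj a" "\<And>i j. f U $ i $ j = f U $ j $ i"
  shows "constraint_map f U \<in> range (linear_part a)"
  unfolding range_linear_part[OF assms(1)] using assms(2)
  by (auto simp: constraint_map_def off_diagonal_def gram_def mat_def inner_commute)

lemma weighted_form_expand:
  "constraint_map (weighted_form a) (mat 1 + X)
    = linear_part a X + (off_diagonal (weighted_form a X), gram X)"
proof -
  have m: "(mat 1 :: real ^ 'n ^ 'n) $ i $ j = (if i = j then 1 else 0)" for i j by (simp add: mat_def)
  have "weighted_form a (mat 1 + X) $ i $ j
    = (if i = j then a i else 0) + a i * X $ j $ i + a j * X $ i $ j + weighted_form a X $ i $ j" for i j
    unfolding weighted_form_def
    by (simp add: m algebra_simps sum.distrib if_distrib[of "\<lambda>x. _ * x"] sum.delta sum.delta' cong: if_cong)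
  moreover have "gram (mat 1 + X) $ i $ j
    = (if i = j then 1 else 0) + X $ j $ i + X $ i $ j + gram X $ i $ j" for i j
    unfolding gram_def inner_vec_def
    by (simp add: m algebra_simps sum.distrib if_distrib[of "\<lambda>x. _ * x"] sum.delta sum.delta' cong: if_cong)
  ultimately show ?thesis
    by (auto simp: constraint_map_def off_diagonal_def linear_part_def vec_eq_iff m)
qed

lemma constraint_map_zero:
  assumes "constraint_map f U = 0"
  shows "orthogonal_matrix U" "\<And>i j. i \<noteq> j \<Longrightarrow> f U $ i $ j = 0"
proof -
  have g: "gram U = mat 1" using assms by (simp add: constraint_map_def prod_eq_iff)
  have "U ** transpose U = gram U"
    by (simp add: matrix_matrix_mult_def transpose_def gram_def inner_vec_def vec_eq_iff)
  then have "U ** transpose U = mat 1" using g by simp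
  then show "orthogonal_matrix U" unfolding orthogonal_matrix_def using matrix_left_right_inverse by blast
  have "off_diagonal (f U) = 0" using assms by (simp add: constraint_map_def prod_eq_iff)
  then show "\<And>i j. i \<noteq> j \<Longrightarrow> f U $ i $ j = 0"
    by (simp add: off_diagonal_def vec_eq_iff) metis
qed

text \<open>
If \<open>U A U\<^sup>t = D\<close> is diagonal and \<open>U\<close> orthogonal, then \<open>U A = D U\<close>. Thus \<open>U i k \<noteq> 0\<close> forces \<open>a k = D i i\<close>, which determines
\<open>k\<close>: each row has a single non-zero entry, and this is \<open>1\<close> or \<open>-1\<close>.
\<close>

lemma weighted_form_zero:
  fixes U :: "real ^ 'n ^ 'n"
  assumes a: "inj a" and z: "constraint_map (weighted_form a) U = 0"
  shows "\<exists>g\<in>signed_perms. U = permute_rows g (mat 1)"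
proof -
  have orth: "orthogonal_matrix U" and off: "\<And>i j. i \<noteq> j \<Longrightarrow> weighted_form a U $ i $ j = 0"
    using constraint_map_zero[OF z] by blast+
  have cols: "(\<Sum>j\<in>UNIV. U $ j $ l * U $ j $ k) = (if l = k then 1 else 0)" for l k
  proof -
    have "(transpose U ** U) $ l $ k = (mat 1 :: real ^ 'n ^ 'n) $ l $ k"
      using orth by (simp add: orthogonal_matrix_def)
    then show ?thesis by (simp add: matrix_matrix_mult_def transpose_def mat_def)
  qed
  have "gram U = mat 1" using z by (simp add: constraint_map_def prod_eq_iff)
  then have "gram U $ i $ j = (mat 1 :: real ^ 'n ^ 'n) $ i $ j" for i j by simp
  then have rows: "(\<Sum>k\<in>UNIV. U $ i $ k * U $ j $ k) = (if i = j then 1 else 0)" for i j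
    by (simp add: gram_def inner_vec_def mat_def)
  \<comment> \<open>\<open>U A = (U A U\<^sup>t) U\<close>, where only the diagonal of the factor in brackets survives\<close>
  have eig: "a k * U $ i $ k = weighted_form a U $ i $ i * U $ i $ k" for i k
  proof -
    have "a k * U $ i $ k = (\<Sum>l\<in>UNIV. a l * U $ i $ l * (\<Sum>j\<in>UNIV. U $ j $ l * U $ j $ k))"
      by (simp add: cols if_distrib[of "\<lambda>x. _ * x"] sum.delta cong: if_cong)
    also have "\<dots> = (\<Sum>j\<in>UNIV. weighted_form a U $ i $ j * U $ j $ k)"
      unfolding weighted_form_def sum_distrib_left sum_distrib_right
      by (subst sum.swap) (simp add: mult_ac sum_distrib_left sum_distrib_right)
    also have "\<dots> = (\<Sum>j\<in>UNIV. if j = i then weighted_form a U $ i $ i * U $ i $ k else 0)"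
      using off by (intro sum.cong) auto
    finally show ?thesis by simp
  qed
  have uniq: "k = l" if "U $ i $ k \<noteq> 0" "U $ i $ l \<noteq> 0" for i k l
    using eig[of k i] eig[of l i] that a by (metis injD mult_right_cancel)
  have "\<exists>k. U $ i $ k \<noteq> 0" for i
  proof (rule ccontr)
    assume "\<not> ?thesis"
    then show False using rows[of i i] by simp
  qed
  then obtain s where s: "\<And>i. U $ i $ s i \<noteq> 0" by metis
  have s0: "U $ i $ k = 0" if "k \<noteq> s i" for i k using uniq s that by blast
  have row: "(\<Sum>k\<in>UNIV. U $ i $ k * U $ j $ k) = U $ i $ s i * U $ j $ s i" for i j
  proof -
    have "(\<Sum>k\<in>UNIV. U $ i $ k * U $ j $ k) = (\<Sum>k\<in>UNIV. if k = s i then U $ i $ s i * U $ j $ s i else 0)"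
      using s0 by (intro sum.cong) auto
    then show ?thesis by simp
  qed
  have "U $ i $ s i * U $ i $ s i = 1" for i using row[of i i] rows[of i i] by simp
  then have pm: "U $ i $ s i = 1 \<or> U $ i $ s i = - 1" for i
    by (metis square_eq_1_iff)
  have "inj s"
  proof (rule injI, rule ccontr)
    fix i j assume ij: "s i = s j" "i \<noteq> j"
    then show False using row[of i j] rows[of i j] s[of i] s[of j] by simp
  qed
  then have bs: "bij s" by (simp add: bij_def finite_UNIV_inj_surj)
  define e where "e i = (if U $ i $ s i = 1 then 1 else - 1 :: int)" for i
  have "(s, e) \<in> signed_perms" using bs by (auto simp: signed_perms_def e_def)
  moreover have "U = permute_rows (s, e) (mat 1)"
    using pm s0 by (auto simp: permute_rows_def mat_def vec_eq_iff e_def)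
  ultimately show ?thesis by blast
qed

lemma norm_matrix_le: "norm (X :: real ^ 'm ^ 'n) \<le> (\<Sum>i\<in>UNIV. \<Sum>j\<in>UNIV. \<bar>X $ i $ j\<bar>)"
proof -
  have "norm X \<le> (\<Sum>i\<in>UNIV. norm (X $ i))" unfolding norm_vec_def by (rule L2_set_le_sum) simp
  also have "\<dots> \<le> (\<Sum>i\<in>UNIV. \<Sum>j\<in>UNIV. \<bar>X $ i $ j\<bar>)" by (intro sum_mono norm_le_l1_cart)
  finally show ?thesis .
qed

lemma entry_le_norm: "\<bar>(X :: real ^ 'm ^ 'n) $ i $ j\<bar> \<le> norm X"
  using component_le_norm_cart[of "X $ i" j] Finite_Cartesian_Product.norm_nth_le[of X i] by linarith

lemma quadratic_part_bound:
  obtains C where "0 < C"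
    "\<And>X :: real ^ 'n ^ 'n. norm (off_diagonal (weighted_form a X), gram X) \<le> C * (norm X)\<^sup>2"
proof -
  define A where "A = (\<Sum>k\<in>UNIV. \<bar>a k\<bar>)"
  define d where "d = real CARD('n)"
  have d: "d > 0" by (simp add: d_def)
  have A: "A \<ge> 0" unfolding A_def by (rule sum_nonneg) simp
  have w: "\<bar>weighted_form a X $ i $ j\<bar> \<le> A * (norm X)\<^sup>2" for X :: "real ^ 'n ^ 'n" and i j
  proof -
    have "\<bar>weighted_form a X $ i $ j\<bar> \<le> (\<Sum>k\<in>UNIV. \<bar>a k\<bar> * (\<bar>X $ i $ k\<bar> * \<bar>X $ j $ k\<bar>))"
      unfolding weighted_form_def by (simp add: sum_abs[THEN order_trans] abs_mult)
    also have "\<dots> \<le> (\<Sum>k\<in>UNIV. \<bar>a k\<bar> * (norm X * norm X))"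
      by (intro sum_mono mult_left_mono mult_mono entry_le_norm) auto
    finally show ?thesis by (simp add: A_def sum_distrib_right power2_eq_square)
  qed
  have g: "\<bar>gram X $ i $ j\<bar> \<le> (norm X)\<^sup>2" for X :: "real ^ 'n ^ 'n" and i j
  proof -
    have "\<bar>gram X $ i $ j\<bar> \<le> norm (X $ i) * norm (X $ j)" unfolding gram_def by (simp add: Cauchy_Schwarz_ineq2)
    also have "\<dots> \<le> norm X * norm X" by (intro mult_mono Finite_Cartesian_Product.norm_nth_le) auto
    finally show ?thesis by (simp add: power2_eq_square)
  qed
  have "norm (off_diagonal (weighted_form a X), gram X) \<le> (d * (d * (A + 1))) * (norm X)\<^sup>2" for X :: "real ^ 'n ^ 'n"
  proof -
    have "norm (off_diagonal (weighted_form a X)) \<le> (\<Sum>i\<in>(UNIV::'n set). \<Sum>j\<in>(UNIV::'n set). A * (norm X)\<^sup>2)"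
      by (rule order_trans[OF norm_matrix_le], intro sum_mono) (use w A in \<open>auto simp: off_diagonal_def\<close>)
    moreover have "norm (gram X) \<le> (\<Sum>i\<in>(UNIV::'n set). \<Sum>j\<in>(UNIV::'n set). (norm X)\<^sup>2)"
      by (rule order_trans[OF norm_matrix_le], intro sum_mono) (use g in auto)
    ultimately show ?thesis
      using norm_Pair_le[of "off_diagonal (weighted_form a X)" "gram X"] by (simp add: d_def algebra_simps)
  qed
  moreover have "0 < d * (d * (A + 1))" using d A by simp
  ultimately show ?thesis using that by blast
qed

text \<open>
A compact neighbourhood of the orthogonal group.
\<close>

definition box_matrices :: "(real ^ 'n ^ 'n) set" where
  "box_matrices = {U. \<forall>i j. \<bar>U $ i $ j\<bar> \<le> 2}"

lemma compact_box_matrices: "compact (box_matrices :: (real ^ 'n ^ 'n) set)"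
proof -
  have "closed (box_matrices :: (real ^ 'n ^ 'n) set)"
    unfolding box_matrices_def by (intro closed_Collect_all closed_Collect_le continuous_intros)
  moreover have "bounded (box_matrices :: (real ^ 'n ^ 'n) set)"
    unfolding bounded_iff
  proof (intro exI ballI)
    fix U :: "real ^ 'n ^ 'n" assume "U \<in> box_matrices"
    then show "norm U \<le> (\<Sum>i\<in>(UNIV::'n set). \<Sum>j\<in>(UNIV::'n set). 2)"
      by (intro order_trans[OF norm_matrix_le] sum_mono) (auto simp: box_matrices_def)
  qed
  ultimately show ?thesis by (simp add: compact_eq_bounded_closed)
qed

text \<open>
Near the zeros the derivative dominates the quadratic remainder, and away from them compactness gives a
positive lower bound. A bound linear in the distance to the zeros allows a modification of
size \<open>O(r\<^sup>2)\<close> within distance \<open>r\<close> of the zeros to create no new zeros.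
\<close>

lemma weighted_form_linear_lower_bound:
  assumes a: "inj (a :: 'n::finite \<Rightarrow> real)"
  obtains c where "0 < c" "\<And>U. U \<in> box_matrices \<Longrightarrow>
    \<exists>g\<in>signed_perms. c * norm (U - permute_rows g (mat 1)) \<le> norm (constraint_map (weighted_form a) U)"
proof -
  let ?\<Phi> = "constraint_map (weighted_form a)"
  obtain B where B: "0 < B" "\<And>X. B * norm X \<le> norm (linear_part a X)"
    using linear_inj_bounded_below_pos[OF linear_linear_part inj_linear_part[OF a]] by blast
  obtain C where C: "0 < C"
    "\<And>X :: real ^ 'n ^ 'n. norm (off_diagonal (weighted_form a X), gram X) \<le> C * (norm X)\<^sup>2"
    using quadratic_part_bound by blast
  define r where "r = B / (2 * C)"
  have r: "0 < r" using B C by (simp add: r_def)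
  have near: "B / 2 * norm (U - permute_rows g (mat 1)) \<le> norm (?\<Phi> U)"
    if g: "g \<in> signed_perms" and U: "norm (U - permute_rows g (mat 1)) \<le> r" for g U
  proof -
    define X where "X = permute_rows (sp_inv g) U - mat 1"
    have UX: "U = permute_rows g (mat 1 + X)" by (simp add: X_def permute_rows_inv g)
    have "U - permute_rows g (mat 1) = permute_rows g X"
      unfolding UX permute_rows_diff[symmetric] by simp
    then have nX: "norm (U - permute_rows g (mat 1)) = norm X" by (simp add: norm_permute_rows g)
    have "norm (?\<Phi> U) = norm (?\<Phi> (mat 1 + X))"
      unfolding UX constraint_map_equivariant[OF weighted_form_equivariant g] norm_conjugate2[OF g] ..
    also have "\<dots> \<ge> norm (linear_part a X) - norm (off_diagonal (weighted_form a X), gram X)"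
      unfolding weighted_form_expand by (rule norm_diff_ineq)
    finally have "norm (?\<Phi> U) \<ge> B * norm X - C * (norm X)\<^sup>2"
      using B(2)[of X] C(2)[of X] by linarith
    moreover have "C * (norm X)\<^sup>2 \<le> B / 2 * norm X"
    proof -
      have "C * norm X \<le> C * r" using U nX C(1) by simp
      also have "\<dots> = B / 2" using C(1) by (simp add: r_def)
      finally have "C * norm X * norm X \<le> B / 2 * norm X" by (rule mult_right_mono) simp
      then show ?thesis by (simp add: power2_eq_square mult.assoc)
    qed
    ultimately show ?thesis unfolding nX by linarith
  qed
  define K where "K = box_matrices \<inter> {U :: real ^ 'n ^ 'n. \<forall>g\<in>signed_perms. r \<le> norm (U - permute_rows g (mat 1))}"
  have "closed {U :: real ^ 'n ^ 'n. \<forall>g\<in>signed_perms. r \<le> norm (U - permute_rows g (mat 1))}"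
  proof -
    have eq: "{U. \<forall>g\<in>signed_perms. r \<le> norm (U - permute_rows g (mat 1))}
      = (\<Inter>g\<in>signed_perms. {U. r \<le> norm (U - permute_rows g (mat 1 :: real ^ 'n ^ 'n))})" by blast
    show ?thesis unfolding eq by (intro closed_INT ballI closed_Collect_le continuous_intros)
  qed
  then have K: "compact K" unfolding K_def by (intro compact_Int_closed compact_box_matrices)
  have nz: "norm (?\<Phi> U) > 0" if "U \<in> K" for U
  proof -
    have "?\<Phi> U \<noteq> 0"
    proof
      assume "?\<Phi> U = 0"
      then obtain g where "g \<in> signed_perms" "U = permute_rows g (mat 1)" using weighted_form_zero[OF a] by blast
      then show False using that r by (auto simp: K_def)
    qed
    then show ?thesis by simp
  qed
  obtain \<eta> where \<eta>: "0 < \<eta>" "\<And>U. U \<in> K \<Longrightarrow> \<eta> \<le> norm (?\<Phi> U)"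
  proof (cases "K = {}")
    case True then show ?thesis using that[of 1] by auto
  next
    case False
    have "continuous_on K (\<lambda>U. norm (?\<Phi> U))"
      by (intro continuous_intros continuous_constraint_map continuous_weighted_form)
    then show ?thesis using continuous_attains_inf[OF K False] nz that by metis
  qed
  obtain D where D: "0 < D" "\<And>U :: real ^ 'n ^ 'n. U \<in> box_matrices \<Longrightarrow> norm (U - permute_rows sp_one (mat 1)) \<le> D"
  proof -
    obtain b where b: "0 < b" "\<And>U :: real ^ 'n ^ 'n. U \<in> box_matrices \<Longrightarrow> norm U \<le> b"
      using compact_imp_bounded[OF compact_box_matrices] unfolding bounded_pos by blast
    show ?thesis
    proof (rule that[of "b + norm (permute_rows sp_one (mat 1) :: real ^ 'n ^ 'n)"])
      show "0 < b + norm (permute_rows sp_one (mat 1) :: real ^ 'n ^ 'n)" using b(1) by (simp add: add_pos_nonneg)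
      fix U :: "real ^ 'n ^ 'n" assume "U \<in> box_matrices"
      then show "norm (U - permute_rows sp_one (mat 1)) \<le> b + norm (permute_rows sp_one (mat 1) :: real ^ 'n ^ 'n)"
        using b(2)[of U] norm_triangle_ineq4[of U "permute_rows sp_one (mat 1)"] by linarith
    qed
  qed
  define c where "c = min (B / 2) (\<eta> / D)"
  have c: "0 < c" "c \<le> B / 2" "c \<le> \<eta> / D"
    unfolding c_def by (simp add: B(1) \<eta>(1) D(1), rule min.cobounded1, rule min.cobounded2)
  have "\<exists>g\<in>signed_perms. c * norm (U - permute_rows g (mat 1)) \<le> norm (?\<Phi> U)" if U: "U \<in> box_matrices" for U
  proof (cases "U \<in> K")
    case True
    have "c * norm (U - permute_rows sp_one (mat 1)) \<le> \<eta> / D * D"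
      using c(1,3) D U by (intro mult_mono) auto
    also have "\<dots> \<le> norm (?\<Phi> U)" using D(1) \<eta>(2)[OF True] by simp
    finally show ?thesis using sp_one_mem by blast
  next
    case False
    then obtain g where g: "g \<in> signed_perms" "norm (U - permute_rows g (mat 1)) \<le> r"
      using U by (auto simp: K_def)
    have "c * norm (U - permute_rows g (mat 1)) \<le> B / 2 * norm (U - permute_rows g (mat 1))"
      using c(2) by (intro mult_right_mono) auto
    also have "\<dots> \<le> norm (?\<Phi> U)" by (rule near[OF g])
    finally show ?thesis using g(1) by blast
  qed
  then show ?thesis using c(1) that by blast
qed

text \<open>
The entries are integers, so matrices at distance less than 1 coincide.
\<close>

lemma signed_perm_matrices_separated:
  assumes "g \<in> signed_perms" "h \<in> signed_perms"
    and "norm (permute_rows g (mat 1) - permute_rows h (mat 1) :: real ^ 'n ^ 'n) < 1"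
  shows "g = h"
proof -
  have entry: "\<bar>(permute_rows g (mat 1) - permute_rows h (mat 1) :: real ^ 'n ^ 'n) $ i $ j\<bar> < 1" for i j
    using entry_le_norm[of "permute_rows g (mat 1) - permute_rows h (mat 1) :: real ^ 'n ^ 'n" i j] assms(3) by linarith
  have "fst h i = fst g i \<and> snd h i = snd g i" for i
    using entry[of i "fst g i"] sp_sign[OF assms(1), of i] sp_sign[OF assms(2), of i]
    by (auto simp: permute_rows_def mat_def split: if_splits)
  then show ?thesis by (auto simp: prod_eq_iff fun_eq_iff)
qed

text \<open>
Within distance \<open>r\<close> of a signed permutation matrix the model map is replaced by its linearisation,
with the zero moved from the identity to \<open>y\<close>. A linear map agrees with its piecewise linear interpolation, so the
balanced facets can be counted exactly. The map jumps at distance \<open>r\<close>, which is harmless because only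
its values at grid points matter.
\<close>

definition start_map :: "('n \<Rightarrow> real) \<Rightarrow> real \<Rightarrow> real ^ 'n ^ 'n \<Rightarrow> real ^ 'n ^ 'n \<Rightarrow> (real ^ 'n ^ 'n) \<times> (real ^ 'n ^ 'n)" where
  "start_map a r y U =
    (if \<exists>g\<in>signed_perms. norm (U - permute_rows g (mat 1)) < r
     then let g = SOME g. g \<in> signed_perms \<and> norm (U - permute_rows g (mat 1)) < r
          in conjugate2 g (linear_part a (permute_rows (sp_inv g) U - y))
     else constraint_map (weighted_form a) U)"

lemma start_map_near:
  assumes "g \<in> signed_perms" "norm (X - mat 1) < r" "r \<le> 1 / 2"
  shows "start_map a r y (permute_rows g X) = conjugate2 g (linear_part a (X - y))"
proof -
  let ?U = "permute_rows g X"
  let ?P = "\<lambda>g. g \<in> signed_perms \<and> norm (?U - permute_rows g (mat 1)) < r"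
  have g: "?P g" using assms(1,2) by (simp add: norm_permute_rows flip: permute_rows_diff)
  have "h = g" if h: "?P h" for h
  proof (rule signed_perm_matrices_separated)
    have "norm (permute_rows h (mat 1) - permute_rows g (mat 1))
        \<le> norm (?U - permute_rows g (mat 1)) + norm (?U - permute_rows h (mat 1))"
      using norm_triangle_ineq4[of "?U - permute_rows g (mat 1)" "?U - permute_rows h (mat 1)"] by simp
    then show "norm (permute_rows h (mat 1) - permute_rows g (mat 1)) < 1"
      using g h assms(3) by linarith
  qed (use g h in auto)
  then have "(SOME g. ?P g) = g" using g by (rule some_equality[rotated])
  moreover have "\<exists>g\<in>signed_perms. norm (?U - permute_rows g (mat 1)) < r" using g by blast
  ultimately show ?thesis
    unfolding start_map_def Let_def by (simp add: permute_rows_inv assms(1))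
qed

lemma start_map_far:
  assumes "\<And>g. g \<in> signed_perms \<Longrightarrow> r \<le> norm (U - permute_rows g (mat 1))"
  shows "start_map a r y U = constraint_map (weighted_form a) U"
  using assms unfolding start_map_def by force

lemma start_map_cases:
  obtains g X where "g \<in> signed_perms" "U = permute_rows g X" "norm (X - mat 1) < r"
  | "\<And>g. g \<in> signed_perms \<Longrightarrow> r \<le> norm (U - permute_rows g (mat 1))"
proof (cases "\<exists>g\<in>signed_perms. norm (U - permute_rows g (mat 1)) < r")
  case True
  then obtain g where g: "g \<in> signed_perms" "norm (U - permute_rows g (mat 1)) < r" by blast
  have "norm (permute_rows (sp_inv g) U - mat 1) = norm (permute_rows g (permute_rows (sp_inv g) U - mat 1))"
    by (simp add: norm_permute_rows g)
  also have "\<dots> < r" unfolding permute_rows_diff using g by (simp add: permute_rows_inv)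
  finally show ?thesis using that(1)[of g "permute_rows (sp_inv g) U"] g by (simp add: permute_rows_inv)
qed (use that(2) in force)

lemma start_map_equivariant:
  assumes g: "g \<in> signed_perms" and r: "r \<le> 1 / 2"
  shows "start_map a r y (permute_rows g U) = conjugate2 g (start_map a r y U)"
proof (rule start_map_cases[of U r])
  fix h X assume h: "h \<in> signed_perms" "U = permute_rows h X" "norm (X - mat 1) < r"
  then show ?thesis
    using start_map_near[OF sp_mul_mem[OF g h(1)] h(3) r, of a y] start_map_near[OF h(1,3) r, of a y]
    by (simp add: permute_rows_mul conjugate2_mul)
next
  assume far: "\<And>h. h \<in> signed_perms \<Longrightarrow> r \<le> norm (U - permute_rows h (mat 1))"
  have "r \<le> norm (permute_rows g U - permute_rows h (mat 1))" if h: "h \<in> signed_perms" for h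
  proof -
    define k where "k = sp_mul (sp_inv g) h"
    have "permute_rows h (mat 1) = permute_rows g (permute_rows k (mat 1))"
      by (simp add: k_def permute_rows_mul permute_rows_inv g)
    then have "norm (permute_rows g U - permute_rows h (mat 1)) = norm (U - permute_rows k (mat 1))"
      by (simp add: norm_permute_rows g flip: permute_rows_diff)
    then show ?thesis using far[of k] by (simp add: k_def sp_mul_mem sp_inv_mem g h)
  qed
  then show ?thesis
    using far by (simp add: start_map_far constraint_map_equivariant weighted_form_equivariant g)
qed

lemma start_map_range:
  assumes "inj a" "r \<le> 1 / 2"
  shows "start_map a r y U \<in> range (linear_part a)"
proof (rule start_map_cases[of U r])
  fix g X assume g: "g \<in> signed_perms" "U = permute_rows g X" "norm (X - mat 1) < r"
  obtain S T where ST: "linear_part a (X - y) = (S, T)" by (cases "linear_part a (X - y)")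
  have "(S, T) \<in> range (linear_part a)" using ST by (metis rangeI)
  then show ?thesis
    unfolding g(2) start_map_near[OF g(1,3) assms(2)] ST range_linear_part[OF assms(1)]
    by (auto simp: conjugate2_def conjugate_def mult.commute)
next
  assume "\<And>h. h \<in> signed_perms \<Longrightarrow> r \<le> norm (U - permute_rows h (mat 1))"
  then show ?thesis
    by (simp only: start_map_far) (rule constraint_map_range[OF assms(1)], simp add: weighted_form_def mult_ac)
qed

text \<open>
The price of the linearisation is the quadratic remainder, at most \<open>C r\<^sup>2\<close>, and the displacement of the zero.
\<close>

lemma start_map_close:
  assumes C: "\<And>X :: real ^ 'n ^ 'n. norm (off_diagonal (weighted_form a X), gram X) \<le> C * (norm X)\<^sup>2" "0 \<le> C"
    and L: "\<And>X :: real ^ 'n ^ 'n. norm (linear_part a X) \<le> L * norm X"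
    and r: "0 \<le> r" "r \<le> 1 / 2" and L0: "0 \<le> L"
  shows "norm (start_map a r y U - constraint_map (weighted_form a) U) \<le> C * r\<^sup>2 + L * norm (y - mat 1)"
proof (rule start_map_cases[of U r])
  fix g X assume g: "g \<in> signed_perms" "U = permute_rows g X" "norm (X - mat 1) < r"
  let ?Q = "(off_diagonal (weighted_form a (X - mat 1)), gram (X - mat 1))"
  have "constraint_map (weighted_form a) (permute_rows g X)
    = conjugate2 g (constraint_map (weighted_form a) (mat 1 + (X - mat 1)))"
    by (simp add: constraint_map_equivariant weighted_form_equivariant g)
  then have "start_map a r y U - constraint_map (weighted_form a) U
    = conjugate2 g (linear_part a (X - y) - (linear_part a (X - mat 1) + ?Q))"
    unfolding g(2) start_map_near[OF g(1,3) r(2)] weighted_form_expand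
    by (simp add: linear_diff[OF linear_conjugate2])
  then have "norm (start_map a r y U - constraint_map (weighted_form a) U)
    = norm (linear_part a (X - y) - linear_part a (X - mat 1) - ?Q)"
    by (simp only: norm_conjugate2[OF g(1)]) (simp add: algebra_simps)
  also have "linear_part a (X - y) - linear_part a (X - mat 1) = - linear_part a (y - mat 1)"
    by (simp add: linear_diff[OF linear_linear_part])
  also have "norm (- linear_part a (y - mat 1) - ?Q) \<le> norm (linear_part a (y - mat 1)) + norm ?Q"
    using norm_triangle_ineq4[of "- linear_part a (y - mat 1)" ?Q] by simp
  also have "\<dots> \<le> L * norm (y - mat 1) + C * (norm (X - mat 1))\<^sup>2"
    by (intro add_mono L C)
  also have "C * (norm (X - mat 1))\<^sup>2 \<le> C * r\<^sup>2"
    using g(3) C(2) by (intro mult_left_mono power_mono) auto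
  finally show ?thesis by simp
next
  assume "\<And>h. h \<in> signed_perms \<Longrightarrow> r \<le> norm (U - permute_rows h (mat 1))"
  then show ?thesis using C(2) L0 by (simp add: start_map_far)
qed

section \<open>Equivariant maps on the orthogonal group have zeros\<close>

lemma not_balanced_if_close:
  fixes g :: "'v \<Rightarrow> 'y::real_inner"
  assumes "finite F" "\<And>v. v \<in> F \<Longrightarrow> norm (g v - w) < norm w"
  shows "\<not> balanced g F"
proof (rule not_balanced_if_positive[of "\<lambda>y. w \<bullet> y"])
  fix v assume v: "v \<in> F"
  have w: "0 < norm w" using assms(2)[OF v] by (meson le_less_trans norm_ge_zero)
  have "\<bar>w \<bullet> (g v - w)\<bar> \<le> norm w * norm (g v - w)" by (rule Cauchy_Schwarz_ineq2)
  also have "\<dots> < norm w * norm w" using assms(2)[OF v] w by (intro mult_strict_left_mono)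
  also have "\<dots> = w \<bullet> w" by (simp add: power2_eq_square flip: power2_norm_eq_inner)
  finally show "0 < w \<bullet> g v" by (simp add: inner_diff_right)
qed (use assms in \<open>auto intro: bounded_linear.linear bounded_linear_inner_right\<close>)

definition near_orthogonal :: "real ^ 'n ^ 'n \<Rightarrow> bool" where
  "near_orthogonal U \<longleftrightarrow> (\<forall>i j. \<bar>(gram U - mat 1) $ i $ j\<bar> \<le> 1 / 4)"

text \<open>
If \<open>U = M u\<close> violates orthonormality markedly, then so do all vertices of a small simplex, all in the
same entry of the Gram matrix and with the same sign: either some row is too long, or all rows
are bounded and the entry varies little. This entry then separates the values from the origin.
\<close>

lemma balanced_imp_near_orthogonal:
  fixes M :: "'v \<Rightarrow> real ^ 'n ^ 'n" and G :: "'v \<Rightarrow> (real ^ 'n ^ 'n) \<times> (real ^ 'n ^ 'n)"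
  assumes S: "finite S" "balanced G S" and u: "u \<in> S"
    and mesh: "\<And>v. v \<in> S \<Longrightarrow> norm (M v - M u) \<le> 1 / 100"
    and close: "\<And>v. v \<in> S \<Longrightarrow> norm (snd (G v) - (gram (M v) - mat 1)) \<le> 1 / 8"
  shows "near_orthogonal (M u)"
proof (rule ccontr)
  assume not: "\<not> near_orthogonal (M u)"
  have row: "norm (M v $ i - M u $ i) \<le> 1 / 100" if "v \<in> S" for v i
    using Finite_Cartesian_Product.norm_nth_le[of "M v - M u" i] mesh[OF that] by simp
  have entry: "\<bar>snd (G v) $ i $ j - (gram (M v) - mat 1) $ i $ j\<bar> \<le> 1 / 8" if "v \<in> S" for v i j
    using entry_le_norm[of "snd (G v) - (gram (M v) - mat 1)" i j] close[OF that] by simp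
  have lin: "linear (\<lambda>y. s * snd y $ i $ j)" for s :: real and i j
    by (rule linearI) (simp_all add: algebra_simps)
  show False
  proof (cases "\<exists>i. norm (M u $ i) > 2")
    case True
    then obtain i where i: "norm (M u $ i) > 2" by blast
    have "0 < 1 * snd (G v) $ i $ i" if v: "v \<in> S" for v
    proof -
      have "norm (M u $ i) \<le> norm (M v $ i) + norm (M v $ i - M u $ i)"
        using norm_triangle_ineq4[of "M v $ i" "M v $ i - M u $ i"] by simp
      then have "norm (M v $ i) \<ge> 3 / 2" using i row[OF v, of i] by linarith
      then have "(norm (M v $ i))\<^sup>2 \<ge> (3 / 2)\<^sup>2" by (intro power_mono) auto
      moreover have "gram (M v) $ i $ i = (norm (M v $ i))\<^sup>2" by (simp add: gram_def power2_norm_eq_inner)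
      ultimately have "gram (M v) $ i $ i \<ge> 9 / 4" by (simp add: power2_eq_square)
      moreover have "\<bar>snd (G v) $ i $ i - (gram (M v) $ i $ i - 1)\<bar> \<le> 1 / 8"
        using entry[OF v, of i i] by (simp add: mat_def)
      ultimately show ?thesis by linarith
    qed
    then show False using not_balanced_if_positive[OF lin S(1), of 1 G i i] S(2) by blast
  next
    case False
    then have b: "norm (M u $ i) \<le> 2" for i by (meson not_less)
    obtain i j where ij: "\<bar>(gram (M u) - mat 1) $ i $ j\<bar> > 1 / 4"
      using not unfolding near_orthogonal_def by (auto simp: not_le)
    have diff: "\<bar>gram (M v) $ i $ j - gram (M u) $ i $ j\<bar> \<le> 1 / 20" if v: "v \<in> S" for v
    proof -
      have nv: "norm (M v $ j) \<le> 2 + 1 / 100"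
        using norm_triangle_ineq[of "M u $ j" "M v $ j - M u $ j"] row[OF v, of j] b[of j] by simp
      have "gram (M v) $ i $ j - gram (M u) $ i $ j
        = (M v $ i - M u $ i) \<bullet> M v $ j + M u $ i \<bullet> (M v $ j - M u $ j)"
        by (simp add: gram_def inner_diff_left inner_diff_right)
      also have "\<bar>\<dots>\<bar> \<le> norm (M v $ i - M u $ i) * norm (M v $ j) + norm (M u $ i) * norm (M v $ j - M u $ j)"
        by (intro order_trans[OF abs_triangle_ineq] add_mono Cauchy_Schwarz_ineq2)
      also have "\<dots> \<le> (1 / 100) * (2 + 1 / 100) + 2 * (1 / 100)"
        by (intro add_mono mult_mono row[OF v] nv b) auto
      finally show ?thesis by simp
    qed
    define s :: real where "s = (if (gram (M u) - mat 1) $ i $ j > 0 then 1 else - 1)"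
    have "0 < s * snd (G v) $ i $ j" if v: "v \<in> S" for v
    proof -
      have 1: "\<bar>snd (G v) $ i $ j - (gram (M v) $ i $ j - mat 1 $ i $ j)\<bar> \<le> 1 / 8"
        using entry[OF v, of i j] by simp
      have 2: "1 / 4 < \<bar>gram (M u) $ i $ j - mat 1 $ i $ j\<bar>" using ij by simp
      have s: "s = (if gram (M u) $ i $ j - mat 1 $ i $ j > 0 then 1 else - 1)" by (simp add: s_def)
      show ?thesis
      proof (cases "gram (M u) $ i $ j - mat 1 $ i $ j > 0")
        case True
        then have "0 < snd (G v) $ i $ j" using 1 2 diff[OF v] by linarith
        then show ?thesis using True s by simp
      next
        case False
        then have "snd (G v) $ i $ j < 0" using 1 2 diff[OF v] by linarith
        then show ?thesis using False s by simp
      qed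
    qed
    then show False using not_balanced_if_positive[OF lin S(1), of s G i j] S(2) by blast
  qed
qed

text \<open>
A signed permutation that nearly fixes \<open>U\<close> would make two nearly orthogonal rows, or a row and
its negative, nearly equal.
\<close>

lemma near_orthogonal_free:
  assumes U: "near_orthogonal U" and g: "g \<in> signed_perms" and moved: "norm (permute_rows g U - U) \<le> 1 / 100"
  shows "g = sp_one"
proof -
  have dg: "3 / 4 \<le> U $ i \<bullet> U $ i" "U $ i \<bullet> U $ i \<le> 5 / 4" for i
  proof -
    have "\<bar>U $ i \<bullet> U $ i - 1\<bar> \<le> 1 / 4"
      using U[unfolded near_orthogonal_def, rule_format, of i i] by (simp add: gram_def mat_def)
    then show "3 / 4 \<le> U $ i \<bullet> U $ i" "U $ i \<bullet> U $ i \<le> 5 / 4" by linarith+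
  qed
  have off: "\<bar>U $ i \<bullet> U $ j\<bar> \<le> 1 / 4" if "i \<noteq> j" for i j
    using U[unfolded near_orthogonal_def, rule_format, of i j] that by (simp add: gram_def mat_def)
  have nr: "norm (U $ i) \<le> 2" for i
  proof -
    have "(norm (U $ i))\<^sup>2 \<le> 2\<^sup>2" using dg(2)[of i] by (simp add: power2_norm_eq_inner)
    then show ?thesis by (rule power2_le_imp_le) simp
  qed
  have key: "\<bar>of_int (snd g i) * (U $ fst g i \<bullet> U $ i) - U $ i \<bullet> U $ i\<bar> \<le> 1 / 50" for i
  proof -
    have "permute_rows g U $ i = of_int (snd g i) *\<^sub>R (U $ fst g i)"
      by (simp add: permute_rows_def vec_eq_iff)
    then have "of_int (snd g i) * (U $ fst g i \<bullet> U $ i) - U $ i \<bullet> U $ i = (permute_rows g U - U) $ i \<bullet> U $ i"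
      by (simp add: inner_diff_left)
    also have "\<bar>\<dots>\<bar> \<le> norm ((permute_rows g U - U) $ i) * norm (U $ i)" by (rule Cauchy_Schwarz_ineq2)
    also have "\<dots> \<le> (1 / 100) * 2"
      using moved Finite_Cartesian_Product.norm_nth_le[of "permute_rows g U - U" i]
      by (intro mult_mono nr) auto
    finally show ?thesis by simp
  qed
  have "fst g i = i" for i
  proof (rule ccontr)
    assume "fst g i \<noteq> i"
    then have "\<bar>of_int (snd g i) * (U $ fst g i \<bullet> U $ i)\<bar> \<le> 1 / 4"
      using off[of "fst g i" i] sp_sign[OF g, of i] by (auto simp: abs_mult)
    then show False using key[of i] dg(1)[of i] by linarith
  qed
  moreover have "snd g i = 1" for i
    using key[of i] dg(1)[of i] sp_sign[OF g, of i] calculation by auto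
  ultimately show ?thesis by (simp add: sp_one_def prod_eq_iff fun_eq_iff)
qed

lemma near_orthogonal_box: 
  assumes "near_orthogonal U" shows "U \<in> box_matrices"
  unfolding box_matrices_def
proof (intro CollectI allI)
  fix i j
  have "\<bar>U $ i \<bullet> U $ i - 1\<bar> \<le> 1 / 4"
    using assms[unfolded near_orthogonal_def, rule_format, of i i] by (simp add: gram_def mat_def)
  then have "U $ i \<bullet> U $ i \<le> 4" by linarith
  then have "(norm (U $ i))\<^sup>2 \<le> 2\<^sup>2" by (simp add: power2_norm_eq_inner)
  then have "norm (U $ i) \<le> 2" by (rule power2_le_imp_le) simp
  then show "\<bar>U $ i $ j\<bar> \<le> 2" using component_le_norm_cart[of "U $ i" j] by linarith
qed

lemma near_orthogonal_permute:
  assumes "near_orthogonal U" "g \<in> signed_perms" shows "near_orthogonal (permute_rows g U)"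
proof -
  have "gram (permute_rows g U) - mat 1 = conjugate g (gram U) - conjugate g (mat 1)"
    by (simp add: gram_permute conjugate_mat1 assms)
  also have "\<dots> = conjugate g (gram U - mat 1)"
    by (simp add: conjugate_def vec_eq_iff right_diff_distrib)
  finally have *: "gram (permute_rows g U) - mat 1 = conjugate g (gram U - mat 1)" .
  have "\<bar>conjugate g S $ i $ j\<bar> = \<bar>S $ fst g i $ fst g j\<bar>" for S i j
    using sp_sign[OF assms(2), of i] sp_sign[OF assms(2), of j] by (auto simp: conjugate_def)
  then show ?thesis using assms(1) unfolding near_orthogonal_def * by (simp del: vector_minus_component)
qed

text \<open>
The point of the grid of mesh \<open>\<delta>\<close> that represents a cell; faces are represented by their midpoints.
\<close>

definition cell_matrix :: "real \<Rightarrow> (('n \<times> 'n) option \<Rightarrow> int) \<Rightarrow> real ^ 'n ^ 'n" where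
  "cell_matrix \<delta> v = (\<chi> i j. \<delta> * of_int (v (Some (i, j))))"

lemma cell_matrix_permute: "cell_matrix \<delta> (permute_cell g v) = permute_rows g (cell_matrix \<delta> v)"
  by (simp add: cell_matrix_def permute_cell_def permute_rows_def vec_eq_iff)

lemma norm_le_entries:
  assumes "\<And>i j. \<bar>(X :: real ^ 'n ^ 'n) $ i $ j\<bar> \<le> \<delta>"
  shows "norm X \<le> \<delta> * (real CARD('n))\<^sup>2"
proof -
  have "norm X \<le> (\<Sum>i\<in>(UNIV :: 'n set). \<Sum>j\<in>(UNIV :: 'n set). \<delta>)"
    by (rule order_trans[OF norm_matrix_le]) (intro sum_mono assms)
  then show ?thesis by (simp add: power2_eq_square mult_ac)
qed

lemma cell_action_signed_perms:
  assumes "inj a"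
  shows "cell_action None signed_perms sp_one sp_mul sp_inv permute_cell conjugate2
    (range (linear_part (a :: 'n::finite \<Rightarrow> real)))"
proof (rule cell_action.intro)
  show "permute_cell sp_one v = v" for v :: "('n \<times> 'n) option \<Rightarrow> int"
    by (auto simp: permute_cell_def sp_one_def fun_eq_iff split: option.splits)
  show "permute_cell (sp_mul g h) v = permute_cell g (permute_cell h v)" for g h and v :: "('n \<times> 'n) option \<Rightarrow> int"
    by (auto simp: permute_cell_def sp_mul_def fun_eq_iff split: option.splits)
  show "permute_cell (sp_inv g) (permute_cell g v) = v" if "g \<in> signed_perms"
    for g and v :: "('n \<times> 'n) option \<Rightarrow> int"
    using that by (auto simp: permute_cell_def sp_inv_def fun_eq_iff sp_inv_apply sp_sign_square_mult split: option.splits)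
  show "permute_cell g v None = v None" for g and v :: "('n \<times> 'n) option \<Rightarrow> int"
    by (simp add: permute_cell_def)
  show "conjugate2 g y \<in> range (linear_part a)" if "y \<in> range (linear_part a)" for g y
    using that unfolding range_linear_part[OF assms]
    by (auto simp: conjugate2_def conjugate_def mult.commute)
  show "linear (conjugate2 g)" for g :: "'n signed_perm"
    by (rule linear_conjugate2)
  show "subspace (range (linear_part a))"
    by (intro linear_subspace_image linear_linear_part subspace_UNIV)
qed (auto simp: finite_signed_perms sp_one_mem sp_mul_mem sp_inv_mem sp_mul_inv_one permute_cell_le
    conjugate2_one conjugate2_mul norm_conjugate2)

lemma finite_bounded_cells: "finite {v :: 'm::finite \<Rightarrow> int. \<forall>x. \<bar>v x\<bar> \<le> b}"
proof (rule finite_subset)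
  show "{v :: 'm \<Rightarrow> int. \<forall>x. \<bar>v x\<bar> \<le> b} \<subseteq> PiE UNIV (\<lambda>_. {- b..b})" by (auto simp: abs_le_iff) (metis minus_le_iff)
qed (intro finite_PiE; simp)

text \<open>
Suppose that there is no zero. The top layer of a fine grid carries \<open>constraint_map f\<close>, which is bounded
away from 0 near the orthogonal group, so it has no balanced facets. The bottom layer carries
\<open>start_map\<close> with \<open>y\<close> the barycentre of a grid simplex at the identity matrix. A balanced facet there must lie
close to a signed permutation matrix, because elsewhere the map is large compared with its variation
over a simplex; there the map is linear, so the facet contains an image of \<open>y\<close> and is an image of the staircase
simplex. This contradicts \<open>parity_obstruction\<close>.
\<close>

theorem equivariant_common_zero:
  fixes f :: "real ^ 'n ^ 'n \<Rightarrow> real ^ 'n ^ 'n"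
  assumes cont: "continuous_on UNIV f" and sym: "\<And>U i j. f U $ i $ j = f U $ j $ i"
    and equiv: "sp_equivariant f"
  shows "\<exists>U. orthogonal_matrix U \<and> (\<forall>i j. i \<noteq> j \<longrightarrow> f U $ i $ j = 0)"
proof (rule ccontr)
  assume no_zero: "\<not> ?thesis"
  obtain a :: "'n \<Rightarrow> real" where a: "inj a"
  proof -
    obtain h :: "'n \<Rightarrow> nat" where "inj h"
      using finite_imp_inj_to_nat_seg[of "UNIV :: 'n set"] by auto
    then show ?thesis using that[of "\<lambda>i. real (h i)"] by (simp add: inj_def)
  qed
  define W where "W = range (linear_part a)"
  let ?\<Phi> = "constraint_map f" and ?\<Psi> = "constraint_map (weighted_form a)"
  define d where "d = real CARD('n)"
  have d1: "1 \<le> d" unfolding d_def by (simp add: Suc_leI)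
  have dd: "d \<le> d\<^sup>2" "0 < d\<^sup>2" using d1 by (auto simp: power2_eq_square)
  obtain c where c: "0 < c" "\<And>U. U \<in> box_matrices \<Longrightarrow>
      \<exists>g\<in>signed_perms. c * norm (U - permute_rows g (mat 1)) \<le> norm (?\<Psi> U)"
    using weighted_form_linear_lower_bound[OF a] by blast
  obtain C where C: "0 < C"
    "\<And>X :: real ^ 'n ^ 'n. norm (off_diagonal (weighted_form a X), gram X) \<le> C * (norm X)\<^sup>2"
    using quadratic_part_bound by blast
  obtain L where L: "0 < L" "\<And>X. norm (linear_part a X) \<le> L * norm X"
    using linear_bounded_pos[OF linear_linear_part, of a] by blast
  obtain \<eta> where \<eta>: "0 < \<eta>" "\<And>U. U \<in> box_matrices \<Longrightarrow> \<eta> \<le> norm (?\<Phi> U)"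
  proof -
    have "mat 1 \<in> (box_matrices :: (real ^ 'n ^ 'n) set)" by (auto simp: box_matrices_def mat_def)
    then have ne: "(box_matrices :: (real ^ 'n ^ 'n) set) \<noteq> {}" by blast
    have "continuous_on box_matrices (\<lambda>U. norm (?\<Phi> U))"
      by (intro continuous_intros continuous_constraint_map continuous_on_subset[OF cont]) simp
    then obtain V where "\<And>U. U \<in> box_matrices \<Longrightarrow> norm (?\<Phi> V) \<le> norm (?\<Phi> U)"
      using continuous_attains_inf[OF compact_box_matrices ne] by metis
    moreover have "0 < norm (?\<Phi> V)" using constraint_map_zero[of f V] no_zero by auto
    ultimately show ?thesis using that by blast
  qed
  \<comment> \<open>the radius of linearisation: its quadratic error is small compared with \<open>c r\<close>, the lower bound of the
    model map outside, and with the tolerance \<open>1/32\<close> in the Gram matrix\<close>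
  define r where "r = min (1 / 4) (min (c / (4 * C)) (1 / (8 * C)))"
  have r: "0 < r" "r \<le> 1 / 4" "r \<le> c / (4 * C)" "r \<le> 1 / (8 * C)"
    using c(1) C(1) by (auto simp: r_def)
  have Cr: "C * r\<^sup>2 \<le> c * r / 4" "C * r\<^sup>2 \<le> 1 / 32"
  proof -
    have 1: "C * r \<le> c / 4" "C * r \<le> 1 / 8" using r(3,4) C(1) by (simp_all add: field_simps)
    have "C * r * r \<le> c / 4 * r" by (rule mult_right_mono[OF 1(1)]) (use r in simp)
    then show "C * r\<^sup>2 \<le> c * r / 4" by (simp add: power2_eq_square mult.assoc)
    have "C * r * r \<le> 1 / 8 * (1 / 4)" by (rule mult_mono[OF 1(2) r(2)]) (use r in auto)
    then show "C * r\<^sup>2 \<le> 1 / 32" by (simp add: power2_eq_square mult.assoc)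
  qed
  have "uniformly_continuous_on box_matrices ?\<Phi>"
    by (intro compact_uniformly_continuous compact_box_matrices continuous_constraint_map
        continuous_on_subset[OF cont]) simp
  then obtain \<rho>1 where \<rho>1: "0 < \<rho>1" "\<And>U V. U \<in> box_matrices \<Longrightarrow> V \<in> box_matrices \<Longrightarrow>
      norm (V - U) < \<rho>1 \<Longrightarrow> norm (?\<Phi> V - ?\<Phi> U) < \<eta>"
    unfolding uniformly_continuous_on_def dist_norm using \<eta>(1) by metis
  have "uniformly_continuous_on box_matrices ?\<Psi>"
    by (intro compact_uniformly_continuous compact_box_matrices continuous_constraint_map
        continuous_weighted_form)
  moreover have "0 < c * r / 4" using c(1) r(1) by simp
  ultimately obtain \<rho>2 where \<rho>2: "0 < \<rho>2" "\<And>U V. U \<in> box_matrices \<Longrightarrow> V \<in> box_matrices \<Longrightarrow>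
      norm (V - U) < \<rho>2 \<Longrightarrow> norm (?\<Psi> V - ?\<Psi> U) < c * r / 4"
    unfolding uniformly_continuous_on_def dist_norm by metis
  \<comment> \<open>an upper bound for the diameter \<open>\<mu>\<close> of the simplices\<close>
  define \<theta> where "\<theta> = Min {\<rho>1, \<rho>2, r, 1 / (32 * L), c * r / (4 * L), 1 / 100}"
  have \<theta>0: "0 < \<theta>" using \<rho>1(1) \<rho>2(1) r(1) c(1) L(1) by (simp add: \<theta>_def)
  have \<theta>: "0 < \<theta>" "\<theta> \<le> \<rho>1" "\<theta> \<le> \<rho>2" "\<theta> \<le> r" "\<theta> \<le> 1 / (32 * L)" "\<theta> \<le> c * r / (4 * L)" "\<theta> \<le> 1 / 100"
    by (rule \<theta>0) (unfold \<theta>_def, (rule Min_le; simp)+)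
  obtain N :: nat where N: "d\<^sup>2 / \<theta> < real N" using reals_Archimedean2 by blast
  have N0: "0 < real N" using N dd(2) \<theta>(1) by (meson divide_pos_pos less_trans)
  \<comment> \<open>with mesh \<open>1 / (2 N)\<close> the identity matrix is a vertex of the grid, with even coordinates\<close>
  define \<delta> where "\<delta> = 1 / (2 * real N)"
  have \<delta>: "0 < \<delta>" "\<delta> * (2 * real N) = 1" using N0 by (simp_all add: \<delta>_def)
  define \<mu> where "\<mu> = \<delta> * d\<^sup>2"
  have "d\<^sup>2 < \<theta> * real N" using N \<theta>(1) by (simp add: divide_less_eq mult.commute)
  also have "\<theta> * real N \<le> \<theta> * (2 * real N)" using \<theta>0 by (intro mult_left_mono) auto
  finally have "d\<^sup>2 < \<theta> * (2 * real N)" .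
  then have \<mu>: "0 \<le> \<mu>" "\<mu> < \<theta>"
    using \<delta>(1) dd(2) N0 by (simp_all add: \<mu>_def \<delta>_def divide_less_eq)
  have L\<mu>: "L * \<mu> \<le> 1 / 32" "L * \<mu> \<le> c * r / 4"
  proof -
    have "L * \<mu> \<le> L * \<theta>" using \<mu> L(1) by simp
    moreover have "L * \<theta> \<le> L * (1 / (32 * L))" "L * \<theta> \<le> L * (c * r / (4 * L))"
      by (rule mult_left_mono[OF \<theta>(5) less_imp_le[OF L(1)]], rule mult_left_mono[OF \<theta>(6) less_imp_le[OF L(1)]])
    moreover have "L * (1 / (32 * L)) = 1 / 32" "L * (c * r / (4 * L)) = c * r / 4"
      using L(1) by simp_all
    ultimately show "L * \<mu> \<le> 1 / 32" "L * \<mu> \<le> c * r / 4" by linarith+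
  qed
  let ?M = "cell_matrix \<delta> :: (('n \<times> 'n) option \<Rightarrow> int) \<Rightarrow> real ^ 'n ^ 'n"
  have card_m: "CARD(('n \<times> 'n) option) = CARD('n) * CARD('n) + 1" by simp
  obtain e where e: "bij_betw e (- {None :: ('n \<times> 'n) option}) {1..<CARD(('n \<times> 'n) option)}"
    using finite_same_card_bij[of "- {None :: ('n \<times> 'n) option}" "{1..<CARD(('n \<times> 'n) option)}"]
    by (auto simp: card_m Compl_eq_Diff_UNIV card_Diff_subset)
  define b :: "('n \<times> 'n) option \<Rightarrow> int" where
    "b x = (case x of None \<Rightarrow> 0 | Some (i, j) \<Rightarrow> if i = j then 2 * int N else 0)" for x
  have b: "\<And>x. even (b x)" "b None = 0" by (auto simp: b_def split: option.splits)
  interpret stairs: staircase_frame None e b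
    by (rule staircase_frame.intro) (rule e, rule b(1), rule b(2))
  define m where "m = CARD(('n \<times> 'n) option)"
  \<comment> \<open>the barycentre of the staircase simplex above the identity matrix\<close>
  define y :: "real ^ 'n ^ 'n" where "y = (\<chi> i j. \<delta> * (of_int (b (Some (i, j))) + real (e (Some (i, j))) / m))"
  define \<sigma> where "\<sigma> = staircase None e b"
  have bmat: "\<delta> * of_int (b (Some (i, j))) = (mat 1 :: real ^ 'n ^ 'n) $ i $ j" for i j
    using \<delta>(2) by (simp add: b_def mat_def)
  have y1: "norm (y - mat 1) \<le> \<mu>"
    unfolding \<mu>_def d_def
  proof (rule norm_le_entries)
    fix i j
    have "(y - mat 1) $ i $ j = \<delta> * (real (e (Some (i, j))) / m)"
      using bmat[of i j] by (simp add: y_def distrib_left)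
    moreover have "e (Some (i, j)) < m" using stairs.e_range[of "Some (i, j)"] by (simp add: m_def)
    then have "real (e (Some (i, j))) / m \<le> 1" by (simp add: divide_le_eq_1)
    then have "\<delta> * (real (e (Some (i, j))) / m) \<le> \<delta> * 1" using \<delta>(1) by (intro mult_left_mono) auto
    ultimately show "\<bar>(y - mat 1) $ i $ j\<bar> \<le> \<delta>"
      using \<delta>(1) by simp
  qed
  \<comment> \<open>the homotopy consists of its two ends: the cells at time 0 and those at time 1\<close>
  define g0 where "g0 v = (if v None = 1 then ?\<Phi> (?M v) else start_map a r y (?M v))" for v
  define R where "R = {v \<in> slab None. near_orthogonal (?M v)}"
  have r2: "r \<le> 1 / 2" using r(2) by simp
  have start_close: "norm (start_map a r y U - ?\<Psi> U) \<le> C * r\<^sup>2 + L * \<mu>" for U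
  proof -
    have "norm (start_map a r y U - ?\<Psi> U) \<le> C * r\<^sup>2 + L * norm (y - mat 1)"
      using C(1) r(1) r2 L(1) by (intro start_map_close C(2) L(2)) auto
    also have "L * norm (y - mat 1) \<le> L * \<mu>" using L(1) by (intro mult_left_mono y1) auto
    finally show ?thesis by simp
  qed
  have mesh: "norm (?M v - ?M w) \<le> \<mu>" if "cell_chain None S" "v \<in> S" "w \<in> S" for S v w
    unfolding \<mu>_def d_def
  proof (rule norm_le_entries)
    fix i j
    have "\<bar>v (Some (i, j)) - w (Some (i, j))\<bar> \<le> 1" using that by (rule cell_chain_near)
    then have "\<bar>real_of_int (v (Some (i, j))) - real_of_int (w (Some (i, j)))\<bar> \<le> 1" by linarith
    then have "\<delta> * \<bar>real_of_int (v (Some (i, j))) - real_of_int (w (Some (i, j)))\<bar> \<le> \<delta> * 1"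
      using \<delta>(1) by (intro mult_left_mono) auto
    moreover have "(?M v - ?M w) $ i $ j = \<delta> * (real_of_int (v (Some (i, j))) - real_of_int (w (Some (i, j))))"
      by (simp add: cell_matrix_def right_diff_distrib)
    ultimately show "\<bar>(?M v - ?M w) $ i $ j\<bar> \<le> \<delta>" using \<delta>(1) by (simp add: abs_mult)
  qed
  have gram_close: "norm (snd (g0 v) - (gram (?M v) - mat 1)) \<le> 1 / 16" for v
  proof (cases "v None = 1")
    case True then show ?thesis by (simp add: g0_def constraint_map_def)
  next
    case False
    have "norm (snd (g0 v) - (gram (?M v) - mat 1)) = norm (snd (g0 v - ?\<Psi> (?M v)))"
      by (simp add: constraint_map_def)
    also have "\<dots> \<le> norm (g0 v - ?\<Psi> (?M v))" by (metis norm_snd_le prod.collapse)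
    also have "\<dots> \<le> C * r\<^sup>2 + L * \<mu>" using False start_close by (simp add: g0_def)
    also have "\<dots> \<le> 1 / 32 + 1 / 32" using Cr(2) L\<mu>(1) by (rule add_mono)
    finally show ?thesis by simp
  qed
  have conf: "S \<subseteq> R" if g: "\<And>v. v \<in> slab None \<Longrightarrow> norm (g v - g0 v) < 1 / 32"
    and S: "cell_chain None S" "balanced g S" for g S
  proof
    fix u assume u: "u \<in> S"
    have sl: "S \<subseteq> slab None" using S(1) by (simp add: cell_chain_def)
    have "near_orthogonal (?M u)"
    proof (rule balanced_imp_near_orthogonal[OF cell_chain_finite[OF S(1)] S(2) u])
      fix v assume v: "v \<in> S"
      show "norm (?M v - ?M u) \<le> 1 / 100" using mesh[OF S(1) v u] \<mu>(2) \<theta>(7) by simp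
      have "norm (snd (g v) - snd (g0 v)) \<le> norm (g v - g0 v)"
        by (metis norm_snd_le prod.collapse snd_diff)
      moreover have "norm (g v - g0 v) < 1 / 32" using sl v by (intro g) blast
      moreover have "snd (g v) - (gram (?M v) - mat 1)
          = (snd (g v) - snd (g0 v)) + (snd (g0 v) - (gram (?M v) - mat 1))" by simp
      then have "norm (snd (g v) - (gram (?M v) - mat 1))
          \<le> norm (snd (g v) - snd (g0 v)) + norm (snd (g0 v) - (gram (?M v) - mat 1))"
        by (metis norm_triangle_ineq)
      ultimately show "norm (snd (g v) - (gram (?M v) - mat 1)) \<le> 1 / 8"
        using gram_close[of v] by linarith
    qed
    then show "u \<in> R" using u sl by (auto simp: R_def)
  qed
  have confg0: "S \<subseteq> R" if "cell_chain None S" "balanced g0 S" for S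
    using conf[of g0 S] that by simp
  have Rbox: "?M v \<in> box_matrices" if "v \<in> R" for v
    using that near_orthogonal_box by (auto simp: R_def)
  interpret cell_action None signed_perms sp_one sp_mul sp_inv permute_cell conjugate2 W
    unfolding W_def by (rule cell_action_signed_perms[OF a])
  have \<sigma>_close: "norm (?M v - mat 1) < r" if "v \<in> \<sigma>" for v
  proof -
    have "norm (?M v - mat 1) \<le> \<mu>" unfolding \<mu>_def d_def
    proof (rule norm_le_entries)
      fix i j
      have "\<bar>real_of_int (v (Some (i, j))) - real_of_int (b (Some (i, j)))\<bar> \<le> 1"
        using stairs.staircase_near[of v "Some (i, j)"] that by (auto simp: \<sigma>_def)
      then have "\<delta> * \<bar>real_of_int (v (Some (i, j))) - real_of_int (b (Some (i, j)))\<bar> \<le> \<delta> * 1"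
        using \<delta>(1) by (intro mult_left_mono) auto
      moreover have "(?M v - mat 1) $ i $ j = \<delta> * (real_of_int (v (Some (i, j))) - real_of_int (b (Some (i, j))))"
        using bmat[of i j] by (simp add: cell_matrix_def right_diff_distrib)
      ultimately show "\<bar>(?M v - mat 1) $ i $ j\<bar> \<le> \<delta>" using \<delta>(1) by (simp add: abs_mult)
    qed
    then show ?thesis using \<mu>(2) \<theta>(4) by simp
  qed
  have \<sigma>: "cell_chain None \<sigma>" "card \<sigma> = m" "\<And>v. v \<in> \<sigma> \<Longrightarrow> v None = 0"
    unfolding \<sigma>_def m_def using stairs.staircase_chain stairs.card_staircase stairs.staircase_level by auto
  have g0\<sigma>: "g0 v = linear_part a (?M v - y)" if "v \<in> \<sigma>" for v
    using start_map_near[OF sp_one_mem \<sigma>_close[OF that] r2] \<sigma>(3)[OF that]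
    by (simp add: g0_def permute_rows_one conjugate2_one)
  have "(\<Sum>v\<in>\<sigma>. ?M v - y) = 0"
  proof -
    have "(\<Sum>v\<in>\<sigma>. ?M v - y) $ i $ j = 0" for i j
    proof -
      have "(\<Sum>v\<in>\<sigma>. ?M v - y) $ i $ j
        = (\<Sum>v\<in>\<sigma>. \<delta> * (real_of_int (v (Some (i, j))) - real_of_int (b (Some (i, j))) - real (e (Some (i, j))) / m))"
        by (simp add: cell_matrix_def y_def algebra_simps)
      also have "\<dots> = 0"
        using stairs.staircase_barycentre[of "Some (i, j)"]
        by (simp add: \<sigma>_def m_def flip: sum_distrib_left)
      finally show ?thesis .
    qed
    then show ?thesis by (simp add: vec_eq_iff)
  qed
  then have sum0: "(\<Sum>v\<in>\<sigma>. g0 v) = 0"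
    using linear_sum[OF linear_linear_part, of a "\<lambda>v. ?M v - y" \<sigma>] linear_0[OF linear_linear_part, of a]
    by (simp add: g0\<sigma> cong: sum.cong)
  have span: "W \<subseteq> span (g0 ` \<sigma>)"
  proof -
    have ax: "linear_part a x \<in> span (g0 ` \<sigma>)" if xB: "x \<in> Basis" for x :: "real ^ 'n ^ 'n"
    proof -
      obtain i j where x: "x = axis i (axis j 1)" using xB unfolding Basis_vec_def Basis_real_def by blast
      \<comment> \<open>two consecutive stairs differ in exactly one matrix entry\<close>
      obtain v w where vw: "v \<in> \<sigma>" "w \<in> \<sigma>" "\<And>k. k \<noteq> None \<Longrightarrow> v k - w k = (if k = Some (i, j) then 1 else 0)"
        using stairs.staircase_step[of "Some (i, j)"] unfolding \<sigma>_def by blast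
      have "real_of_int (v (Some (k, l))) - real_of_int (w (Some (k, l))) = (if k = i \<and> l = j then 1 else 0)" for k l
        using vw(3)[of "Some (k, l)"] by (simp flip: of_int_diff)
      then have "?M v - ?M w = \<delta> *\<^sub>R x"
        by (simp add: x cell_matrix_def axis_def vec_eq_iff flip: right_diff_distrib)
      then have "linear_part a x = (1 / \<delta>) *\<^sub>R linear_part a ((?M v - y) - (?M w - y))"
        using \<delta>(1) by (simp add: linear_cmul[OF linear_linear_part])
      also have "\<dots> = (1 / \<delta>) *\<^sub>R (g0 v - g0 w)"
        by (simp only: linear_diff[OF linear_linear_part] g0\<sigma> vw(1,2))
      also have "\<dots> \<in> span (g0 ` \<sigma>)" using vw(1,2) by (intro span_mul span_diff span_base) auto
      finally show ?thesis .
    qed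
    have "linear_part a X \<in> span (g0 ` \<sigma>)" for X
    proof -
      have "linear_part a X = linear_part a (\<Sum>x\<in>Basis. (X \<bullet> x) *\<^sub>R x)" by (simp add: euclidean_representation)
      also have "\<dots> = (\<Sum>x\<in>Basis. (X \<bullet> x) *\<^sub>R linear_part a x)"
        by (simp add: linear_sum[OF linear_linear_part] linear_cmul[OF linear_linear_part])
      also have "\<dots> \<in> span (g0 ` \<sigma>)" by (intro span_sum span_mul ax)
      finally show ?thesis .
    qed
    then show ?thesis by (auto simp: W_def)
  qed
  have fin\<sigma>: "finite \<sigma>" "\<sigma> \<noteq> {}" using cell_chain_finite[OF \<sigma>(1)] \<sigma>(2) by (auto simp: m_def)
  obtain \<epsilon>1 where stable: "0 < \<epsilon>1"
    "\<And>h. (\<And>v. v \<in> \<sigma> \<Longrightarrow> h v \<in> W \<and> norm (h v - g0 v) < \<epsilon>1) \<Longrightarrow> balanced h \<sigma>"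
    using balanced_stable[OF fin\<sigma> subspace_W span sum0] by blast
  have top: "\<not> balanced g0 F"
    if F: "cell_chain None F" "card F = m" "\<forall>v\<in>F. v None = 1" for F
  proof
    assume bal: "balanced g0 F"
    have FR: "F \<subseteq> R" by (rule confg0[OF F(1) bal])
    have "F \<noteq> {}" using F(2) by (auto simp: m_def)
    then obtain u where u: "u \<in> F" by blast
    have "norm (g0 v - ?\<Phi> (?M u)) < norm (?\<Phi> (?M u))" if v: "v \<in> F" for v
    proof -
      have "norm (?\<Phi> (?M v) - ?\<Phi> (?M u)) < \<eta>"
        using mesh[OF F(1) v u] \<mu>(2) \<theta>(2) FR v u by (intro \<rho>1(2) Rbox) auto
      also have "\<eta> \<le> norm (?\<Phi> (?M u))" using FR u by (intro \<eta>(2) Rbox) auto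
      finally show ?thesis using F(3) v by (simp add: g0_def)
    qed
    then show False using not_balanced_if_close[OF cell_chain_finite[OF F(1)]] bal by blast
  qed
  have bot: "\<exists>g\<in>signed_perms. F = permute_cell g ` \<sigma>"
    if F: "cell_chain None F" "card F = m" "\<forall>v\<in>F. v None = 0" and bal: "balanced g0 F" for F
  proof -
    have FR: "F \<subseteq> R" by (rule confg0[OF F(1) bal])
    have finF: "finite F" by (rule cell_chain_finite[OF F(1)])
    have "F \<noteq> {}" using F(2) by (auto simp: m_def)
    then obtain u where u: "u \<in> F" by blast
    have near: "\<exists>g\<in>signed_perms. norm (?M u - permute_rows g (mat 1)) < r" if u: "u \<in> F" for u
    proof (rule ccontr)
      assume far: "\<not> ?thesis"
      obtain g where g: "g \<in> signed_perms" "c * norm (?M u - permute_rows g (mat 1)) \<le> norm (?\<Psi> (?M u))"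
        using c(2)[OF Rbox[OF subsetD[OF FR u]]] by blast
      have "c * r \<le> c * norm (?M u - permute_rows g (mat 1))" using far g(1) c(1) by (intro mult_left_mono) auto
      then have big: "c * r \<le> norm (?\<Psi> (?M u))" using g(2) by simp
      have "norm (g0 v - ?\<Psi> (?M u)) < norm (?\<Psi> (?M u))" if v: "v \<in> F" for v
      proof -
        have "norm (?\<Psi> (?M v) - ?\<Psi> (?M u)) < c * r / 4"
          using mesh[OF F(1) v u] \<mu>(2) \<theta>(3) FR v u by (intro \<rho>2(2) Rbox) auto
        moreover have "norm (g0 v - ?\<Psi> (?M v)) \<le> c * r / 4 + c * r / 4"
          using start_close[of "?M v"] Cr(1) L\<mu>(2) bspec[OF F(3) v] by (simp add: g0_def)
        moreover have "norm (g0 v - ?\<Psi> (?M u)) \<le> norm (g0 v - ?\<Psi> (?M v)) + norm (?\<Psi> (?M v) - ?\<Psi> (?M u))"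
          using norm_triangle_ineq[of "g0 v - ?\<Psi> (?M v)" "?\<Psi> (?M v) - ?\<Psi> (?M u)"] by simp
        moreover have "0 < c * r" using c(1) r(1) by simp
        ultimately show ?thesis using big by linarith
      qed
      then show False using not_balanced_if_close[OF finF] bal by blast
    qed
    obtain h where h: "h \<in> signed_perms" "norm (?M u - permute_rows h (mat 1)) < r" using near[OF u] by blast
    \<comment> \<open>two vertices of the facet cannot be close to different signed permutation matrices\<close>
    have same: "norm (?M v - permute_rows h (mat 1)) < r" if v: "v \<in> F" for v
    proof -
      obtain k where k: "k \<in> signed_perms" "norm (?M v - permute_rows k (mat 1)) < r" using near[OF v] by blast
      have "permute_rows k (mat 1) - permute_rows h (mat 1)
        = (?M u - permute_rows h (mat 1)) + (?M v - ?M u) - (?M v - permute_rows k (mat 1))" by simp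
      also have "norm \<dots> \<le> norm (?M u - permute_rows h (mat 1)) + norm (?M v - ?M u) + norm (?M v - permute_rows k (mat 1))"
        by (meson norm_triangle_ineq norm_triangle_ineq4 add_right_mono order_trans)
      also have "\<dots> < 1" using h(2) k(2) mesh[OF F(1) v u] \<mu>(2) \<theta>(7) r(2) by simp
      finally have "k = h" using k(1) h(1) by (intro signed_perm_matrices_separated)
      then show ?thesis using k(2) by simp
    qed
    define \<pi> where "\<pi> = permute_cell (sp_inv h)"
    have h\<pi>: "permute_cell h (\<pi> v) = v" for v
    proof -
      have "\<pi> (permute_cell h (\<pi> v)) = \<pi> v" unfolding \<pi>_def by (rule \<alpha>_inver[OF h(1)])
      then show ?thesis unfolding \<pi>_def by (metis \<alpha>_inver[OF inver_I[OF h(1)]])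
    qed
    have g0F: "g0 v = conjugate2 h (linear_part a (?M (\<pi> v) - y))" if v: "v \<in> F" for v
    proof -
      have Mv: "?M v = permute_rows h (?M (\<pi> v))" by (simp add: h\<pi> flip: cell_matrix_permute)
      have "norm (?M (\<pi> v) - mat 1) = norm (?M v - permute_rows h (mat 1))"
        unfolding Mv permute_rows_diff[symmetric] norm_permute_rows[OF h(1)] ..
      then show ?thesis
        using start_map_near[OF h(1) _ r2, of "?M (\<pi> v)" a y] same[OF v] bspec[OF F(3) v] Mv by (simp add: g0_def)
    qed
    obtain t where t: "\<forall>v\<in>F. 0 \<le> t v" "\<exists>v\<in>F. 0 < t v" "(\<Sum>v\<in>F. t v *\<^sub>R g0 v) = 0"
      using bal unfolding balanced_def by blast
    \<comment> \<open>undoing the linear map turns balancedness into a convex combination representing \<open>y\<close>\<close>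
    define Z where "Z = (\<Sum>v\<in>F. t v *\<^sub>R (?M (\<pi> v) - y))"
    have "conjugate2 h (linear_part a Z) = (\<Sum>v\<in>F. t v *\<^sub>R g0 v)"
      unfolding Z_def linear_sum[OF linear_linear_part] linear_sum[OF linear_conjugate2]
        linear_cmul[OF linear_linear_part] linear_cmul[OF linear_conjugate2]
      by (intro sum.cong) (simp_all add: g0F)
    then have "norm (linear_part a Z) = 0" using t(3) norm_conjugate2[OF h(1), of "linear_part a Z"] by simp
    then have Z: "Z = 0" using inj_linear_part[OF a] linear_injective_0[OF linear_linear_part] by (metis norm_eq_zero)
    have inj\<pi>: "inj_on \<pi> F" by (rule inj_on_inverseI[of _ "permute_cell h"]) (rule h\<pi>)
    have "\<pi> ` F = staircase None e b"
    proof (rule stairs.barycentre_in_staircase_only[where c = "\<lambda>v. t (permute_cell h v)"])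
      show "cell_chain None (\<pi> ` F)" unfolding \<pi>_def by (rule \<alpha>_chain[OF inver_I[OF h(1)] F(1)])
      show "card (\<pi> ` F) = CARD(('n \<times> 'n) option)" using F(2) by (simp add: card_image[OF inj\<pi>] m_def)
      show "v None = 0" if "v \<in> \<pi> ` F" for v
        using that F(3) by (auto simp: \<pi>_def permute_cell_def)
      show "0 \<le> t (permute_cell h v)" if "v \<in> \<pi> ` F" for v using that t(1) by (auto simp: h\<pi>)
      show "\<exists>v\<in>\<pi> ` F. 0 < t (permute_cell h v)" using t(2) by (simp add: h\<pi>)
      fix x :: "('n \<times> 'n) option" assume "x \<noteq> None"
      then obtain i j where x: "x = Some (i, j)" by auto
      have "0 = Z $ i $ j" using Z by simp
      also have "\<dots> = (\<Sum>v\<in>F. \<delta> * (t v * (real_of_int (\<pi> v x) - real_of_int (b x) - real (e x) / m)))"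
        by (simp add: Z_def cell_matrix_def y_def x algebra_simps)
      also have "\<dots> = \<delta> * (\<Sum>v\<in>F. t v * (real_of_int (\<pi> v x) - real_of_int (b x) - real (e x) / m))"
        by (simp only: sum_distrib_left)
      finally have "(\<Sum>v\<in>F. t v * (real_of_int (\<pi> v x) - real_of_int (b x) - real (e x) / m)) = 0"
        using \<delta>(1) by simp
      then show "(\<Sum>v\<in>\<pi> ` F. t (permute_cell h v)
          * (real_of_int (v x) - real_of_int (b x) - real (e x) / CARD(('n \<times> 'n) option))) = 0"
        by (simp add: sum.reindex[OF inj\<pi>] h\<pi> m_def)
    qed
    then have "permute_cell h ` \<sigma> = permute_cell h ` \<pi> ` F" by (simp add: \<sigma>_def)
    also have "\<dots> = F" by (simp add: image_image h\<pi>)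
    finally show ?thesis using h(1) by blast
  qed
  show False
  proof (rule parity_obstruction[of R g0 "1 / 32" \<sigma> \<epsilon>1])
    show "CARD(('n \<times> 'n) option) = dim W + 1"
      unfolding card_m W_def dim_range_linear_part[OF a] ..
    show "finite R"
    proof (rule finite_subset)
      show "R \<subseteq> {v. \<forall>x. \<bar>v x\<bar> \<le> 4 * int N + 1}"
      proof (intro subsetI CollectI allI)
        fix v x assume v: "v \<in> R"
        show "\<bar>v x\<bar> \<le> 4 * int N + 1"
        proof (cases x)
          case None then show ?thesis using v by (auto simp: R_def slab_def)
        next
          case (Some z)
          obtain i j where z: "z = (i, j)" by (cases z)
          have "\<delta> * \<bar>real_of_int (v x)\<bar> \<le> 2"
            using Rbox[OF v] \<delta>(1) by (simp add: box_matrices_def cell_matrix_def Some z abs_mult)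
          then have "\<delta> * \<bar>real_of_int (v x)\<bar> * (2 * real N) \<le> 2 * (2 * real N)"
            using N0 by (intro mult_right_mono) auto
          moreover have "\<delta> * \<bar>real_of_int (v x)\<bar> * (2 * real N) = \<bar>real_of_int (v x)\<bar> * (\<delta> * (2 * real N))"
            by (simp only: mult_ac)
          ultimately have "\<bar>real_of_int (v x)\<bar> \<le> 4 * real N" unfolding \<delta>(2) by simp
          then show ?thesis by linarith
        qed
      qed
    qed (rule finite_bounded_cells)
    show "R \<subseteq> slab None" by (auto simp: R_def)
    show "permute_cell g v \<in> R" if "g \<in> signed_perms" "v \<in> R" for g v
      using that \<alpha>_slab[of g v] near_orthogonal_permute[of "?M v" g] by (simp add: R_def cell_matrix_permute)
    show "g0 v \<in> W" for v
      unfolding g0_def W_def using start_map_range[OF a r2] constraint_map_range[OF a, of f] sym by auto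
    show "g0 (permute_cell g v) = conjugate2 g (g0 v)" if "g \<in> signed_perms" for g v
      using that by (simp add: g0_def cell_matrix_permute \<alpha>_level start_map_equivariant[OF _ r2]
          constraint_map_equivariant[OF equiv])
    show "g = sp_one" if S: "cell_chain None S" "S \<subseteq> R" "v \<in> S" "w \<in> S" "g \<in> signed_perms" "permute_cell g v = w" for S v w g
    proof (rule near_orthogonal_free)
      show "near_orthogonal (?M v)" using S by (auto simp: R_def)
      show "norm (permute_rows g (?M v) - ?M v) \<le> 1 / 100"
        using mesh[OF S(1,4,3)] \<mu>(2) \<theta>(7) S(6) by (simp flip: cell_matrix_permute)
    qed (rule S(5))
    show "0 < (1 / 32 :: real)" by simp
    show "S \<subseteq> R" if "\<And>v. v \<in> slab None \<Longrightarrow> norm (g v - g0 v) < 1 / 32" "cell_chain None S" "balanced g S" for g S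
      using that by (rule conf)
    show "\<not> balanced g0 F" if "cell_chain None F" "card F = CARD(('n \<times> 'n) option)" "\<forall>v\<in>F. v None = 1" for F
      using top that unfolding m_def by blast
    show "\<exists>g\<in>signed_perms. F = permute_cell g ` \<sigma>"
      if "cell_chain None F" "card F = CARD(('n \<times> 'n) option)" "\<forall>v\<in>F. v None = 0" "balanced g0 F" for F
      using bot that unfolding m_def by blast
    show "cell_chain None \<sigma>" by (rule \<sigma>(1))
    show "card \<sigma> = CARD(('n \<times> 'n) option)" using \<sigma>(2) by (simp only: m_def)
    show "\<forall>v\<in>\<sigma>. v None = 0" using \<sigma>(3) by blast
    show "0 < \<epsilon>1" by (rule stable(1))
    show "balanced h \<sigma>" if "\<And>v. v \<in> \<sigma> \<Longrightarrow> h v \<in> W \<and> norm (h v - g0 v) < \<epsilon>1" for h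
      using that by (rule stable(2))
  qed
qed

section \<open>Soft medians\<close>

text \<open>
The sign function with a continuous transition around 0, of a width proportional to \<open>\<epsilon>\<close>.
\<close>

definition soft_sign :: "real \<Rightarrow> real \<Rightarrow> real" where
  "soft_sign \<epsilon> y = y / (\<epsilon> + \<bar>y\<bar>)"

lemma soft_sign_minus: "soft_sign \<epsilon> (- y) = - soft_sign \<epsilon> y"
  by (simp add: soft_sign_def)

lemma soft_sign_bound:
  assumes "0 < \<epsilon>" shows "\<bar>soft_sign \<epsilon> y\<bar> \<le> 1"
proof -
  have "0 < \<epsilon> + \<bar>y\<bar>" using assms by simp
  then show ?thesis using assms by (simp add: soft_sign_def abs_divide)
qed

lemma soft_sign_strict_mono:
  assumes "0 < \<epsilon>" "y < z" shows "soft_sign \<epsilon> y < soft_sign \<epsilon> z"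
proof -
  have p: "0 < \<epsilon> + \<bar>y\<bar>" "0 < \<epsilon> + \<bar>z\<bar>" using assms by auto
  have "y * \<bar>z\<bar> \<le> z * \<bar>y\<bar>"
    using assms(2) by (cases "0 \<le> y"; cases "0 \<le> z")
      (auto simp: mult.commute mult_nonneg_nonpos2 mult_nonneg_nonpos intro: order_trans[of _ 0] mult_nonpos_nonneg)
  moreover have "y * \<epsilon> < z * \<epsilon>" using assms by simp
  ultimately have "y * (\<epsilon> + \<bar>z\<bar>) < z * (\<epsilon> + \<bar>y\<bar>)" by (simp add: distrib_left)
  then show ?thesis unfolding soft_sign_def using p by (simp add: divide_less_eq less_divide_eq mult.commute)
qed

lemma continuous_on_soft_sign [continuous_intros]:
  assumes "0 < \<epsilon>" "continuous_on A f"
  shows "continuous_on A (\<lambda>x. soft_sign \<epsilon> (f x))"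
  unfolding soft_sign_def using assms
  by (intro continuous_intros) (auto simp: add_pos_nonneg intro: order.strict_implies_not_eq[symmetric])

lemma soft_sign_measurable [measurable]: "soft_sign \<epsilon> \<in> borel_measurable borel"
  unfolding soft_sign_def by measurable

lemma soft_sign_tendsto_1:
  assumes "y \<longlonglongrightarrow> l" "0 < l" "e \<longlonglongrightarrow> 0"
  shows "(\<lambda>k. soft_sign (e k) (y k)) \<longlonglongrightarrow> 1"
proof -
  have "(\<lambda>k. y k / (e k + \<bar>y k\<bar>)) \<longlonglongrightarrow> l / (0 + \<bar>l\<bar>)"
    using assms by (intro tendsto_intros) auto
  then show ?thesis using assms(2) by (simp add: soft_sign_def)
qed

text \<open>
The soft sign is strictly monotone on the whole line, so soft medians are unique even where medians are
not, and it is bounded, so that all expectations below are continuous by dominated convergence.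
\<close>

locale borel_distribution = prob_space P for P :: "(real ^ 'n) measure" +
  assumes sets_P: "sets P = sets borel"
begin

lemma measurable_P [measurable_cong]: "sets P = sets borel"
  by (rule sets_P)

lemma space_P: "space P = UNIV"
  using sets_eq_imp_space_eq[OF sets_P] by simp

lemma continuous_expectation:
  fixes \<phi> :: "'a::metric_space \<Rightarrow> real ^ 'n \<Rightarrow> real"
  assumes "\<And>x. continuous_on UNIV (\<lambda>a. \<phi> a x)" "\<And>a. \<phi> a \<in> borel_measurable P" "\<And>a x. \<bar>\<phi> a x\<bar> \<le> 1"
  shows "continuous_on UNIV (\<lambda>a. \<integral>x. \<phi> a x \<partial>P)"
proof (rule continuous_on_sequentiallyI)
  fix u and a :: 'a assume u: "u \<longlonglongrightarrow> a"
  show "(\<lambda>n. \<integral>x. \<phi> (u n) x \<partial>P) \<longlonglongrightarrow> (\<integral>x. \<phi> a x \<partial>P)"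
  proof (rule integral_dominated_convergence[where w = "\<lambda>_. 1"])
    show "AE x in P. (\<lambda>n. \<phi> (u n) x) \<longlonglongrightarrow> \<phi> a x"
    proof (rule AE_I2)
      fix x
      show "(\<lambda>n. \<phi> (u n) x) \<longlonglongrightarrow> \<phi> a x"
        using continuous_on_tendsto_compose[OF assms(1)[of x] u] by simp
    qed
  qed (use assms in auto)
qed

lemma integrable_soft [simp]:
  assumes "0 < \<epsilon>" shows "integrable P (\<lambda>x. soft_sign \<epsilon> (b \<bullet> x - m))"
  by (rule integrable_const_bound[of _ 1]) (use soft_sign_bound[OF assms] in auto)

text \<open>
The expected soft sign relative to the threshold \<open>m\<close>; it decreases strictly from \<open>1\<close> to \<open>-1\<close> in \<open>m\<close>.
\<close>

definition balance :: "real \<Rightarrow> real ^ 'n \<Rightarrow> real \<Rightarrow> real" where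
  "balance \<epsilon> b m = (\<integral>x. soft_sign \<epsilon> (b \<bullet> x - m) \<partial>P)"

lemma balance_continuous:
  assumes "0 < \<epsilon>"
  shows "continuous_on UNIV (\<lambda>(b, m). balance \<epsilon> b m)"
  unfolding balance_def case_prod_beta
  by (rule continuous_expectation) (use assms soft_sign_bound in \<open>auto intro!: continuous_intros\<close>)

lemma balance_strict_antimono:
  assumes "0 < \<epsilon>" "m < m'" shows "balance \<epsilon> b m' < balance \<epsilon> b m"
  unfolding balance_def
proof (rule integral_less_AE_space)
  show "AE x in P. soft_sign \<epsilon> (b \<bullet> x - m') < soft_sign \<epsilon> (b \<bullet> x - m)"
    using assms by (intro AE_I2 soft_sign_strict_mono) auto
qed (use assms in \<open>auto simp: emeasure_space_1\<close>)

lemma balance_minus: "balance \<epsilon> (- b) (- m) = - balance \<epsilon> b m"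
  unfolding balance_def
  using soft_sign_minus[of \<epsilon>, of "b \<bullet> _ - m"] by (simp add: inner_minus_left flip: integral_minus)

lemma bounded_mass:
  obtains R where "0 < R" "3 / 4 < measure P (cball 0 R)"
proof -
  have "(\<lambda>n. measure P (cball 0 (real n))) \<longlonglongrightarrow> measure P (\<Union>n. cball 0 (real n))"
    by (rule finite_Lim_measure_incseq) (auto simp: incseq_def sets_P)
  moreover have "(\<Union>n. cball 0 (real n)) = (UNIV :: (real ^ 'n) set)"
    by (auto simp: real_arch_simple)
  ultimately have "(\<lambda>n. measure P (cball 0 (real n))) \<longlonglongrightarrow> 1"
    using prob_space by (simp add: space_P)
  then have "eventually (\<lambda>n. 3 / 4 < measure P (cball 0 (real n))) sequentially"
    by (rule order_tendstoD(1)) simp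
  then obtain N where "\<And>n. n \<ge> N \<Longrightarrow> 3 / 4 < measure P (cball 0 (real n))"
    by (auto simp: eventually_sequentially)
  then have "3 / 4 < measure P (cball 0 (real (Suc N)))" by (meson le_Suc_eq order_refl)
  then show ?thesis by (intro that[of "real (Suc N)"]) auto
qed

text \<open>
Beyond the threshold all points of a ball carrying more than three quarters of the mass contribute at
most \<open>-1/2\<close>, which outweighs the contribution of the remaining points, at most \<open>1\<close> each.
\<close>

lemma balance_negative:
  assumes "0 < \<epsilon>" "3 / 4 < measure P (cball 0 R)" "norm b * R + \<epsilon> \<le> m"
  shows "balance \<epsilon> b m < 0"
proof -
  have meas: "cball 0 R \<in> sets P" by (simp add: sets_P)
  have "soft_sign \<epsilon> (b \<bullet> x - m) \<le> 1 - (3 / 2) * indicator (cball 0 R) x" for x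
  proof (cases "x \<in> cball 0 R")
    case True
    have "b \<bullet> x \<le> norm b * norm x" by (rule norm_cauchy_schwarz)
    also have "\<dots> \<le> norm b * R" using True by (intro mult_left_mono) auto
    finally have "b \<bullet> x - m \<le> - \<epsilon>" using assms(3) by simp
    then have "soft_sign \<epsilon> (b \<bullet> x - m) \<le> soft_sign \<epsilon> (- \<epsilon>)"
      using soft_sign_strict_mono[OF assms(1)] by (metis le_less)
    also have "\<dots> = - 1 / 2" using assms(1) by (simp add: soft_sign_def)
    finally show ?thesis using True by simp
  next
    case False
    then show ?thesis using soft_sign_bound[OF assms(1), of "b \<bullet> x - m"] by auto
  qed
  then have "balance \<epsilon> b m \<le> (\<integral>x. 1 - (3 / 2) * indicator (cball 0 R) x \<partial>P)"
    unfolding balance_def using meas assms(1)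
    by (intro integral_mono) (auto intro!: integrable_real_indicator simp: emeasure_eq_measure)
  also have "\<dots> = 1 - (3 / 2) * measure P (cball 0 R)"
    using meas by (subst Bochner_Integration.integral_diff)
      (auto intro!: integrable_real_indicator simp: emeasure_eq_measure prob_space)
  also have "\<dots> < 0" using assms(2) by simp
  finally show ?thesis .
qed

lemma soft_median_ex1:
  assumes "0 < \<epsilon>" shows "\<exists>!m. balance \<epsilon> b m = 0"
proof -
  obtain R where R: "0 < R" "3 / 4 < measure P (cball 0 R)" using bounded_mass by blast
  let ?M = "norm b * R + \<epsilon>"
  have "balance \<epsilon> b ?M < 0" using balance_negative[OF assms R(2)] by simp
  moreover have "balance \<epsilon> b (- ?M) > 0"
    using balance_negative[OF assms R(2), of "- b" ?M] balance_minus[of \<epsilon> b "- ?M"]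
    by (simp add: algebra_simps)
  moreover have "continuous_on {- ?M .. ?M} (balance \<epsilon> b)"
    using continuous_on_compose2[OF balance_continuous[OF assms], of "{- ?M .. ?M}" "\<lambda>m. (b, m)"]
    by (simp add: continuous_on_Pair)
  moreover have "- ?M \<le> ?M" using R(1) assms by simp
  ultimately obtain m where "balance \<epsilon> b m = 0"
    using IVT2'[of "balance \<epsilon> b" ?M 0 "- ?M"] by auto
  moreover have "m = m'" if "balance \<epsilon> b m = 0" "balance \<epsilon> b m' = 0" for m m'
    using that balance_strict_antimono[OF assms, of m m' b] balance_strict_antimono[OF assms, of m' m b]
    by (cases m m' rule: linorder_cases) auto
  ultimately show ?thesis by blast
qed

definition soft_median :: "real \<Rightarrow> real ^ 'n \<Rightarrow> real" where
  "soft_median \<epsilon> b = (THE m. balance \<epsilon> b m = 0)"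

lemma balance_soft_median: "0 < \<epsilon> \<Longrightarrow> balance \<epsilon> b (soft_median \<epsilon> b) = 0"
  unfolding soft_median_def by (rule theI'[OF soft_median_ex1])

lemma soft_median_eqI: "0 < \<epsilon> \<Longrightarrow> balance \<epsilon> b m = 0 \<Longrightarrow> soft_median \<epsilon> b = m"
  using soft_median_ex1 balance_soft_median by blast

lemma soft_median_minus: "0 < \<epsilon> \<Longrightarrow> soft_median \<epsilon> (- b) = - soft_median \<epsilon> b"
  by (rule soft_median_eqI) (simp_all add: balance_minus balance_soft_median)

text \<open>
For \<open>\<epsilon> \<le> 1\<close> and unit vectors \<open>b\<close> the bound is uniform, which keeps the solutions in a compact set as \<open>\<epsilon> \<rightarrow> 0\<close>.
\<close>

lemma soft_median_bound:
  assumes "0 < \<epsilon>" "3 / 4 < measure P (cball 0 R)"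
  shows "\<bar>soft_median \<epsilon> b\<bar> \<le> norm b * R + \<epsilon>"
proof (rule ccontr)
  assume *: "\<not> \<bar>soft_median \<epsilon> b\<bar> \<le> norm b * R + \<epsilon>"
  then consider "norm b * R + \<epsilon> \<le> soft_median \<epsilon> b" | "norm (- b) * R + \<epsilon> \<le> soft_median \<epsilon> (- b)"
    using soft_median_minus[OF assms(1)] by fastforce
  then show False
    using balance_negative[OF assms] balance_soft_median[OF assms(1)] by cases (metis less_irrefl)+
qed

lemma soft_median_continuous:
  assumes e: "0 < \<epsilon>" shows "continuous_on UNIV (soft_median \<epsilon>)"
proof (rule continuous_at_imp_continuous_on, rule ballI)
  fix b
  have cont: "continuous_on UNIV (\<lambda>b. balance \<epsilon> b m)" for m
    using continuous_on_compose2[OF balance_continuous[OF e], of UNIV "\<lambda>b. (b, m)"]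
    by (simp add: continuous_on_Pair)
  have lim: "((\<lambda>c. balance \<epsilon> c m) \<longlongrightarrow> balance \<epsilon> b m) (at b)" for m
    using cont[of m] by (simp add: continuous_on_def)
  show "isCont (soft_median \<epsilon>) b"
    unfolding isCont_def
  proof (rule tendstoI)
    fix \<eta> :: real assume \<eta>: "0 < \<eta>"
    let ?m = "soft_median \<epsilon> b"
    have "balance \<epsilon> b (?m + \<eta>) < 0" "0 < balance \<epsilon> b (?m - \<eta>)"
      using balance_strict_antimono[OF e, of ?m "?m + \<eta>" b] balance_strict_antimono[OF e, of "?m - \<eta>" ?m b]
        balance_soft_median[OF e, of b] \<eta> by auto
    then have "\<forall>\<^sub>F c in at b. balance \<epsilon> c (?m + \<eta>) < 0" "\<forall>\<^sub>F c in at b. 0 < balance \<epsilon> c (?m - \<eta>)"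
      using lim order_tendstoD by blast+
    then show "\<forall>\<^sub>F c in at b. dist (soft_median \<epsilon> c) ?m < \<eta>"
    proof eventually_elim
      case (elim c)
      have "soft_median \<epsilon> c < ?m + \<eta>"
        using elim(1) balance_soft_median[OF e, of c] balance_strict_antimono[OF e, of "?m + \<eta>" "soft_median \<epsilon> c" c]
        by (cases "soft_median \<epsilon> c" "?m + \<eta>" rule: linorder_cases) auto
      moreover have "?m - \<eta> < soft_median \<epsilon> c"
        using elim(2) balance_soft_median[OF e, of c] balance_strict_antimono[OF e, of "soft_median \<epsilon> c" "?m - \<eta>" c]
        by (cases "soft_median \<epsilon> c" "?m - \<eta>" rule: linorder_cases) auto
      ultimately show ?case by (simp add: dist_real_def abs_less_iff)
    qed
  qed
qed

definition soft_part :: "real \<Rightarrow> real ^ 'n \<Rightarrow> real ^ 'n \<Rightarrow> real" where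
  "soft_part \<epsilon> b x = soft_sign \<epsilon> (b \<bullet> x - soft_median \<epsilon> b)"

lemma soft_part_minus: "0 < \<epsilon> \<Longrightarrow> soft_part \<epsilon> (- b) x = - soft_part \<epsilon> b x"
  unfolding soft_part_def
  using soft_sign_minus[of \<epsilon> "b \<bullet> x - soft_median \<epsilon> b"] by (simp add: soft_median_minus)

lemma soft_part_bound: "0 < \<epsilon> \<Longrightarrow> \<bar>soft_part \<epsilon> b x\<bar> \<le> 1"
  unfolding soft_part_def by (rule soft_sign_bound)

lemma soft_part_measurable [measurable]: "soft_part \<epsilon> b \<in> borel_measurable P"
  unfolding soft_part_def by measurable

lemma expectation_soft_part: "0 < \<epsilon> \<Longrightarrow> (\<integral>x. soft_part \<epsilon> b x \<partial>P) = 0"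
  using balance_soft_median by (simp add: balance_def soft_part_def)

definition soft_correlation :: "real \<Rightarrow> real ^ 'n ^ 'n \<Rightarrow> real ^ 'n ^ 'n" where
  "soft_correlation \<epsilon> U = (\<chi> i j. \<integral>x. soft_part \<epsilon> (U $ i) x * soft_part \<epsilon> (U $ j) x \<partial>P)"

lemma soft_correlation_continuous:
  assumes "0 < \<epsilon>" shows "continuous_on UNIV (soft_correlation \<epsilon>)"
  unfolding soft_correlation_def
proof (intro continuous_on_vec_lambda continuous_expectation)
  fix i j :: 'n and x :: "real ^ 'n"
  have "continuous_on UNIV (\<lambda>U :: real ^ 'n ^ 'n. soft_median \<epsilon> (U $ i))" for i
    by (rule continuous_on_compose2[OF soft_median_continuous[OF assms]]) (auto intro!: continuous_intros)
  then show "continuous_on UNIV (\<lambda>U. soft_part \<epsilon> (U $ i) x * soft_part \<epsilon> (U $ j) x)"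
    unfolding soft_part_def using assms by (intro continuous_intros) auto
next
  fix U :: "real ^ 'n ^ 'n" and i j :: 'n and x :: "real ^ 'n"
  show "\<bar>soft_part \<epsilon> (U $ i) x * soft_part \<epsilon> (U $ j) x\<bar> \<le> 1"
    using soft_part_bound[OF assms] by (simp add: abs_mult mult_le_one)
qed measurable

end

section \<open>From soft medians to quarter medians\<close>

context borel_distribution
begin

lemma soft_correlation_equivariant:
  assumes e: "0 < \<epsilon>" shows "sp_equivariant (soft_correlation \<epsilon>)"
proof -
  have "soft_part \<epsilon> (permute_rows g U $ i) x = of_int (snd g i) * soft_part \<epsilon> (U $ fst g i) x"
    if g: "g \<in> signed_perms" for g i x and U :: "real ^ 'n ^ 'n"
  proof -
    have "permute_rows g U $ i = of_int (snd g i) *\<^sub>R (U $ fst g i)"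
      by (simp add: permute_rows_def vec_eq_iff)
    then show ?thesis using sp_sign[OF g, of i] soft_part_minus[OF e] by auto
  qed
  then show ?thesis
    by (simp add: sp_equivariant_def soft_correlation_def conjugate_def vec_eq_iff mult_ac
        flip: integral_mult_right_zero)
qed

lemma soft_quarter_median:
  assumes e: "0 < \<epsilon>"
  shows "\<exists>U. orthogonal_matrix U \<and>
    (\<forall>i j. i \<noteq> j \<longrightarrow> (\<integral>x. soft_part \<epsilon> (U $ i) x * soft_part \<epsilon> (U $ j) x \<partial>P) = 0)"
  using equivariant_common_zero[OF soft_correlation_continuous[OF e] _ soft_correlation_equivariant[OF e]]
  by (simp add: soft_correlation_def mult.commute)

text \<open>
Outside \<open>V\<close> the weights vanish in the limit, so their whole expectation \<open>q\<close> has to come from \<open>V\<close>,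
where they are at most 1. On the boundary of \<open>V\<close> the weights may oscillate, and only this bound enters there.
\<close>

lemma measure_ge_limit:
  assumes V: "V \<in> sets P" and meas: "\<And>k. u k \<in> borel_measurable P"
    and bd: "\<And>k x. 0 \<le> u k x \<and> u k x \<le> 1" and int: "\<And>k. (\<integral>x. u k x \<partial>P) = q"
    and lim: "\<And>x. x \<notin> V \<Longrightarrow> (\<lambda>k. u k x) \<longlonglongrightarrow> (0 :: real)"
  shows "q \<le> measure P V"
proof -
  have nV: "- V \<in> sets P" using V by (simp add: sets_P borel_comp)
  have "(\<lambda>k. \<integral>x. u k x * indicator (- V) x \<partial>P) \<longlonglongrightarrow> (\<integral>x. 0 \<partial>P)"
  proof (rule integral_dominated_convergence[where w = "\<lambda>_. 1"])
    show "AE x in P. (\<lambda>k. u k x * indicator (- V) x) \<longlonglongrightarrow> 0"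
    proof (rule AE_I2)
      fix x show "(\<lambda>k. u k x * indicator (- V) x) \<longlonglongrightarrow> 0"
        using lim[of x] by (cases "x \<in> V") auto
    qed
    show "(\<lambda>x. u k x * indicator (- V) x) \<in> borel_measurable P" for k
      by (intro borel_measurable_times borel_measurable_indicator meas nV)
    show "AE x in P. norm (u k x * indicator (- V) x) \<le> 1" for k
      using bd by (intro AE_I2) (auto simp: indicator_def)
  qed (use meas in auto)
  then have "(\<lambda>k. (\<integral>x. u k x * indicator (- V) x \<partial>P) + measure P V) \<longlonglongrightarrow> 0 + measure P V"
    by (intro tendsto_add tendsto_const) simp
  moreover have "q \<le> (\<integral>x. u k x * indicator (- V) x \<partial>P) + measure P V" for k
  proof -
    have i: "integrable P (\<lambda>x. u k x * indicator (- V) x)"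
    proof (rule integrable_const_bound[of _ 1])
      show "AE x in P. norm (u k x * indicator (- V) x) \<le> 1"
        using bd by (intro AE_I2) (auto simp: indicator_def)
    qed (intro borel_measurable_times borel_measurable_indicator meas nV)
    have "q = (\<integral>x. u k x \<partial>P)" using int by simp
    also have "\<dots> \<le> (\<integral>x. u k x * indicator (- V) x + indicator V x \<partial>P)"
    proof (rule integral_mono)
      show "integrable P (u k)"
        by (rule integrable_const_bound[of _ 1]) (use bd meas in auto)
      show "integrable P (\<lambda>x. u k x * indicator (- V) x + indicator V x)"
        using V by (intro Bochner_Integration.integrable_add i integrable_real_indicator) (auto simp: emeasure_eq_measure)
      fix x show "u k x \<le> u k x * indicator (- V) x + indicator V x"
        using bd[of k x] by (auto simp: indicator_def)
    qed
    also have "\<dots> = (\<integral>x. u k x * indicator (- V) x \<partial>P) + measure P V"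
      using V i by (subst Bochner_Integration.integral_add) (auto simp: emeasure_eq_measure intro!: integrable_real_indicator)
    finally show ?thesis .
  qed
  ultimately show ?thesis
    using LIMSEQ_le_const[of _ "0 + measure P V" q] by auto
qed

text \<open>
Orthogonal matrices and their soft medians range over a bounded set. The medians along the
rows of the limit \<open>U\<close> are the coordinates of the centre \<open>\<theta>\<close> in the orthonormal basis of these rows.
\<close>

lemma soft_medians_converge:
  assumes e: "\<And>k. 0 < \<epsilon> k" "\<epsilon> \<longlonglongrightarrow> 0" and U: "\<And>k. orthogonal_matrix (V k)"
  obtains s U \<theta> where "strict_mono s" "orthogonal_matrix U" "(V \<circ> s) \<longlonglongrightarrow> U"
    "\<And>i. (\<lambda>k. soft_median (\<epsilon> (s k)) (V (s k) $ i)) \<longlonglongrightarrow> U $ i \<bullet> \<theta>"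
proof -
  obtain R where R: "0 < R" "3 / 4 < measure P (cball 0 R)" using bounded_mass by blast
  obtain B where B: "\<And>k. \<epsilon> k \<le> B"
    using convergent_imp_Bseq[of \<epsilon>] e(2) by (auto simp: convergent_def Bseq_def abs_le_iff)
  have n1: "norm (V k $ i) = 1" for k i
    using U[of k] by (metis orthogonal_matrix_orthonormal_rows row_def vec_nth_inverse vec_lambda_eta)
  define m where "m k = (\<chi> i. soft_median (\<epsilon> k) (V k $ i))" for k
  have mb: "norm (m k) \<le> (\<Sum>i\<in>(UNIV::'n set). R + B)" for k
  proof (rule order_trans[OF norm_le_l1_cart], rule sum_mono)
    fix i
    have "\<bar>soft_median (\<epsilon> k) (V k $ i)\<bar> \<le> norm (V k $ i) * R + \<epsilon> k"
      by (rule soft_median_bound[OF e(1) R(2)])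
    then show "\<bar>m k $ i\<bar> \<le> R + B" using B[of k] by (simp add: m_def n1)
  qed
  have Vb: "norm (V k) \<le> (\<Sum>i\<in>(UNIV::'n set). 1)" for k
  proof -
    have "norm (V k) \<le> (\<Sum>i\<in>UNIV. norm (V k $ i))" unfolding norm_vec_def by (rule L2_set_le_sum) simp
    then show ?thesis by (simp add: n1)
  qed
  have "bounded (range (\<lambda>k. (V k, m k)))"
    unfolding bounded_iff
    using order_trans[OF norm_Pair_le add_mono[OF Vb mb]] by blast
  then obtain l s where s: "strict_mono s" "((\<lambda>k. (V k, m k)) \<circ> s) \<longlonglongrightarrow> l"
    using bounded_imp_convergent_subsequence by blast
  define U where "U = fst l"
  have VU: "(V \<circ> s) \<longlonglongrightarrow> U" using tendsto_fst[OF s(2)] by (simp add: U_def comp_def)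
  have mm: "(\<lambda>k. m (s k)) \<longlonglongrightarrow> snd l" using tendsto_snd[OF s(2)] by (simp add: comp_def)
  have "closed {X :: real ^ 'n ^ 'n. gram X = mat 1}"
    by (intro closed_Collect_eq continuous_gram continuous_on_const)
  moreover have iff: "orthogonal_matrix X \<longleftrightarrow> gram X = mat 1" for X :: "real ^ 'n ^ 'n"
  proof -
    have "X ** transpose X = gram X"
      by (simp add: matrix_matrix_mult_def transpose_def gram_def inner_vec_def vec_eq_iff)
    then show ?thesis unfolding orthogonal_matrix_def using matrix_left_right_inverse by metis
  qed
  ultimately have oU: "orthogonal_matrix U"
    using closed_sequentially[of "{X. gram X = mat 1}" "V \<circ> s" U] VU U by simp
  define \<theta> where "\<theta> = transpose U *v snd l"
  have "U *v \<theta> = snd l"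
    using oU unfolding \<theta>_def matrix_vector_mul_assoc orthogonal_matrix_def
    by (simp only: matrix_vector_mul_lid)
  then have "U $ i \<bullet> \<theta> = snd l $ i" for i
    by (metis matrix_vector_mul_component)
  moreover have "(\<lambda>k. m (s k) $ i) \<longlonglongrightarrow> snd l $ i" for i by (intro tendsto_intros mm)
  ultimately show ?thesis using that[OF s(1) oU VU, of \<theta>] by (simp add: m_def)
qed

lemma soft_part_tendsto:
  assumes "e \<longlonglongrightarrow> 0" "b \<longlonglongrightarrow> b0" "(\<lambda>k. soft_median (e k) (b k)) \<longlonglongrightarrow> b0 \<bullet> \<theta>"
  shows "0 < b0 \<bullet> (x - \<theta>) \<Longrightarrow> (\<lambda>k. soft_part (e k) (b k) x) \<longlonglongrightarrow> 1"
    and "b0 \<bullet> (x - \<theta>) < 0 \<Longrightarrow> (\<lambda>k. soft_part (e k) (b k) x) \<longlonglongrightarrow> - 1"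
proof -
  have lim: "(\<lambda>k. b k \<bullet> x - soft_median (e k) (b k)) \<longlonglongrightarrow> b0 \<bullet> (x - \<theta>)"
    unfolding inner_diff_right by (intro tendsto_intros assms)
  show "0 < b0 \<bullet> (x - \<theta>) \<Longrightarrow> (\<lambda>k. soft_part (e k) (b k) x) \<longlonglongrightarrow> 1"
    unfolding soft_part_def by (rule soft_sign_tendsto_1[OF lim _ assms(1)])
  assume "b0 \<bullet> (x - \<theta>) < 0"
  then have "(\<lambda>k. soft_sign (e k) (- (b k \<bullet> x - soft_median (e k) (b k)))) \<longlonglongrightarrow> 1"
    by (intro soft_sign_tendsto_1[OF tendsto_minus[OF lim] _ assms(1)]) simp
  then show "(\<lambda>k. soft_part (e k) (b k) x) \<longlonglongrightarrow> - 1"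
    unfolding soft_part_def soft_sign_minus using tendsto_minus_cancel_left by fastforce
qed

definition sign_value :: "sign \<Rightarrow> real" where
  "sign_value s = (case s of Plus \<Rightarrow> 1 | Minus \<Rightarrow> - 1)"

lemma half_space_sets: "half_space s a b \<in> sets P"
proof -
  have "closed (half_space s a b)"
    by (cases s) (auto intro!: closed_Collect_le continuous_intros)
  then show ?thesis by (simp add: sets_P borel_closed)
qed

lemma half_weight:
  assumes "0 < \<epsilon>"
  shows "0 \<le> (1 + sign_value s * soft_part \<epsilon> b x) / 2 \<and> (1 + sign_value s * soft_part \<epsilon> b x) / 2 \<le> 1"
  using soft_part_bound[OF assms, of b x] by (cases s) (auto simp: sign_value_def abs_le_iff)

lemma half_weight_tendsto:
  assumes "e \<longlonglongrightarrow> 0" "b \<longlonglongrightarrow> b0" "(\<lambda>k. soft_median (e k) (b k)) \<longlonglongrightarrow> b0 \<bullet> \<theta>" "x \<notin> half_space s \<theta> b0"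
  shows "(\<lambda>k. (1 + sign_value s * soft_part (e k) (b k) x) / 2) \<longlonglongrightarrow> 0"
proof -
  have "(\<lambda>k. soft_part (e k) (b k) x) \<longlonglongrightarrow> - sign_value s"
    using soft_part_tendsto[OF assms(1-3), of x] assms(4) by (cases s) (auto simp: sign_value_def)
  then have "(\<lambda>k. (1 + sign_value s * soft_part (e k) (b k) x) / 2) \<longlonglongrightarrow> (1 + sign_value s * - sign_value s) / 2"
    by (intro tendsto_intros) auto
  then show ?thesis by (cases s) (simp_all add: sign_value_def)
qed

theorem quarter_median_exists: "\<exists>\<theta> U. quarter_median_solution P \<theta> U"
proof -
  define e where "e k = 1 / real (Suc k)" for k
  have e: "0 < e k" for k by (simp add: e_def)
  have e0: "e \<longlonglongrightarrow> 0" unfolding e_def by (rule LIMSEQ_Suc[OF lim_1_over_n])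
  obtain V where V: "\<And>k. orthogonal_matrix (V k)" "\<And>k i j. i \<noteq> j \<Longrightarrow>
      (\<integral>x. soft_part (e k) (V k $ i) x * soft_part (e k) (V k $ j) x \<partial>P) = 0"
    using soft_quarter_median[OF e] by metis
  obtain s U \<theta> where s: "strict_mono s" and U: "orthogonal_matrix U" and VU: "(V \<circ> s) \<longlonglongrightarrow> U"
    and med: "\<And>i. (\<lambda>k. soft_median (e (s k)) (V (s k) $ i)) \<longlonglongrightarrow> U $ i \<bullet> \<theta>"
  proof (rule soft_medians_converge[where V = V and \<epsilon> = e, OF e e0 V(1)])
    fix s U \<theta>
    assume "strict_mono s" "orthogonal_matrix U" "(V \<circ> s) \<longlonglongrightarrow> U"
      "\<And>i. (\<lambda>k. soft_median (e (s k)) (V (s k) $ i)) \<longlonglongrightarrow> U $ i \<bullet> \<theta>"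
    then show thesis by (rule that)
  qed
  have es: "(\<lambda>k. e (s k)) \<longlonglongrightarrow> 0" using LIMSEQ_subseq_LIMSEQ[OF e0 s] by (simp add: comp_def)
  have Vi: "(\<lambda>k. V (s k) $ i) \<longlonglongrightarrow> U $ i" for i
    using tendsto_vec_nth[OF VU] by (simp add: comp_def)
  define w where "w \<sigma> i k x = (1 + sign_value \<sigma> * soft_part (e (s k)) (V (s k) $ i) x) / 2" for \<sigma> i k x
  have wb: "0 \<le> w \<sigma> i k x \<and> w \<sigma> i k x \<le> 1" for \<sigma> i k x unfolding w_def by (rule half_weight[OF e])
  have wm: "w \<sigma> i k \<in> borel_measurable P" for \<sigma> i k unfolding w_def by measurable
  have w0: "(\<lambda>k. w \<sigma> i k x) \<longlonglongrightarrow> 0" if "x \<notin> half_space \<sigma> \<theta> (U $ i)" for \<sigma> i x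
    unfolding w_def by (rule half_weight_tendsto[OF es Vi med that])
  have int1: "integrable P (soft_part (e k) b)" for k b
    by (rule integrable_const_bound[of _ 1]) (use soft_part_bound[OF e] in auto)
  have int2: "integrable P (\<lambda>x. soft_part (e k) b x * soft_part (e k) b' x)" for k b b'
    by (rule integrable_const_bound[of _ 1]) (use soft_part_bound[OF e] in \<open>auto simp: abs_mult mult_le_one\<close>)
  have half: "1 / 2 \<le> measure P (half_space \<sigma> \<theta> (U $ i))" for \<sigma> i
  proof (rule measure_ge_limit[where u = "w \<sigma> i"])
    show "(\<integral>x. w \<sigma> i k x \<partial>P) = 1 / 2" for k
      unfolding w_def using int1 expectation_soft_part[OF e] by (simp add: prob_space)
  qed (use half_space_sets wm wb w0 in auto)
  have quarter: "1 / 4 \<le> measure P (half_space \<sigma> \<theta> (U $ i) \<inter> half_space \<sigma>' \<theta> (U $ j))" if ij: "i \<noteq> j" for \<sigma> \<sigma>' i j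
  proof (rule measure_ge_limit[where u = "\<lambda>k x. w \<sigma> i k x * w \<sigma>' j k x"])
    show "(\<integral>x. w \<sigma> i k x * w \<sigma>' j k x \<partial>P) = 1 / 4" for k
    proof -
      \<comment> \<open>the means of the soft signs and of their product vanish, so only the constant term survives\<close>
      let ?p = "\<lambda>i x. soft_part (e (s k)) (V (s k) $ i) x"
      have "w \<sigma> i k x * w \<sigma>' j k x = 1 / 4 + (sign_value \<sigma> / 4) * ?p i x + (sign_value \<sigma>' / 4) * ?p j x
          + (sign_value \<sigma> * sign_value \<sigma>' / 4) * (?p i x * ?p j x)" for x
        by (simp add: w_def field_simps)
      then show ?thesis
        using int1 int2 expectation_soft_part[OF e] V(2)[OF ij] by (simp add: prob_space)
    qed
    show "(\<lambda>k. w \<sigma> i k x * w \<sigma>' j k x) \<longlonglongrightarrow> 0"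
      if x: "x \<notin> half_space \<sigma> \<theta> (U $ i) \<inter> half_space \<sigma>' \<theta> (U $ j)" for x
    proof (cases "x \<in> half_space \<sigma> \<theta> (U $ i)")
      case True
      then have lim: "(\<lambda>k. w \<sigma>' j k x) \<longlonglongrightarrow> 0" using x w0 by blast
      show ?thesis
        by (rule tendsto_sandwich[OF _ _ tendsto_const lim]) (use wb in \<open>auto simp: mult_left_le_one_le\<close>)
    next
      case False
      then have lim: "(\<lambda>k. w \<sigma> i k x) \<longlonglongrightarrow> 0" using w0 by blast
      show ?thesis
        by (rule tendsto_sandwich[OF _ _ tendsto_const lim]) (use wb in \<open>auto simp: mult_left_le\<close>)
    qed
  qed (use half_space_sets wm wb in \<open>auto simp: mult_le_one\<close>)
  have row: "row i U = U $ i" for i by (simp add: row_def vec_eq_iff)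
  have "quarter_median_solution P \<theta> U"
    unfolding quarter_median_solution_def quarter_space_def row
    using U half quarter by blast
  then show ?thesis by blast
qed

end

theorem theorem1:
  fixes P :: "(real ^ 'n) measure"
  assumes "CARD('n) \<ge> 2"
    and "prob_space P"
    and "sets P = sets borel"
  shows "\<exists>(\<theta> :: real ^ 'n) (U :: real ^ 'n ^ 'n). quarter_median_solution P \<theta> U"
proof -
  interpret borel_distribution P
    using assms by (simp add: borel_distribution_def borel_distribution_axioms_def)
  show ?thesis by (rule quarter_median_exists)
qed

end
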